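(* Let $1\leq b\leq 2$ be a real number, and suppose that for every compact set $A\subset\mathbb{R}^2$ one has $\dim_{\mathrm H}\operatorname{Vis}_v(A)\leq b$ for $\mathcal{H}^1$-almost every $v\in S^1$. Then, for every integer $d\geq 3$ and every compact set $K\subset\mathbb{R}^d$, $$\dim_{\mathrm H}\operatorname{Vis}_e(K)\leq\min\{\dim_{\mathrm H}K,\ d-2+b\}\qquad\text{for } \mathcal{H}^{d-1}\text{-almost every } e\in S^{d-1}.$$
   Context: $S^{n-1}$ is the unit sphere of $\mathbb{R}^n$, $\dim_{\mathrm H}$ denotes Hausdorff dimension, and $\mathcal{H}^{s}$ denotes $s$-dimensional Hausdorff measure. For $n\ge 2$, a compact set $K\subset\mathbb{R}^n$ and a direction $e\in S^{n-1}$, the visible part of $K$ along $e$ is $$\operatorname{Vis}_e(K)=\{x\in K:\ (x+[0,\infty)e)\cap K=\{x\}\},$$ where $x+[0,\infty)e=\{x+te: t\ge 0\}$. *)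

theory Defs
  imports "HOL-Analysis.Analysis"
begin

(* The summand diam(U)^s of the Hausdorff premeasure, with the conventions that the empty set
   contributes 0 and that diam(U)^0 = 1 for nonempty U. The case s = 0 is separate because
   0 powr 0 = 0 in HOL, which would give singletons no weight. *)
definition hausdorff_weight :: "real \<Rightarrow> 'a::metric_space set \<Rightarrow> ennreal" where
  "hausdorff_weight s U =
    (if U = {} then 0 else if s = 0 then 1 else ennreal (diameter U powr s))"

(* Covering sets are required to be bounded because diameter is unspecified on unbounded sets. *)
definition hausdorff_premeasure :: "real \<Rightarrow> real \<Rightarrow> 'a::metric_space set \<Rightarrow> ennreal" where
  "hausdorff_premeasure s \<delta> A =
    (INF U \<in> {U :: nat \<Rightarrow> 'a set. A \<subseteq> (\<Union>i. U i) \<and> (\<forall>i. bounded (U i) \<and> diameter (U i) \<le> \<delta>)}.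
       \<Sum>i. hausdorff_weight s (U i))"

(* The s-dimensional Hausdorff (outer) measure for s \<ge> 0, defined on all sets, without a
   normalising constant. *)
definition hausdorff_measure :: "real \<Rightarrow> 'a::metric_space set \<Rightarrow> ennreal" where
  "hausdorff_measure s A = (SUP \<delta> \<in> {0<..}. hausdorff_premeasure s \<delta> A)"

(* The infimum is taken in ereal, so the value is \<infinity> if no exponent qualifies;
   the empty set has dimension 0. *)
definition hausdorff_dim :: "'a::metric_space set \<Rightarrow> ereal" where
  "hausdorff_dim A = (INF s \<in> {s. 0 \<le> s \<and> hausdorff_measure s A = 0}. ereal s)"

definition hausdorff_ae :: "real \<Rightarrow> 'a::metric_space set \<Rightarrow> ('a \<Rightarrow> bool) \<Rightarrow> bool" where
  "hausdorff_ae s S P \<longleftrightarrow> hausdorff_measure s {x \<in> S. \<not> P x} = 0"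

definition visible_part :: "'a::real_normed_vector \<Rightarrow> 'a set \<Rightarrow> 'a set" where
  "visible_part e K = {x \<in> K. {x + t *\<^sub>R e | t. 0 \<le> t} \<inter> K = {x}}"

end

theory Submission
  imports Defs
begin

text \<open>
  Write \<open>d\<close> for the dimension of the ambient space. The theorem is a slicing argument. If a
  direction \<open>e\<close> lies in a plane \<open>W\<close>, then for every translate \<open>a + W\<close> the visible part of \<open>K\<close>
  along \<open>e\<close> meets \<open>a + W\<close> in the visible part of the planar compact set \<open>K \<inter> (a + W)\<close>. Suppose
  that \<open>Vis\<^sub>e(K)\<close> had dimension larger than \<open>d - 2 + b\<close> for a set of directions \<open>e\<close> that is not null.
  If such a set also had slices of dimension larger than \<open>b\<close> by many translates of many planes
  through \<open>e\<close>, then Fubini would produce one fixed translate \<open>a + W\<close> and a set of positive measure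
  of directions \<open>e\<close> in \<open>W\<close> for which \<open>Vis\<^sub>e(K \<inter> (a + W))\<close> has dimension larger than \<open>b\<close>. The planar
  hypothesis forbids this.

  Two points need work. The first is the slicing theorem. Only planes containing the given \<open>e\<close> are
  allowed, and for this restricted family Marstrand's theorem fails in general. It holds for sets of
  dimension \<open>s > d - 1\<close>, and this is where \<open>b \<ge> 1\<close> enters. Planes are parametrised as
  \<open>a + span(w, e)\<close> with \<open>a\<close> and \<open>w\<close> ranging over full-dimensional sets. For a density \<open>f\<close> that gives
  every cube of side \<open>r\<close> mass at most a multiple of \<open>r powr s\<close>, substituting \<open>x = z + h w\<close> in the variable
  \<open>w\<close> turns the average over \<open>w\<close> of the integral of \<open>f\<close> on the small parallelogram at \<open>z\<close> with sides \<open>\<rho> w\<close>, \<open>\<rho> e\<close>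
  into an integral of \<open>\<bar>h\<bar> powr (s - d)\<close>, which converges because \<open>s > d - 1\<close>, and which gives a
  bound of order \<open>\<rho> powr (s - d + 2)\<close> (\<open>parallelogram_average\<close>). Hence the average
  \<open>t\<close>-energy of the slices of \<open>f\<close> is finite for \<open>t < s - d + 2\<close>, so many slices carry mass with small
  energy and cannot be covered cheaply (\<open>emeasure_costly_planes_ge\<close>). Applying this to
  Frostman densities on finer and finer dyadic cubes (\<open>discrete_frostman\<close>) and passing to the limit
  by compactness gives the slicing theorem for compact sets (\<open>slices_not_small_cover\<close>) without
  constructing a limit measure.

  The second point is measurability. The pairs \<open>(e, x)\<close> with \<open>x \<in> Vis\<^sub>e(K)\<close> form only a G-delta set,
  whereas both the limiting argument and Fubini need closed sets. Choquet's capacitability argument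
  replaces the G-delta set by a compact subset that still has large sections over a set of \<open>e\<close> of
  positive measure (\<open>compact_section_not_small_cover\<close>). It requires a content that is continuous along
  increasing sequences of arbitrary sets. The dyadic content has this property
  (\<open>tree_content_Union_incseq\<close>), while coverings by open balls supply the semicontinuity on
  compact sets; the two contents are comparable up to constants.

  Null sets of the sphere are compared with Lebesgue null sets of cones
  (\<open>hausdorff_null_of_null_cone\<close>, \<open>null_of_hausdorff_null_directions\<close>), which is legitimate because
  the visible part does not depend on the length of \<open>e\<close>.
\<close>

section \<open>Hausdorff measure and coverings by balls\<close>

text \<open>The negation says that the Hausdorff content of dimension \<open>t\<close>, computed with open balls, is at least
  \<open>k\<close>. Open balls make this a closed condition on compact sets; radius \<open>0\<close> gives the empty ball, so
  finite coverings are included.\<close>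

definition small_cover :: "real \<Rightarrow> real \<Rightarrow> 'a::metric_space set \<Rightarrow> bool" where
  "small_cover t k S \<longleftrightarrow>
    (\<exists>c r. (\<forall>i::nat. 0 \<le> r i) \<and> S \<subseteq> (\<Union>i. ball (c i) (r i)) \<and>
      (\<Sum>i. ennreal (r i powr t)) < ennreal k)"

lemma small_cover_subset: "small_cover t k S \<Longrightarrow> T \<subseteq> S \<Longrightarrow> small_cover t k T"
  unfolding small_cover_def by (meson subset_trans)

lemma small_cover_mono: "small_cover t k S \<Longrightarrow> k \<le> l \<Longrightarrow> small_cover t l S"
  unfolding small_cover_def by (meson ennreal_leI order_less_le_trans)

lemma small_cover_empty: "0 < k \<Longrightarrow> small_cover t k {}"
proof -
  assume "0 < k"
  then have k: "0 < ennreal k" by simp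
  have "(\<Sum>i::nat. ennreal (0 powr t)) = 0" by (simp only: powr_0 ennreal_0 suminf_zero)
  with k have "(\<Sum>i::nat. ennreal (0 powr t)) < ennreal k" by (simp only:)
  then show ?thesis unfolding small_cover_def
    by (intro exI[of _ "\<lambda>_. undefined"] exI[of _ "\<lambda>_. 0::real"] conjI allI order_refl empty_subsetI)
qed

lemma small_cover_lipschitz_image:
  fixes g :: "'a::metric_space \<Rightarrow> 'b::metric_space"
  assumes S: "small_cover t k S" and L: "L > 0"
    and lip: "\<And>x y. dist (g x) (g y) \<le> L * dist x y"
  shows "small_cover t (L powr t * k) (g ` S)"
proof -
  obtain c r where r: "\<And>i::nat. 0 \<le> r i" and cov: "S \<subseteq> (\<Union>i. ball (c i) (r i))"
    and sum: "(\<Sum>i. ennreal (r i powr t)) < ennreal k"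
    using S unfolding small_cover_def by blast
  have "g ` S \<subseteq> (\<Union>i. ball (g (c i)) (L * r i))"
  proof
    fix y assume "y \<in> g ` S"
    then obtain x i where x: "y = g x" "dist (c i) x < r i" using cov by fastforce
    have "dist (g (c i)) y < L * r i"
      using lip[of "c i" x] x L by (smt (verit) mult_strict_left_mono)
    then show "y \<in> (\<Union>i. ball (g (c i)) (L * r i))" by auto
  qed
  moreover have "(\<Sum>i. ennreal ((L * r i) powr t)) < ennreal (L powr t * k)"
  proof -
    have "(\<Sum>i. ennreal ((L * r i) powr t)) = (\<Sum>i. ennreal (L powr t) * ennreal (r i powr t))"
      using r L by (simp add: powr_mult ennreal_mult)
    also have "\<dots> = ennreal (L powr t) * (\<Sum>i. ennreal (r i powr t))"
      by (rule ennreal_suminf_cmult)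
    also have "\<dots> < ennreal (L powr t) * ennreal k"
      using sum L by (intro ennreal_mult_strict_left_mono) (auto simp: ennreal_zero_less_mult_iff)
    also have "\<dots> = ennreal (L powr t * k)"
      by (metis ennreal_mult' powr_ge_zero)
    finally show ?thesis .
  qed
  ultimately show ?thesis
    unfolding small_cover_def using r L
    by (intro exI[of _ "\<lambda>i. g (c i)"] exI[of _ "\<lambda>i. L * r i"]) auto
qed

lemma hausdorff_premeasure_antimono:
  "\<delta> \<le> \<delta>' \<Longrightarrow> hausdorff_premeasure s \<delta>' A \<le> hausdorff_premeasure s \<delta> A"
  unfolding hausdorff_premeasure_def
  by (rule INF_superset_mono) (auto intro: order_trans)

lemma hausdorff_premeasure_le_measure:
  "\<delta> > 0 \<Longrightarrow> hausdorff_premeasure s \<delta> A \<le> hausdorff_measure s A"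
  unfolding hausdorff_measure_def by (rule SUP_upper) auto

lemma hausdorff_measure_subset:
  "A \<subseteq> B \<Longrightarrow> hausdorff_measure s A \<le> hausdorff_measure s B"
  unfolding hausdorff_measure_def hausdorff_premeasure_def
  by (intro SUP_mono bexI INF_superset_mono) auto

lemma hausdorff_dim_subset: "A \<subseteq> B \<Longrightarrow> hausdorff_dim A \<le> hausdorff_dim B"
  unfolding hausdorff_dim_def
  by (intro INF_superset_mono Collect_mono)
    (auto, metis hausdorff_measure_subset le_zero_eq)

lemma hausdorff_measure_mono_exponent:
  assumes "0 \<le> s" "s \<le> t" "hausdorff_measure s A = 0"
  shows "hausdorff_measure t A = 0"
proof -
  have w: "hausdorff_weight t U \<le> hausdorff_weight s U"
    if "diameter U \<le> 1" "bounded U" for U :: "'a set"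
    using that assms(1,2) diameter_ge_0[of U] powr_mono'[of s t "diameter U"]
    by (auto simp: hausdorff_weight_def ennreal_leI powr_le1)
  have "hausdorff_premeasure t \<delta> A \<le> hausdorff_measure s A" if "\<delta> > 0" for \<delta>
  proof -
    have "hausdorff_premeasure t \<delta> A \<le> hausdorff_premeasure t (min \<delta> 1) A"
      by (rule hausdorff_premeasure_antimono) simp
    also have "\<dots> \<le> hausdorff_premeasure s (min \<delta> 1) A"
      unfolding hausdorff_premeasure_def
      by (rule INF_mono) (force intro!: suminf_le w)
    also have "\<dots> \<le> hausdorff_measure s A"
      using that by (intro hausdorff_premeasure_le_measure) simp
    finally show ?thesis .
  qed
  then show ?thesis
    using assms(3) unfolding hausdorff_measure_def[of t] by (simp add: SUP_eq_iff)
qed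

lemma hausdorff_measure_0_above_dim:
  assumes "hausdorff_dim A < ereal t"
  shows "hausdorff_measure t A = 0"
proof -
  obtain s where "0 \<le> s" "hausdorff_measure s A = 0" "s < t"
    using assms unfolding hausdorff_dim_def INF_less_iff by auto
  then show ?thesis using hausdorff_measure_mono_exponent[of s t A] by simp
qed

lemma hausdorff_dim_le_if_null_above:
  assumes v: "0 \<le> v" and N: "\<And>n::nat. n \<ge> m \<Longrightarrow> hausdorff_measure (v + 1 / real (Suc n)) A = 0"
  shows "hausdorff_dim A \<le> ereal v"
proof (rule ccontr)
  assume "\<not> ?thesis"
  then obtain u where u: "ereal v < ereal u" "ereal u < hausdorff_dim A"
    by (metis ereal_dense2 not_le)
  then have "u - v > 0" by simp
  obtain n where n: "1 / real (Suc n) < u - v"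
    using \<open>u - v > 0\<close> nat_approx_posE by (metis inverse_eq_divide)
  have "1 / real (Suc (max m n)) \<le> 1 / real (Suc n)"
    by (intro divide_left_mono) auto
  then have "v + 1 / real (Suc (max m n)) < u" using n by linarith
  moreover have "hausdorff_dim A \<le> ereal (v + 1 / real (Suc (max m n)))"
    unfolding hausdorff_dim_def
    by (rule INF_lower) (use v N[of "max m n"] in auto)
  ultimately have "hausdorff_dim A < ereal u" by (simp add: le_less_trans)
  then show False using u(2) by simp
qed

text \<open>A covering set is enclosed in a ball around one of its points whose radius exceeds the diameter by
  a summable amount; the excess is needed because the ball is open and the diameter may be \<open>0\<close>.\<close>

lemma small_cover_if_hausdorff_null:
  fixes S :: "'a::metric_space set"
  assumes t: "t > 0" and H: "hausdorff_measure t S = 0" and k: "k > 0"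
  shows "small_cover t k S"
proof -
  define \<epsilon> where "\<epsilon> = k / (4 * 2 powr t)"
  have e: "\<epsilon> > 0" using k by (simp add: \<epsilon>_def)
  have "hausdorff_premeasure t 1 S \<le> 0"
    using hausdorff_premeasure_le_measure[of 1 t S] H by simp
  then have "hausdorff_premeasure t 1 S < ennreal \<epsilon>" using e by (simp add: le_less_trans)
  then obtain U :: "nat \<Rightarrow> 'a set" where U: "S \<subseteq> (\<Union>i. U i)" "\<And>i. bounded (U i)"
    and sU: "(\<Sum>i. hausdorff_weight t (U i)) < ennreal \<epsilon>"
    unfolding hausdorff_premeasure_def INF_less_iff by auto
  define h where "h i = (\<epsilon> * (1/2) ^ Suc i) powr (1/t)" for i
  have h: "h i > 0" for i using e by (simp add: h_def)
  have ht: "h i powr t = \<epsilon> * (1/2) ^ Suc i" for i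
    using e t by (simp add: h_def powr_powr)
  define c where "c i = (SOME x. x \<in> U i)" for i
  define r where "r i = (if U i = {} then 0 else diameter (U i) + h i)" for i
  have r: "r i \<ge> 0" for i using h[of i] diameter_ge_0[OF U(2)] by (simp add: r_def)
  have "S \<subseteq> (\<Union>i. ball (c i) (r i))"
  proof
    fix x assume "x \<in> S"
    then obtain i where i: "x \<in> U i" using U(1) by blast
    then have "c i \<in> U i" unfolding c_def by (metis someI)
    then have "dist (c i) x \<le> diameter (U i)"
      using i U(2) by (intro diameter_bounded_bound) auto
    then have "x \<in> ball (c i) (r i)" using i h[of i] by (auto simp: r_def)
    then show "x \<in> (\<Union>i. ball (c i) (r i))" by blast
  qed
  moreover have "(\<Sum>i. ennreal (r i powr t)) < ennreal k"
  proof -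
    have le: "ennreal (r i powr t) \<le> ennreal (2 powr t) *
        (hausdorff_weight t (U i) + ennreal (\<epsilon> * (1/2) ^ Suc i))" for i
    proof (cases "U i = {}")
      case True then show ?thesis using t by (simp add: r_def)
    next
      case False
      define m where "m = max (diameter (U i)) (h i)"
      have "r i powr t \<le> (2 * m) powr t"
        using t r[of i] False by (intro powr_mono2) (auto simp: r_def m_def)
      also have "\<dots> = 2 powr t * m powr t"
        using h[of i] by (simp add: powr_mult m_def)
      also have "m powr t \<le> diameter (U i) powr t + h i powr t"
        by (auto simp: m_def max_def)
      finally have "r i powr t \<le> 2 powr t * (diameter (U i) powr t + \<epsilon> * (1/2) ^ Suc i)"
        by (simp add: ht mult_left_mono)
      then have "ennreal (r i powr t) \<le> ennreal (2 powr t * (diameter (U i) powr t + \<epsilon> * (1/2) ^ Suc i))"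
        by (rule ennreal_leI)
      also have "\<dots> = ennreal (2 powr t) * (hausdorff_weight t (U i) + ennreal (\<epsilon> * (1/2) ^ Suc i))"
        using False t e by (simp add: ennreal_mult hausdorff_weight_def ennreal_plus[symmetric] del: ennreal_plus)
      finally show ?thesis .
    qed
    have "(\<lambda>i. \<epsilon> * (1/2::real) ^ Suc i) sums (\<epsilon> * 1)"
      using power_half_series by (rule sums_mult)
    then have s2: "(\<Sum>i. ennreal (\<epsilon> * (1/2) ^ Suc i)) = ennreal \<epsilon>"
      by (intro suminf_ennreal_eq) (use e in auto)
    have "(\<Sum>i. ennreal (r i powr t)) \<le> (\<Sum>i. ennreal (2 powr t) *
        (hausdorff_weight t (U i) + ennreal (\<epsilon> * (1/2) ^ Suc i)))"
      by (intro suminf_le le) auto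
    also have "\<dots> = ennreal (2 powr t) * ((\<Sum>i. hausdorff_weight t (U i)) + ennreal \<epsilon>)"
      unfolding ennreal_suminf_cmult s2[symmetric] by (subst suminf_add) auto
    also have "\<dots> \<le> ennreal (2 powr t) * (ennreal \<epsilon> + ennreal \<epsilon>)"
      using sU by (intro mult_left_mono add_right_mono) auto
    also have "\<dots> = ennreal (2 powr t * (2 * \<epsilon>))"
      using e by (simp add: ennreal_mult ennreal_plus[symmetric] del: ennreal_plus)
    also have "\<dots> < ennreal k"
      using k by (intro ennreal_lessI) (auto simp: \<epsilon>_def)
    finally show ?thesis .
  qed
  ultimately show ?thesis unfolding small_cover_def using r by blast
qed

lemma term_le_suminf_ennreal: "f i \<le> (\<Sum>i. f i)" for f :: "nat \<Rightarrow> ennreal"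
proof -
  have "sum f {i} \<le> suminf f" by (rule sum_le_suminf) (auto intro: summableI)
  then show ?thesis by simp
qed

text \<open>A small total \<open>t\<close>-weight forces every radius to be small, so the restriction on the diameters in the
  premeasure comes for free.\<close>

lemma hausdorff_null_if_small_cover:
  fixes S :: "'a::real_normed_vector set"
  assumes t: "t > 0" and sc: "\<And>k. k > 0 \<Longrightarrow> small_cover t k S"
  shows "hausdorff_measure t S = 0"
proof -
  have "hausdorff_premeasure t \<delta> S \<le> ennreal \<eta>" if d: "\<delta> > 0" and eta: "\<eta> > 0" for \<delta> \<eta> :: real
  proof -
    define k where "k = min ((\<delta>/2) powr t) (\<eta> / 2 powr t)"
    have "k > 0" using d eta by (simp add: k_def)
    then obtain c r where r: "\<And>i::nat. 0 \<le> r i" and cov: "S \<subseteq> (\<Union>i. ball (c i) (r i))"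
      and sum: "(\<Sum>i. ennreal (r i powr t)) < ennreal k"
      using sc[of k] unfolding small_cover_def by blast
    have rd: "r i \<le> \<delta>/2" for i
    proof (rule ccontr)
      assume "\<not> r i \<le> \<delta>/2"
      then have "(\<delta>/2) powr t \<le> r i powr t" using t d by (intro powr_mono2) auto
      then have "ennreal k \<le> ennreal (r i powr t)" by (intro ennreal_leI) (simp add: k_def)
      also have "\<dots> \<le> (\<Sum>i. ennreal (r i powr t))"
        by (rule term_le_suminf_ennreal)
      finally show False using sum leD by blast
    qed
    have diam: "diameter (ball (c i) (r i)) \<le> 2 * r i" for i
    proof (rule diameter_le)
      show "ball (c i) (r i) \<noteq> {} \<or> 0 \<le> 2 * r i" using r[of i] by simp
      fix x y assume "x \<in> ball (c i) (r i)" "y \<in> ball (c i) (r i)"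
      then have "dist (c i) x < r i" "dist (c i) y < r i" by auto
      then show "norm (x - y) \<le> 2 * r i"
        using dist_triangle3[of x y "c i"] by (simp add: dist_norm)
    qed
    have w: "hausdorff_weight t (ball (c i) (r i)) \<le> ennreal (2 powr t) * ennreal (r i powr t)" for i
    proof -
      have "diameter (ball (c i) (r i)) powr t \<le> (2 * r i) powr t"
        using diam t diameter_ge_0[OF bounded_ball] by (intro powr_mono2) auto
      then show ?thesis using t r[of i]
        by (auto simp: hausdorff_weight_def powr_mult ennreal_mult[symmetric] intro!: ennreal_leI)
    qed
    have "hausdorff_premeasure t \<delta> S \<le> (\<Sum>i. hausdorff_weight t (ball (c i) (r i)))"
      unfolding hausdorff_premeasure_def
    proof (rule INF_lower)
      show "(\<lambda>i. ball (c i) (r i)) \<in> {U. S \<subseteq> (\<Union>i. U i) \<and> (\<forall>i. bounded (U i) \<and> diameter (U i) \<le> \<delta>)}"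
        using cov order_trans[OF diam, of _ \<delta>] rd by (simp add: field_simps)
    qed
    also have "\<dots> \<le> (\<Sum>i. ennreal (2 powr t) * ennreal (r i powr t))"
      by (intro suminf_le w) auto
    also have "\<dots> = ennreal (2 powr t) * (\<Sum>i. ennreal (r i powr t))" by (rule ennreal_suminf_cmult)
    also have "\<dots> \<le> ennreal (2 powr t) * ennreal k" using sum by (intro mult_left_mono) auto
    also have "\<dots> = ennreal (2 powr t * k)" using \<open>k > 0\<close> by (simp add: ennreal_mult)
    also have "2 powr t * k \<le> 2 powr t * (\<eta> / 2 powr t)"
      unfolding k_def by (intro mult_left_mono) auto
    also have "2 powr t * (\<eta> / 2 powr t) = \<eta>" by simp
    finally show ?thesis by (simp add: ennreal_leI)
  qed
  then have "hausdorff_premeasure t \<delta> S = 0" if "\<delta> > 0" for \<delta>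
    using that by (metis ennreal_le_epsilon ennreal_zero_neq_top add_0 le_zero_eq)
  then show ?thesis unfolding hausdorff_measure_def by (simp add: SUP_eq_iff)
qed

text \<open>Semicontinuity of the content: the balls covering a compact section form an open set, and nearby
  sections cannot leave it.\<close>

lemma closed_not_small_cover:
  fixes G :: "('y::metric_space \<times> 'x::metric_space) set"
  assumes G: "closed G" and K: "compact K" and GK: "\<And>y x. (y, x) \<in> G \<Longrightarrow> x \<in> K"
  shows "closed {y. \<not> small_cover t k {x. (y, x) \<in> G}}"
  unfolding closed_sequential_limits
proof (intro allI impI, elim conjE)
  fix y l assume ns: "\<forall>n::nat. y n \<in> {y. \<not> small_cover t k {x. (y, x) \<in> G}}" and lim: "y \<longlonglongrightarrow> l"
  show "l \<in> {y. \<not> small_cover t k {x. (y, x) \<in> G}}"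
  proof (rule ccontr)
    assume "\<not> ?thesis"
    then obtain c r where r: "\<And>i::nat. 0 \<le> r i" "(\<Sum>i. ennreal (r i powr t)) < ennreal k"
      and cov: "{x. (l, x) \<in> G} \<subseteq> (\<Union>i. ball (c i) (r i))" (is "_ \<subseteq> ?O")
      unfolding small_cover_def by auto
    have "\<exists>x. (y n, x) \<in> G \<and> x \<notin> ?O" for n
    proof (rule ccontr)
      assume "\<not> ?thesis"
      then have "{x. (y n, x) \<in> G} \<subseteq> ?O" by auto
      then have "small_cover t k {x. (y n, x) \<in> G}" unfolding small_cover_def using r by blast
      then show False using ns by auto
    qed
    then obtain x where x: "\<And>n. (y n, x n) \<in> G" "\<And>n. x n \<notin> ?O" by metis
    obtain p \<rho> where p: "strict_mono (\<rho>::nat\<Rightarrow>nat)" "(x \<circ> \<rho>) \<longlonglongrightarrow> p"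
      using K GK x(1) unfolding compact_def by metis
    have "(\<lambda>n. (y (\<rho> n), x (\<rho> n))) \<longlonglongrightarrow> (l, p)"
      using p LIMSEQ_subseq_LIMSEQ[OF lim p(1)] by (intro tendsto_Pair) (auto simp: o_def)
    then have "(l, p) \<in> G" using G x(1) closed_sequentially[of G "\<lambda>n. (y (\<rho> n), x (\<rho> n))"] by blast
    then have "p \<in> ?O" using cov by blast
    moreover have "p \<in> - ?O"
    proof -
      have "closed (- ?O)" by (intro closed_Compl open_UN) auto
      moreover have "(x \<circ> \<rho>) n \<in> - ?O" for n using x(2)[of "\<rho> n"] by simp
      ultimately show ?thesis using p(2) closed_sequentially by blast
    qed
    ultimately show False by blast
  qed
qed

lemma not_small_cover_INT:
  fixes S :: "nat \<Rightarrow> 'x::heine_borel set"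
  assumes S: "\<And>n. compact (S n)" "\<And>m n. m \<le> n \<Longrightarrow> S n \<subseteq> S m"
    and ns: "\<And>n. \<not> small_cover t k (S n)"
  shows "\<not> small_cover t k (\<Inter>n. S n)"
proof
  assume "small_cover t k (\<Inter>n. S n)"
  then obtain c r where r: "\<And>i::nat. 0 \<le> r i" "(\<Sum>i. ennreal (r i powr t)) < ennreal k"
      and cov: "(\<Inter>n. S n) \<subseteq> (\<Union>i. ball (c i) (r i))" (is "_ \<subseteq> ?O")
      unfolding small_cover_def by auto
  have o: "open ?O" by auto
  have ne: "S n - ?O \<noteq> {}" for n
  proof
    assume "S n - ?O = {}"
    then have "S n \<subseteq> ?O" by blast
    then have "small_cover t k (S n)" unfolding small_cover_def using r by blast
    then show False using ns by auto
  qed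
  have "\<Inter>(range (\<lambda>n. S n - ?O)) \<noteq> {}"
    by (rule compact_nest) (use S ne o in \<open>auto intro: compact_diff\<close>)
  then show False using cov by blast
qed

section \<open>Contents on a refining sequence of partitions\<close>

text \<open>A pair \<open>(n, v)\<close> stands for the cell with index \<open>v\<close> of the partition at level \<open>n\<close>. Every cell of
  level \<open>n\<close> has weight \<open>w n\<close>.\<close>

definition weight_measure :: "(nat \<Rightarrow> ennreal) \<Rightarrow> (nat \<times> 'i) measure" where
  "weight_measure w = density (count_space UNIV) (\<lambda>z. w (fst z))"

lemma emeasure_weight_measure:
  "emeasure (weight_measure w) F = (\<integral>\<^sup>+z. w (fst z) * indicator F z \<partial>count_space UNIV)"
  unfolding weight_measure_def by (subst emeasure_density) auto

lemma sets_weight_measure [simp]: "sets (weight_measure w) = UNIV"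
  by (simp add: weight_measure_def)

definition tree_content :: "(nat \<Rightarrow> 'a \<Rightarrow> 'i) \<Rightarrow> (nat \<Rightarrow> ennreal) \<Rightarrow> 'a set \<Rightarrow> ennreal" where
  "tree_content q w S = (INF F \<in> {F. \<forall>x\<in>S. \<exists>n. (n, q n x) \<in> F}. emeasure (weight_measure w) F)"

lemma tree_content_le:
  "(\<And>x. x \<in> S \<Longrightarrow> \<exists>n. (n, q n x) \<in> F) \<Longrightarrow> tree_content q w S \<le> emeasure (weight_measure w) F"
  unfolding tree_content_def by (rule INF_lower) auto

lemma tree_content_subset: "S \<subseteq> T \<Longrightarrow> tree_content q w S \<le> tree_content q w T"
  unfolding tree_content_def by (rule INF_superset_mono) auto

text \<open>Nearly optimal coverings \<open>C k\<close> of the sets \<open>E k\<close> are merged by keeping only maximal cells. Two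
  cells are nested or disjoint, so the content is strongly subadditive at the level of coverings: the
  cells discarded when \<open>C (Suc n)\<close> is merged with \<open>H n\<close> still cover \<open>E n\<close>, and therefore pay for the
  content of \<open>E n\<close>. Hence the weight of the merged covering \<open>H n\<close> exceeds the content of \<open>E n\<close> only by
  the accumulated errors. Cells containing a given point can only grow from \<open>H n\<close> to \<open>H (Suc n)\<close>, so
  they are eventually constant, and the cells that stay forever cover the union.\<close>

lemma tree_content_Union_incseq:
  fixes q :: "nat \<Rightarrow> 'a \<Rightarrow> 'i"
  assumes refine: "\<And>n x y. q (Suc n) x = q (Suc n) y \<Longrightarrow> q n x = q n y"
    and E: "incseq E" and le: "\<And>k. tree_content q w (E k) \<le> L"
  shows "tree_content q w (\<Union>k. E k) \<le> L"
proof (rule ennreal_le_epsilon)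
  fix \<epsilon> :: real assume L: "L < top" and e: "0 < \<epsilon>"
  let ?W = "emeasure (weight_measure w) :: (nat \<times> 'i) set \<Rightarrow> ennreal"
  let ?tc = "tree_content q w"
  have refine': "q n x = q n y" if "q m x = q m y" "n \<le> m" for n m x y
    using that(2,1) by (induction rule: dec_induct) (auto dest: refine)
  define \<delta> where "\<delta> i = ennreal (\<epsilon> * (1/2) ^ Suc i)" for i :: nat
  have dpos: "\<delta> i > 0" for i using e by (simp add: \<delta>_def)
  have fin: "?tc (E k) < top" for k using le[of k] L by (rule le_less_trans)
  have "\<exists>F. (\<forall>x\<in>E k. \<exists>n. (n, q n x) \<in> F) \<and> ?W F < ?tc (E k) + \<delta> k" for k
  proof -
    have "?tc (E k) < ?tc (E k) + \<delta> k"
      using fin[of k] dpos[of k] by (simp add: ennreal_add_left_cancel_less[of _ 0, simplified] less_top)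
    then show ?thesis unfolding tree_content_def INF_less_iff by auto
  qed
  then obtain C where C: "\<And>k x. x \<in> E k \<Longrightarrow> \<exists>n. (n, q n x) \<in> C k"
    and WC: "\<And>k. ?W (C k) < ?tc (E k) + \<delta> k" by metis
  \<comment> \<open>strict and weak inclusion of cells\<close>
  define sb where "sb z z' \<longleftrightarrow> fst z' < fst z \<and> (\<exists>x. q (fst z) x = snd z \<and> q (fst z') x = snd z')"
    for z z' :: "nat \<times> 'i"
  define in_eq where "in_eq z z' \<longleftrightarrow> fst z' \<le> fst z \<and> (\<exists>x. q (fst z) x = snd z \<and> q (fst z') x = snd z')"
    for z z' :: "nat \<times> 'i"
  define H where "H = rec_nat (C 0) (\<lambda>n X. {z\<in>X. \<not> (\<exists>z'\<in>C (Suc n). sb z z')}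
      \<union> {z\<in>C (Suc n). \<not> (\<exists>z'\<in>X. in_eq z z')})"
  have H0: "H 0 = C 0" by (simp add: H_def)
  have HS: "H (Suc n) = {z\<in>H n. \<not> (\<exists>z'\<in>C (Suc n). sb z z')}
      \<union> {z\<in>C (Suc n). \<not> (\<exists>z'\<in>H n. in_eq z z')}" for n by (simp add: H_def)
  have minimal: "\<exists>m'\<le>m. (m', q m' x) \<in> H (Suc n)"
    if m: "(m, q m x) \<in> H n \<union> C (Suc n)" for n m x
  proof -
    define k where "k = (LEAST k. (k, q k x) \<in> H n \<union> C (Suc n))"
    have k: "(k, q k x) \<in> H n \<union> C (Suc n)" unfolding k_def by (rule LeastI[of _ m]) (rule m)
    have km: "k \<le> m" unfolding k_def by (rule Least_le) (rule m)
    have below: "(j, q j x) \<notin> H n \<union> C (Suc n)" if "j < k" for j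
      using not_less_Least that unfolding k_def by blast
    have "(k, q k x) \<in> H (Suc n)"
    proof (cases "(k, q k x) \<in> H n")
      case True
      have "\<not> sb (k, q k x) z'" if "z' \<in> C (Suc n)" for z'
      proof
        assume "sb (k, q k x) z'"
        then obtain y where y: "fst z' < k" "q k y = q k x" "q (fst z') y = snd z'"
          by (auto simp: sb_def)
        then have "z' = (fst z', q (fst z') x)"
          using refine'[of k y x "fst z'"] by (simp add: prod_eq_iff)
        then show False using below[of "fst z'"] y(1) that by auto
      qed
      then show ?thesis using True by (auto simp: HS)
    next
      case False
      have "\<not> in_eq (k, q k x) z'" if "z' \<in> H n" for z'
      proof
        assume "in_eq (k, q k x) z'"
        then obtain y where y: "fst z' \<le> k" "q k y = q k x" "q (fst z') y = snd z'"
          by (auto simp: in_eq_def)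
        then have "z' = (fst z', q (fst z') x)" using refine'[of k y x "fst z'"] by (simp add: prod_eq_iff)
        then have "(fst z', q (fst z') x) \<in> H n" using that by metis
        then show False using below[of "fst z'"] y(1) False by (cases "fst z' = k") auto
      qed
      then show ?thesis using False k by (auto simp: HS)
    qed
    then show ?thesis using km by blast
  qed
  have covH: "x \<in> E k \<Longrightarrow> k \<le> n \<Longrightarrow> \<exists>m. (m, q m x) \<in> H n" for k n x
  proof (induction n)
    case 0 then show ?case using C[of x 0] by (simp add: H0)
  next
    case (Suc n)
    then have "\<exists>m. (m, q m x) \<in> H n \<union> C (Suc n)"
      using C[of x "Suc n"] by (cases "k = Suc n") auto
    then show ?case using minimal by blast
  qed
  have WH: "?W (H n) \<le> ?tc (E n) + (\<Sum>i\<le>n. \<delta> i)" for n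
  proof (induction n)
    case 0 then show ?case using WC[of 0] by (simp add: H0 less_imp_le)
  next
    case (Suc n)
    \<comment> \<open>the cells of \<open>H n\<close> and \<open>C (Suc n)\<close> that lie below another one; they cover \<open>E n\<close>\<close>
    define P where "P = {z\<in>H n. \<exists>z'\<in>C (Suc n). sb z z'} \<union> {z\<in>C (Suc n). \<exists>z'\<in>H n. in_eq z z'}"
    have "?tc (E n) \<le> ?W P"
    proof (rule tree_content_le)
      fix x assume x: "x \<in> E n"
      then obtain m where m: "(m, q m x) \<in> H n" using covH by blast
      have "x \<in> E (Suc n)" using x E by (auto simp: incseq_Suc_iff)
      then obtain m' where m': "(m', q m' x) \<in> C (Suc n)" using C by blast
      show "\<exists>n. (n, q n x) \<in> P"
      proof (cases "m' < m")
        case True then have "sb (m, q m x) (m', q m' x)" by (auto simp: sb_def)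
        then show ?thesis using m m' by (auto simp: P_def)
      next
        case False then have "in_eq (m', q m' x) (m, q m x)" by (auto simp: in_eq_def)
        then show ?thesis using m m' by (auto simp: P_def)
      qed
    qed
    then have "?W (H (Suc n)) + ?tc (E n) \<le> ?W (H (Suc n)) + ?W P" by (rule add_left_mono)
    also have "\<dots> \<le> ?W (H n) + ?W (C (Suc n))"
      unfolding emeasure_weight_measure
      by (subst (1 2) nn_integral_add[symmetric])
        (auto intro!: nn_integral_mono simp: HS P_def indicator_def)
    also have "\<dots> \<le> (?tc (E n) + (\<Sum>i\<le>n. \<delta> i)) + (?tc (E (Suc n)) + \<delta> (Suc n))"
      using Suc WC[of "Suc n"] by (intro add_mono) auto
    also have "\<dots> = (?tc (E (Suc n)) + (\<Sum>i\<le>Suc n. \<delta> i)) + ?tc (E n)"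
      by (simp add: ac_simps)
    finally show ?case
      using fin[of n] ennreal_add_left_cancel_le[of "?tc (E n)"] by (auto simp: add.commute)
  qed
  have dsum: "(\<Sum>i\<le>n. \<delta> i) \<le> ennreal \<epsilon>" for n
  proof -
    have "(\<Sum>i\<le>n. \<delta> i) \<le> (\<Sum>i. \<delta> i)" by (intro sum_le_suminf) auto
    also have "\<dots> = ennreal \<epsilon>" unfolding \<delta>_def
      using sums_mult[OF power_half_series, of \<epsilon>] by (intro suminf_ennreal_eq) (use e in auto)
    finally show ?thesis .
  qed
  have WH': "?W (H n) \<le> L + ennreal \<epsilon>" for n
    using WH[of n] add_mono[OF le[of n] dsum[of n]] by (rule order_trans)
  define D where "D n = (\<Inter>m\<in>{n..}. H m)" for n
  have incD: "incseq D" by (auto simp: incseq_def D_def)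
  have "?W (\<Union>n. D n) = (SUP n. ?W (D n))"
    by (rule SUP_emeasure_incseq[symmetric]) (auto simp: incD)
  also have "\<dots> \<le> L + ennreal \<epsilon>"
  proof (rule SUP_least)
    fix n show "?W (D n) \<le> L + ennreal \<epsilon>"
      using emeasure_mono[of "D n" "H n" "weight_measure w"] WH'[of n] by (force simp: D_def intro: order_trans)
  qed
  finally have "?W (\<Union>n. D n) \<le> L + ennreal \<epsilon>" .
  moreover have "?tc (\<Union>k. E k) \<le> ?W (\<Union>n. D n)"
  proof (rule tree_content_le)
    fix x assume "x \<in> (\<Union>k. E k)"
    then obtain k where k: "x \<in> E k" by blast
    define lev where "lev n = (LEAST m. (m, q m x) \<in> H n)" for n
    have lev: "(lev n, q (lev n) x) \<in> H n" if "k \<le> n" for n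
      unfolding lev_def using covH[OF k that] by (metis (mono_tags, lifting) LeastI_ex)
    have dec: "lev (Suc n) \<le> lev n" if "k \<le> n" for n
    proof -
      have "(lev n, q (lev n) x) \<in> H n \<union> C (Suc n)" using lev[OF that] by blast
      then obtain m' where "m' \<le> lev n" "(m', q m' x) \<in> H (Suc n)" using minimal by blast
      then show ?thesis unfolding lev_def[of "Suc n"] by (meson Least_le order_trans)
    qed
    define l where "l = (LEAST l. \<exists>n\<ge>k. lev n = l)"
    have "\<exists>n\<ge>k. lev n = l" unfolding l_def by (rule LeastI[of _ "lev k"]) auto
    then obtain N where N: "N \<ge> k" "lev N = l" by blast
    have lmin: "l \<le> lev n" if "n \<ge> k" for n unfolding l_def by (rule Least_le) (use that in auto)
    have "lev n = l" if "n \<ge> N" for n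
      using that
    proof (induction rule: dec_induct)
      case base show ?case by (rule N(2))
    next
      case (step n) then show ?case using dec[of n] lmin[of "Suc n"] N(1) by simp
    qed
    then have "(l, q l x) \<in> D N" using lev N(1) by (force simp: D_def)
    then show "\<exists>n. (n, q n x) \<in> (\<Union>n. D n)" by blast
  qed
  ultimately show "?tc (\<Union>k. E k) \<le> L + ennreal \<epsilon>" by (rule order_trans[rotated])
qed

section \<open>Dyadic cubes\<close>

definition dyadic_index :: "nat \<Rightarrow> real ^ 'd \<Rightarrow> ('d \<Rightarrow> int)" where
  "dyadic_index n x = (\<lambda>i. \<lfloor>2 ^ n * x $ i\<rfloor>)"

definition dyadic_weight :: "real \<Rightarrow> nat \<Rightarrow> ennreal" where
  "dyadic_weight s n = ennreal (2 powr (- s * real n))"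

abbreviation dyadic_content :: "real \<Rightarrow> (real ^ 'd) set \<Rightarrow> ennreal" where
  "dyadic_content s \<equiv> tree_content dyadic_index (dyadic_weight s)"

lemma dyadic_index_refine: "dyadic_index (Suc n) x = dyadic_index (Suc n) y \<Longrightarrow> dyadic_index n x = dyadic_index n y"
proof -
  assume eq: "dyadic_index (Suc n) x = dyadic_index (Suc n) y"
  have half: "\<lfloor>2 ^ n * a\<rfloor> = \<lfloor>2 ^ Suc n * a\<rfloor> div 2" for a :: real
    using floor_divide_real_eq_div[of 2 "2 ^ Suc n * a"] by simp
  show ?thesis
    using fun_cong[OF eq] unfolding dyadic_index_def by (intro ext) (metis half)
qed

lemma dyadic_index_refine_le: "dyadic_index m x = dyadic_index m y \<Longrightarrow> n \<le> m \<Longrightarrow> dyadic_index n x = dyadic_index n y"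
  by (rotate_tac, induction rule: dec_induct) (auto dest: dyadic_index_refine)

lemma dyadic_index_eq_imp_component: "dyadic_index n x = dyadic_index n y \<Longrightarrow> \<bar>x $ i - y $ i\<bar> \<le> (1/2) ^ n"
proof -
  assume "dyadic_index n x = dyadic_index n y"
  then have "\<lfloor>2 ^ n * x $ i\<rfloor> = \<lfloor>2 ^ n * y $ i\<rfloor>" unfolding dyadic_index_def by meson
  then have "\<bar>2 ^ n * x $ i - 2 ^ n * y $ i\<bar> \<le> 1" by linarith
  then have "2 ^ n * \<bar>x $ i - y $ i\<bar> \<le> 1"
    by (metis abs_mult abs_numeral power_abs right_diff_distrib)
  then show ?thesis by (simp add: power_one_over field_simps)
qed

lemma dyadic_index_eq_imp_norm: "dyadic_index n x = dyadic_index n y \<Longrightarrow> norm (x - y) \<le> real CARD('d) * (1/2) ^ n"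
  for x y :: "real ^ 'd"
proof -
  assume eq: "dyadic_index n x = dyadic_index n y"
  have "norm (x - y) \<le> (\<Sum>i\<in>UNIV. \<bar>(x - y) $ i\<bar>)" by (rule norm_le_l1_cart)
  also have "\<dots> \<le> (\<Sum>i\<in>(UNIV::'d set). (1/2) ^ n)"
    by (intro sum_mono) (use dyadic_index_eq_imp_component[OF eq] in simp)
  finally show ?thesis by simp
qed

lemma dyadic_scale:
  fixes r :: real
  assumes "0 < r" "r \<le> 1"
  obtains n where "(1/2) ^ Suc n < r" "r \<le> (1/2) ^ n"
proof -
  obtain m where m: "(1/2::real) ^ m < r" using assms(1) real_arch_pow_inv[of r "1/2"] by auto
  define n where "n = (LEAST n. (1/2) ^ Suc n < r)"
  have ex: "(1/2) ^ Suc m < r"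
  proof -
    have "(1/2::real) ^ Suc m \<le> (1/2) ^ m" by simp
    then show ?thesis using m by (rule le_less_trans)
  qed
  have 1: "(1/2) ^ Suc n < r" unfolding n_def by (rule LeastI[of _ m]) (rule ex)
  have 2: "r \<le> (1/2) ^ n"
  proof (cases n)
    case 0 then show ?thesis using assms by simp
  next
    case (Suc k)
    then have "\<not> (1/2) ^ Suc k < r" using not_less_Least[of k "\<lambda>n. (1/2) ^ Suc n < r"] by (simp add: n_def)
    then show ?thesis using Suc by simp
  qed
  show ?thesis using that 1 2 by blast
qed

text \<open>The cubes of lowest level with property \<open>P\<close> are disjoint, because dyadic cubes are nested.\<close>

lemma minimal_dyadic_cubes:
  fixes X :: "(real ^ 'd) set" and P :: "nat \<Rightarrow> ('d \<Rightarrow> int) \<Rightarrow> bool"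
  assumes ex: "\<And>x. x \<in> X \<Longrightarrow> \<exists>n. P n (dyadic_index n x)"
  obtains F where "\<And>x. x \<in> X \<Longrightarrow> \<exists>n. (n, dyadic_index n x) \<in> F"
    "\<And>z. z \<in> F \<Longrightarrow> \<exists>x\<in>X. dyadic_index (fst z) x = snd z"
    "\<And>z. z \<in> F \<Longrightarrow> P (fst z) (snd z)"
    "\<And>z z' y. z \<in> F \<Longrightarrow> z' \<in> F \<Longrightarrow> dyadic_index (fst z) y = snd z \<Longrightarrow>
      dyadic_index (fst z') y = snd z' \<Longrightarrow> z = z'"
    "finite X \<Longrightarrow> finite F"
proof -
  define lv where "lv x = (LEAST n. P n (dyadic_index n x))" for x
  have lv: "P (lv x) (dyadic_index (lv x) x)" if "x \<in> X" for x
    unfolding lv_def using ex[OF that] by (rule LeastI_ex)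
  have lvle: "lv x \<le> n" if "P n (dyadic_index n x)" for x n
    unfolding lv_def using that by (rule Least_le)
  define F where "F = (\<lambda>x. (lv x, dyadic_index (lv x) x)) ` X"
  have key: "z = z'" if z: "z \<in> F" "z' \<in> F" "dyadic_index (fst z) y = snd z"
    "dyadic_index (fst z') y = snd z'" "fst z \<le> fst z'" for z z' y
  proof -
    obtain x x' where x: "x \<in> X" "z = (lv x, dyadic_index (lv x) x)" "z' = (lv x', dyadic_index (lv x') x')"
      using z(1,2) by (auto simp: F_def)
    have y: "dyadic_index (lv x) y = dyadic_index (lv x) x" "dyadic_index (lv x') y = dyadic_index (lv x') x'"
      using z(3,4) x by simp_all
    have le: "lv x \<le> lv x'" using z(5) x by simp
    have "dyadic_index (lv x) x' = dyadic_index (lv x) x" using dyadic_index_refine_le[OF y(2) le] y(1) by simp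
    then have "lv x' \<le> lv x" using lv[OF x(1)] lvle[of "lv x" x'] by simp
    then show ?thesis using x y le by simp
  qed
  show ?thesis
  proof (rule that[of F])
    fix z z' y assume z: "z \<in> F" "z' \<in> F" "dyadic_index (fst z) y = snd z" "dyadic_index (fst z') y = snd z'"
    show "z = z'"
    proof (cases "fst z \<le> fst z'")
      case True then show ?thesis using key[OF z] by simp
    next
      case False then show ?thesis using key[OF z(2,1,4,3)] by simp
    qed
  qed (use lv in \<open>auto simp: F_def\<close>)
qed

text \<open>These cubes of level \<open>n\<close> cover the box of radius \<open>2 powr (- n)\<close> around \<open>x\<close>.\<close>

definition adjacent_indices :: "nat \<Rightarrow> real ^ 'd \<Rightarrow> ('d \<Rightarrow> int) set" where
  "adjacent_indices n x = (\<Pi>\<^sub>E i\<in>UNIV. {dyadic_index n x i - 1 .. dyadic_index n x i + 1})"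

lemma finite_adjacent_indices [simp]: "finite (adjacent_indices n x)"
  unfolding adjacent_indices_def by (intro finite_PiE) auto

lemma card_adjacent_indices: "card (adjacent_indices n (x :: real ^ 'd)) = 3 ^ CARD('d)"
  unfolding adjacent_indices_def by (subst card_PiE) auto

lemma dyadic_index_in_adjacent_indices:
  assumes "\<And>i. \<bar>y $ i - x $ i\<bar> \<le> (1/2) ^ n"
  shows "dyadic_index n y \<in> adjacent_indices n x"
proof -
  have "dyadic_index n y i \<in> {dyadic_index n x i - 1 .. dyadic_index n x i + 1}" for i
  proof -
    have "2 ^ n * \<bar>y $ i - x $ i\<bar> \<le> 2 ^ n * (1/2) ^ n"
      using assms by (intro mult_left_mono) auto
    then have "\<bar>2 ^ n * y $ i - 2 ^ n * x $ i\<bar> \<le> 1"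
      by (simp add: abs_mult power_one_over flip: right_diff_distrib)
    then show ?thesis unfolding dyadic_index_def by (auto; linarith)
  qed
  then show ?thesis by (auto simp: adjacent_indices_def)
qed

lemma dyadic_weight_eq: "dyadic_weight s n = ennreal (((1/2) ^ n) powr s)"
  by (simp add: dyadic_weight_def powr_powr powr_divide powr_minus_divide power_one_over powr_realpow[symmetric] mult.commute)

lemma emeasure_weight_measure_finite:
  "finite F \<Longrightarrow> emeasure (weight_measure w) F = (\<Sum>z\<in>F. w (fst z))"
  unfolding emeasure_weight_measure by (subst nn_integral_indicator_finite) auto

text \<open>A ball of radius at most \<open>1\<close> meets at most \<open>3 ^ d\<close> dyadic cubes of comparable side.\<close>

lemma dyadic_content_le_of_small_cover:
  fixes S :: "(real ^ 'd) set"
  assumes s: "s > 0" and S: "small_cover s k S" and k: "k \<le> 1"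
  shows "dyadic_content s S \<le> ennreal (3 ^ CARD('d) * 2 powr s * k)"
proof -
  obtain c r where r: "\<And>i::nat. 0 \<le> r i" and cov: "S \<subseteq> (\<Union>i. ball (c i) (r i))"
    and sum: "(\<Sum>i. ennreal (r i powr s)) < ennreal k"
    using S unfolding small_cover_def by blast
  have k0: "k > 0" using sum by (metis ennreal_neg not_le not_less_zero)
  have r1: "r i \<le> 1" for i
  proof (rule ccontr)
    assume "\<not> r i \<le> 1"
    then have "1 \<le> r i powr s" using s by (intro ge_one_powr_ge_zero) auto
    then have "ennreal k \<le> ennreal (r i powr s)" using k by (intro ennreal_leI) auto
    also have "\<dots> \<le> (\<Sum>i. ennreal (r i powr s))" by (rule term_le_suminf_ennreal)
    finally show False using sum leD by blast
  qed
  define lv where "lv i = (SOME n. (1/2) ^ Suc n < r i \<and> r i \<le> (1/2) ^ n)" for i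
  have lv: "(1/2) ^ Suc (lv i) < r i \<and> r i \<le> (1/2) ^ lv i" if "r i > 0" for i
    unfolding lv_def by (rule someI_ex) (metis dyadic_scale[OF that r1])
  define F where "F i = (if r i = 0 then {} else {lv i} \<times> adjacent_indices (lv i) (c i))" for i
  have "dyadic_content s S \<le> emeasure (weight_measure (dyadic_weight s)) (\<Union>i. F i)"
  proof (rule tree_content_le)
    fix x assume "x \<in> S"
    then obtain i where i: "dist (c i) x < r i" using cov by auto
    then have ri: "r i > 0" by (meson le_less_trans zero_le_dist)
    have "\<bar>x $ j - c i $ j\<bar> \<le> (1/2) ^ lv i" for j
      using i lv[OF ri] component_le_norm_cart[of "x - c i" j]
      by (simp add: dist_norm norm_minus_commute)
    then have "dyadic_index (lv i) x \<in> adjacent_indices (lv i) (c i)" by (rule dyadic_index_in_adjacent_indices)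
    then show "\<exists>n. (n, dyadic_index n x) \<in> (\<Union>i. F i)" using ri by (intro exI[of _ "lv i"]) (auto simp: F_def intro!: exI[of _ i])
  qed
  also have "\<dots> \<le> (\<Sum>i. emeasure (weight_measure (dyadic_weight s)) (F i))"
    by (rule emeasure_subadditive_countably) auto
  also have "\<dots> \<le> (\<Sum>i. ennreal (3 ^ CARD('d) * 2 powr s) * ennreal (r i powr s))"
  proof (intro suminf_le)
    fix i
    show "emeasure (weight_measure (dyadic_weight s)) (F i) \<le> ennreal (3 ^ CARD('d) * 2 powr s) * ennreal (r i powr s)"
    proof (cases "r i = 0")
      case True then show ?thesis by (simp add: F_def)
    next
      case False
      then have "r i > 0" using r[of i] by simp
      note lv = lv[OF this]
      have "((1/2) ^ lv i) powr s = 2 powr s * ((1/2) ^ Suc (lv i)) powr s"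
        by (subst powr_mult[symmetric]) auto
      also have "\<dots> \<le> 2 powr s * r i powr s"
        using lv s by (intro mult_left_mono powr_mono2) auto
      finally have *: "((1/2) ^ lv i) powr s \<le> 2 powr s * r i powr s" .
      have "emeasure (weight_measure (dyadic_weight s)) (F i) = of_nat (3 ^ CARD('d)) * dyadic_weight s (lv i)"
        using False
        by (simp add: F_def emeasure_weight_measure_finite sum.cartesian_product' card_adjacent_indices)
      also have "\<dots> = ennreal (3 ^ CARD('d) * ((1/2) ^ lv i) powr s)"
        by (simp add: dyadic_weight_eq ennreal_mult ennreal_of_nat_eq_real_of_nat)
      also have "\<dots> \<le> ennreal (3 ^ CARD('d) * (2 powr s * r i powr s))"
        by (intro ennreal_leI mult_left_mono *) auto
      also have "\<dots> = ennreal (3 ^ CARD('d) * 2 powr s) * ennreal (r i powr s)"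
        by (simp add: ennreal_mult' [symmetric] mult.assoc)
      finally show ?thesis .
    qed
  qed auto
  also have "\<dots> = ennreal (3 ^ CARD('d) * 2 powr s) * (\<Sum>i. ennreal (r i powr s))"
    by (rule ennreal_suminf_cmult)
  also have "\<dots> \<le> ennreal (3 ^ CARD('d) * 2 powr s) * ennreal k"
    using sum by (intro mult_left_mono) auto
  also have "\<dots> = ennreal (3 ^ CARD('d) * 2 powr s * k)"
    using k0 by (simp add: ennreal_mult'[symmetric])
  finally show ?thesis .
qed

lemma small_cover_of_dyadic_content:
  fixes S :: "(real ^ 'd) set"
  assumes s: "s > 0" and S: "dyadic_content s S < ennreal k"
  shows "small_cover s ((2 * real CARD('d)) powr s * k) S"
proof -
  obtain F where F: "\<And>x. x \<in> S \<Longrightarrow> \<exists>n. (n, dyadic_index n x) \<in> F"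
    and W: "emeasure (weight_measure (dyadic_weight s)) F < ennreal k"
    using S unfolding tree_content_def INF_less_iff by auto
  let ?d = "real CARD('d)"
  let ?g = "from_nat :: nat \<Rightarrow> nat \<times> ('d \<Rightarrow> int)"
  let ?R = "range (to_nat :: nat \<times> ('d \<Rightarrow> int) \<Rightarrow> nat)"
  define c where "c j = (SOME x. dyadic_index (fst (?g j)) x = snd (?g j))" for j
  define r where "r j = (if ?g j \<in> F \<and> j \<in> ?R then 2 * ?d * (1/2) ^ fst (?g j) else 0)" for j
  have dpos: "?d > 0" by (simp add: zero_less_card_finite)
  have "S \<subseteq> (\<Union>j. ball (c j) (r j))"
  proof
    fix x assume "x \<in> S"
    then obtain n where n: "(n, dyadic_index n x) \<in> F" using F by blast
    define j where "j = to_nat (n, dyadic_index n x)"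
    have g: "?g j = (n, dyadic_index n x)" by (simp add: j_def)
    have "dyadic_index n (c j) = dyadic_index n x" unfolding c_def g fst_conv snd_conv by (rule someI) (rule refl)
    then have "dist (c j) x \<le> ?d * (1/2) ^ n" unfolding dist_norm by (rule dyadic_index_eq_imp_norm)
    also have "\<dots> < 2 * ?d * (1/2) ^ n" using dpos by simp
    also have "\<dots> = r j" using n g by (simp add: r_def) (simp add: j_def)
    finally show "x \<in> (\<Union>j. ball (c j) (r j))" by auto
  qed
  moreover have "(\<Sum>j. ennreal (r j powr s)) < ennreal ((2 * ?d) powr s * k)"
  proof -
    have rw: "ennreal (r j powr s) = ennreal ((2 * ?d) powr s) * (dyadic_weight s (fst (?g j)) * indicator F (?g j) * indicator ?R j)" for j
      using s by (auto simp: r_def dyadic_weight_eq powr_mult ennreal_mult' indicator_def)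
    have "emeasure (weight_measure (dyadic_weight s)) F =
        (\<integral>\<^sup>+j. dyadic_weight s (fst (?g j)) * indicator F (?g j) \<partial>count_space ?R)"
      unfolding emeasure_weight_measure
      by (rule nn_integral_bij_count_space[symmetric])
        (auto simp: bij_betw_def inj_on_def image_image)
    also have "\<dots> = (\<Sum>j. dyadic_weight s (fst (?g j)) * indicator F (?g j) * indicator ?R j)"
      by (subst nn_integral_count_space_indicator) (auto simp: nn_integral_count_space_nat)
    finally have "(\<Sum>j. ennreal (r j powr s)) = ennreal ((2 * ?d) powr s) * emeasure (weight_measure (dyadic_weight s)) F"
      unfolding rw by simp
    also have "\<dots> < ennreal ((2 * ?d) powr s) * ennreal k"
      using W dpos by (intro ennreal_mult_strict_left_mono) (auto simp: ennreal_zero_less_mult_iff)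
    also have "\<dots> = ennreal ((2 * ?d) powr s * k)" by (metis ennreal_mult' powr_ge_zero)
    finally show ?thesis .
  qed
  ultimately show ?thesis unfolding small_cover_def
    by (intro exI[of _ c] exI[of _ r]) (auto simp: r_def)
qed

lemma hausdorff_null_if_dyadic_content_0:
  fixes S :: "(real ^ 'd) set"
  assumes s: "s > 0" and S: "dyadic_content s S = 0"
  shows "hausdorff_measure s S = 0"
proof (rule hausdorff_null_if_small_cover[OF s])
  fix k :: real assume k: "k > 0"
  have p: "(2 * real CARD('d)) powr s > 0" by (simp add: zero_less_card_finite)
  have "dyadic_content s S < ennreal (k / (2 * real CARD('d)) powr s)"
    using S k p by simp
  from small_cover_of_dyadic_content[OF s this] show "small_cover s k S"
    using p by simp
qed

definition dyadic_cube :: "nat \<Rightarrow> real ^ 'd \<Rightarrow> (real ^ 'd) set" where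
  "dyadic_cube n x = {y. dyadic_index n y = dyadic_index n x}"

lemma measurable_dyadic_index_fibre [measurable]: "{y. dyadic_index n y = v} \<in> sets borel"
proof -
  have "{y. dyadic_index n y = v} = (\<Inter>i. {y. \<lfloor>2 ^ n * (y $ i)\<rfloor> = v i})" by (auto simp: dyadic_index_def)
  also have "\<dots> \<in> sets borel" by measurable
  finally show ?thesis .
qed

lemma dyadic_cube_measurable [measurable]: "dyadic_cube n x \<in> sets borel"
  unfolding dyadic_cube_def by measurable

lemma emeasure_dyadic_cube: "emeasure lborel (dyadic_cube n (x :: real ^ 'd)) = ennreal ((1/2) ^ (n * CARD('d)))"
proof -
  define a where "a = (\<chi> i. real_of_int (dyadic_index n x i) / 2 ^ n)"
  define b where "b = (\<chi> i. (real_of_int (dyadic_index n x i) + 1) / 2 ^ n)"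
  have ba: "(b - a) $ i = (1/2) ^ n" for i
    by (simp add: a_def b_def diff_divide_distrib[symmetric] power_one_over)
  have p: "(\<Prod>i\<in>Basis. (b - a) \<bullet> i) = (1/2) ^ (n * CARD('d))"
    by (simp add: Basis_vec_def prod.UNION_disjoint prod.reindex cart_eq_inner_axis[symmetric] ba[simplified] power_mult
      axis_eq_axis inj_on_def UNION_singleton_eq_range)
  have le: "a \<bullet> i \<le> b \<bullet> i" if "i \<in> Basis" for i
    using that by (auto simp: Basis_vec_def cart_eq_inner_axis[symmetric] a_def b_def divide_right_mono)
  have memb: "y \<in> box a b \<Longrightarrow> y \<in> dyadic_cube n x" for y
    by (auto simp: mem_box_cart dyadic_cube_def dyadic_index_def a_def b_def fun_eq_iff floor_eq_iff field_simps)
      (auto intro: less_imp_le)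
  have memc: "y \<in> dyadic_cube n x \<Longrightarrow> y \<in> cbox a b" for y
  proof -
    assume "y \<in> dyadic_cube n x"
    then have "\<lfloor>2 ^ n * y $ i\<rfloor> = dyadic_index n x i" for i by (auto simp: dyadic_cube_def dyadic_index_def fun_eq_iff)
    then have "dyadic_index n x i \<le> 2 ^ n * y $ i" "2 ^ n * y $ i \<le> dyadic_index n x i + 1" for i by (smt (verit) floor_correct)+
    then show "y \<in> cbox a b" by (auto simp: mem_box_cart a_def b_def field_simps)
  qed
  have "emeasure lborel (dyadic_cube n x) \<le> emeasure lborel (cbox a b)"
    by (rule emeasure_mono) (use memc in auto)
  moreover have "emeasure lborel (box a b) \<le> emeasure lborel (dyadic_cube n x)"
    by (rule emeasure_mono) (use memb in auto)
  ultimately show ?thesis using p le by (simp add: emeasure_lborel_box_eq emeasure_lborel_cbox_eq)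
qed

lemma weight_disjoint_dyadic_cubes:
  fixes F :: "(nat \<times> ('d::finite \<Rightarrow> int)) set"
  assumes ne: "\<And>z. z \<in> F \<Longrightarrow> \<exists>x. dyadic_index (fst z) x = snd z"
    and disj: "\<And>z z' y. z \<in> F \<Longrightarrow> z' \<in> F \<Longrightarrow> dyadic_index (fst z) y = snd z \<Longrightarrow>
      dyadic_index (fst z') y = snd z' \<Longrightarrow> z = z'"
  shows "emeasure (weight_measure (dyadic_weight (real CARD('d)))) F =
    emeasure lborel (\<Union>z\<in>F. {y :: real ^ 'd. dyadic_index (fst z) y = snd z})"
proof -
  let ?d = "CARD('d)"
  define cs where "cs z = {y :: real ^ 'd. dyadic_index (fst z) y = snd z}" for z :: "nat \<times> ('d \<Rightarrow> int)"
  have em: "dyadic_weight (real ?d) (fst z) = emeasure lborel (cs z)" if z: "z \<in> F" for z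
  proof -
    obtain x where "dyadic_index (fst z) x = snd z" using ne[OF z] by blast
    then have "cs z = dyadic_cube (fst z) x" by (simp add: cs_def dyadic_cube_def)
    moreover have "(1/2::real) ^ (fst z * ?d) = ((1/2) ^ fst z) powr real ?d"
      by (simp add: powr_realpow power_mult)
    ultimately show ?thesis by (simp add: emeasure_dyadic_cube dyadic_weight_eq)
  qed
  have disj': "disjoint_family_on cs F"
    using disj unfolding disjoint_family_on_def cs_def by blast
  have "emeasure (weight_measure (dyadic_weight (real ?d))) F = (\<integral>\<^sup>+z. dyadic_weight (real ?d) (fst z) \<partial>count_space F)"
    unfolding emeasure_weight_measure by (simp add: nn_integral_count_space_indicator)
  also have "\<dots> = (\<integral>\<^sup>+z. emeasure lborel (cs z) \<partial>count_space F)"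
    by (intro nn_integral_cong) (simp add: em)
  also have "\<dots> = emeasure lborel (\<Union>(cs ` F))"
    by (rule emeasure_UN_countable[symmetric]) (simp_all only: disj' countableI_type, simp add: cs_def)
  finally have "emeasure (weight_measure (dyadic_weight (real ?d))) F = emeasure lborel (\<Union>(cs ` F))" .
  moreover have "cs = (\<lambda>z. {y. dyadic_index (fst z) y = snd z})" by (rule ext) (rule cs_def)
  ultimately show ?thesis by simp
qed

text \<open>The cubes of level \<open>N\<close> that meet a bounded set have bounded total volume, and passing from volume to
  the weight of dimension \<open>s > d\<close> gains a factor that tends to \<open>0\<close>.\<close>

lemma hausdorff_null_above_space_dimension:
  fixes S :: "(real ^ 'd) set"
  assumes S: "bounded S" and s: "s > real CARD('d)"
  shows "hausdorff_measure s S = 0"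
proof (rule hausdorff_null_if_dyadic_content_0)
  show "s > 0" using s by linarith
  let ?d = "real CARD('d)"
  obtain B where B: "\<And>x. x \<in> S \<Longrightarrow> norm x \<le> B" using S by (auto simp: bounded_iff)
  define v where "v = measure lborel (cball (0 :: real ^ 'd) (B + ?d))"
  have le: "dyadic_content s S \<le> ennreal (((1/2) powr (s - ?d)) ^ N * v)" for N
  proof -
    define F where "F = {N} \<times> dyadic_index N ` S"
    define q where "q = ennreal (((1/2) powr (s - ?d)) ^ N)"
    have q: "dyadic_weight s N = q * dyadic_weight ?d N"
      unfolding q_def dyadic_weight_eq by (simp add: ennreal_mult[symmetric] powr_realpow[symmetric] powr_powr powr_add[symmetric] algebra_simps)
    have "dyadic_content s S \<le> emeasure (weight_measure (dyadic_weight s)) F"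
      by (rule tree_content_le) (auto simp: F_def)
    also have "\<dots> = (\<integral>\<^sup>+z. q * (dyadic_weight ?d (fst z) * indicator F z) \<partial>count_space UNIV)"
      unfolding emeasure_weight_measure by (intro nn_integral_cong) (auto simp: F_def q indicator_def)
    also have "\<dots> = q * emeasure (weight_measure (dyadic_weight ?d)) F"
      unfolding emeasure_weight_measure by (rule nn_integral_cmult) simp
    also have "emeasure (weight_measure (dyadic_weight ?d)) F =
        emeasure lborel (\<Union>z\<in>F. {y :: real ^ 'd. dyadic_index (fst z) y = snd z})"
      by (rule weight_disjoint_dyadic_cubes) (auto simp: F_def)
    also have "\<dots> \<le> emeasure lborel (cball (0 :: real ^ 'd) (B + ?d))"
    proof (intro emeasure_mono subsetI)
      fix y :: "real ^ 'd"
      assume "y \<in> (\<Union>z\<in>F. {y. dyadic_index (fst z) y = snd z})"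
      then obtain x where x: "x \<in> S" "dyadic_index N y = dyadic_index N x" by (auto simp: F_def)
      have "?d * (1/2) ^ N \<le> ?d * 1" by (intro mult_left_mono power_le_one) auto
      then have "norm y \<le> B + ?d"
        using B[OF x(1)] dyadic_index_eq_imp_norm[OF x(2)] norm_triangle_sub[of y x] by linarith
      then show "y \<in> cball 0 (B + ?d)" by simp
    qed simp
    also have "\<dots> = ennreal v" unfolding v_def by (rule emeasure_eq_ennreal_measure) (use emeasure_lborel_cball_finite in \<open>simp add: less_top[symmetric]\<close>)
    also have "q * ennreal v = ennreal (((1/2) powr (s - ?d)) ^ N * v)"
      unfolding q_def by (rule ennreal_mult[symmetric]) (auto simp: v_def)
    finally show ?thesis by (simp add: mult_left_mono)
  qed
  have "(1/2::real) powr (s - ?d) < 1" using powr_less_mono'[of "1/2" 0 "s - ?d"] s by simp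
  then have "(\<lambda>N. ((1/2) powr (s - ?d)) ^ N * v) \<longlonglongrightarrow> 0 * v"
    by (intro tendsto_mult tendsto_const LIMSEQ_power_zero) auto
  then have "(\<lambda>N. ennreal (((1/2) powr (s - ?d)) ^ N * v)) \<longlonglongrightarrow> ennreal 0"
    by (intro tendsto_ennrealI) simp
  then have "dyadic_content s S \<le> ennreal 0"
    by (rule LIMSEQ_le_const) (use le in auto)
  then show "dyadic_content s S = 0" by simp
qed

section \<open>Frostman densities\<close>

text \<open>Points receive mass one after the other, each as much as the constraints leave. A point then lies in
  a block whose constraint is tight, and a tight constraint stays tight because the points added to
  its block later receive nothing.\<close>

lemma greedy_saturated_masses:
  fixes A :: "nat \<Rightarrow> 'x \<Rightarrow> 'i" and w :: "nat \<Rightarrow> real"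
  assumes "finite I" and w: "\<And>n. 0 \<le> w n"
  shows "\<exists>m. (\<forall>j. 0 \<le> m j) \<and> (\<forall>n\<le>N. \<forall>k. (\<Sum>j\<in>{j\<in>I. A n j = k}. m j) \<le> w n) \<and>
    (\<forall>i\<in>I. \<exists>n\<le>N. (\<Sum>j\<in>{j\<in>I. A n j = A n i}. m j) = w n)"
  using assms(1)
proof (induction I rule: finite_induct)
  case empty
  show ?case by (rule exI[of _ "\<lambda>_. 0"]) (use w in auto)
next
  case (insert a I)
  then obtain m :: "'x \<Rightarrow> real" where m: "\<And>j. 0 \<le> m j"
    and le: "\<And>n k. n \<le> N \<Longrightarrow> (\<Sum>j\<in>{j\<in>I. A n j = k}. m j) \<le> w n"
    and sat: "\<And>i. i \<in> I \<Longrightarrow> \<exists>n\<le>N. (\<Sum>j\<in>{j\<in>I. A n j = A n i}. m j) = w n" by blast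
  define slack where "slack n = w n - (\<Sum>j\<in>{j\<in>I. A n j = A n a}. m j)" for n
  define v where "v = Min (slack ` {..N})"
  have vle: "v \<le> slack n" if "n \<le> N" for n unfolding v_def using that by (intro Min_le) auto
  have "v \<in> slack ` {..N}" unfolding v_def by (intro Min_in) auto
  then obtain n0 where n0: "n0 \<le> N" "v = slack n0" by auto
  have v0: "0 \<le> v" using n0 le[OF n0(1), of "A n0 a"] by (simp add: slack_def)
  define m' where "m' = m(a := v)"
  have sum': "(\<Sum>j\<in>{j\<in>insert a I. A n j = k}. m' j) =
      (\<Sum>j\<in>{j\<in>I. A n j = k}. m j) + (if A n a = k then v else 0)" for n k
  proof -
    have eq: "{j\<in>insert a I. A n j = k} = (if A n a = k then insert a {j\<in>I. A n j = k} else {j\<in>I. A n j = k})" by auto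
    have "(\<Sum>j\<in>{j\<in>I. A n j = k}. m' j) = (\<Sum>j\<in>{j\<in>I. A n j = k}. m j)"
      using insert(2) by (intro sum.cong) (auto simp: m'_def)
    then show ?thesis unfolding eq using insert(1,2) by (auto simp: m'_def)
  qed
  show ?case
  proof (intro exI[of _ m'] conjI allI impI ballI)
    fix j show "0 \<le> m' j" using m v0 by (simp add: m'_def)
  next
    fix n k assume n: "n \<le> N"
    show "(\<Sum>j\<in>{j\<in>insert a I. A n j = k}. m' j) \<le> w n"
      using le[OF n, of k] vle[OF n] unfolding sum' by (auto simp: slack_def)
  next
    fix i assume i: "i \<in> insert a I"
    show "\<exists>n\<le>N. (\<Sum>j\<in>{j\<in>insert a I. A n j = A n i}. m' j) = w n"
    proof (cases "i = a")
      case True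
      then show ?thesis unfolding sum' using n0 by (intro exI[of _ n0]) (simp add: slack_def)
    next
      case False
      then obtain n where n: "n \<le> N" "(\<Sum>j\<in>{j\<in>I. A n j = A n i}. m j) = w n" using sat i by blast
      have "v = 0" if "A n a = A n i" using vle[OF n(1)] v0 n(2) that by (simp add: slack_def)
      then show ?thesis unfolding sum' using n by (intro exI[of _ n]) auto
    qed
  qed
qed

abbreviation cube_box :: "real ^ 'd \<Rightarrow> real \<Rightarrow> (real ^ 'd) set" where
  "cube_box x r \<equiv> cbox (x - (\<chi> i. r)) (x + (\<chi> i. r))"

lemma mem_cube_box: "y \<in> cube_box x r \<longleftrightarrow> (\<forall>i. \<bar>y $ i - x $ i\<bar> \<le> r)"
  by (auto simp: mem_box_cart abs_le_iff algebra_simps)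

lemma emeasure_cube_box:
  "0 \<le> r \<Longrightarrow> emeasure lborel (cube_box (x :: real ^ 'd) r) = ennreal ((2 * r) ^ CARD('d))"
  by (subst emeasure_lborel_cbox_eq)
    (auto simp: Basis_vec_def prod.UNION_disjoint prod.reindex cart_eq_inner_axis[symmetric]
      axis_eq_axis inj_on_def UNION_singleton_eq_range)

text \<open>Frostman's lemma at resolution \<open>N\<close>. One representative is chosen in every cube of level \<open>N\<close> that
  meets \<open>C\<close>, and the masses come from \<open>greedy_saturated_masses\<close> with the constraint that a cube of
  side \<open>l\<close> has mass at most \<open>l powr s\<close>. The saturated cubes of lowest level are disjoint and cover \<open>C\<close>,
  which bounds the total mass below by the content. The mass is spread uniformly over the cubes of
  level \<open>N\<close>, and \<open>s \<le> d\<close> makes the bound persist below that scale. All constants are independent of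
  \<open>N\<close>.\<close>

lemma discrete_frostman:
  fixes C :: "(real ^ 'd) set"
  assumes C: "bounded C" and s: "0 < s" "s \<le> real CARD('d)"
  shows "\<exists>f :: real ^ 'd \<Rightarrow> ennreal. f \<in> borel_measurable borel \<and>
    (\<forall>x. f x \<noteq> 0 \<longrightarrow> (\<exists>y\<in>C. dyadic_index N x = dyadic_index N y)) \<and>
    (\<forall>x r. 0 < r \<longrightarrow> r \<le> 1 \<longrightarrow>
      (\<integral>\<^sup>+y. f y * indicator (cube_box x r) y \<partial>lborel) \<le> ennreal (6 ^ CARD('d) * r powr s)) \<and>
    dyadic_content s C \<le> (\<integral>\<^sup>+y. f y \<partial>lborel) \<and> (\<integral>\<^sup>+y. f y \<partial>lborel) < \<infinity>"
proof -
  let ?d = "CARD('d)"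
  have "finite (dyadic_index N ` C)"
  proof -
    obtain B where B: "\<And>x. x \<in> C \<Longrightarrow> norm x \<le> B" using C by (auto simp: bounded_iff)
    have "dyadic_index N ` C \<subseteq> (\<Pi>\<^sub>E i\<in>UNIV. {\<lfloor>- (2 ^ N * B)\<rfloor>..\<lfloor>2 ^ N * B\<rfloor>})"
    proof
      fix v assume "v \<in> dyadic_index N ` C"
      then obtain x where x: "x \<in> C" "v = dyadic_index N x" by blast
      have "\<bar>x $ i\<bar> \<le> B" for i using B[OF x(1)] component_le_norm_cart[of x i] by linarith
      then have "- (2 ^ N * B) \<le> 2 ^ N * x $ i \<and> 2 ^ N * x $ i \<le> 2 ^ N * B" for i
        using mult_left_mono[of "- B" "x $ i" "2 ^ N"] mult_left_mono[of "x $ i" B "2 ^ N"]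
        by (smt (verit) mult_minus_right zero_le_power)
      then show "v \<in> (\<Pi>\<^sub>E i\<in>UNIV. {\<lfloor>- (2 ^ N * B)\<rfloor>..\<lfloor>2 ^ N * B\<rfloor>})"
        unfolding x(2) dyadic_index_def by (auto intro!: floor_mono)
    qed
    then show ?thesis by (rule finite_subset) (intro finite_PiE, auto)
  qed
  then obtain I where I: "I \<subseteq> C" "finite I" "inj_on (dyadic_index N) I" "dyadic_index N ` I = dyadic_index N ` C"
    by (metis finite_image_iff subset_image_inj order_refl)
  define w where "w n = ((1/2::real) ^ n) powr s" for n
  have wn: "dyadic_weight s n = ennreal (w n)" for n by (simp add: dyadic_weight_eq w_def)
  obtain m where m: "\<And>j. 0 \<le> m j"
    and le: "\<And>n k. n \<le> N \<Longrightarrow> (\<Sum>j\<in>{j\<in>I. dyadic_index n j = k}. m j) \<le> w n"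
    and sat: "\<And>i. i \<in> I \<Longrightarrow> \<exists>n\<le>N. (\<Sum>j\<in>{j\<in>I. dyadic_index n j = dyadic_index n i}. m j) = w n"
  proof -
    have "0 \<le> w n" for n by (simp add: w_def)
    from greedy_saturated_masses[where A=dyadic_index and w=w, OF I(2) this, of N]
    obtain m where "\<forall>j. 0 \<le> m j" "\<forall>n\<le>N. \<forall>k. (\<Sum>j\<in>{j\<in>I. dyadic_index n j = k}. m j) \<le> w n"
      "\<forall>i\<in>I. \<exists>n\<le>N. (\<Sum>j\<in>{j\<in>I. dyadic_index n j = dyadic_index n i}. m j) = w n" by (elim exE conjE)
    then show ?thesis by (intro that[of m]) auto
  qed
  define f where "f x = (\<Sum>j\<in>I. ennreal (m j * 2 ^ (N * ?d)) * indicator (dyadic_cube N j) x)" for x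
  have f_meas: "f \<in> borel_measurable borel" unfolding f_def by measurable
  have supp: "\<exists>y\<in>C. dyadic_index N x = dyadic_index N y" if fx: "f x \<noteq> 0" for x
  proof -
    obtain j where "j \<in> I" "x \<in> dyadic_cube N j"
    proof (rule ccontr)
      assume "\<not> thesis"
      then have "f x = 0" using that unfolding f_def by (intro sum.neutral) (auto simp: indicator_def)
      then show False using fx by simp
    qed
    then show ?thesis using I(1) by (auto simp: dyadic_cube_def)
  qed
  have int: "(\<integral>\<^sup>+y. f y * indicator B y \<partial>lborel) =
      (\<Sum>j\<in>I. ennreal (m j * 2 ^ (N * ?d)) * emeasure lborel (dyadic_cube N j \<inter> B))"
    if [measurable]: "B \<in> sets borel" for B
  proof -
    have "(\<integral>\<^sup>+y. f y * indicator B y \<partial>lborel) =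
      (\<integral>\<^sup>+y. (\<Sum>j\<in>I. ennreal (m j * 2 ^ (N * ?d)) * indicator (dyadic_cube N j \<inter> B) y) \<partial>lborel)"
      unfolding f_def by (simp add: sum_distrib_right indicator_inter_arith mult.assoc)
    also have "\<dots> = (\<Sum>j\<in>I. ennreal (m j * 2 ^ (N * ?d)) * emeasure lborel (dyadic_cube N j \<inter> B))"
      by (subst nn_integral_sum) (auto simp: nn_integral_cmult_indicator)
    finally show ?thesis .
  qed
  have cellmass: "ennreal (m j * 2 ^ (N * ?d)) * emeasure lborel (dyadic_cube N j) = ennreal (m j)" for j
    unfolding emeasure_dyadic_cube using m[of j]
    by (simp add: ennreal_mult'[symmetric] power_one_over)
  have total: "(\<integral>\<^sup>+y. f y \<partial>lborel) = ennreal (\<Sum>j\<in>I. m j)"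
    using int[of UNIV] m by (simp add: cellmass)
  have fle: "f x \<le> ennreal (2 ^ (N * ?d) * w N)" for x
  proof (cases "f x = 0")
    case False
    then obtain i where i: "i \<in> I" "dyadic_index N x = dyadic_index N i" using supp I(4) by (metis image_iff)
    have "f x = (\<Sum>j\<in>{i}. ennreal (m j * 2 ^ (N * ?d)) * indicator (dyadic_cube N j) x)"
      unfolding f_def using i I(2,3) by (intro sum.mono_neutral_right) (auto simp: dyadic_cube_def inj_on_def indicator_def)
    also have "\<dots> \<le> ennreal (m i * 2 ^ (N * ?d))" using i by (simp add: dyadic_cube_def)
    also have "m i \<le> w N"
      using le[of N "dyadic_index N i"] member_le_sum[of i "{j\<in>I. dyadic_index N j = dyadic_index N i}" m] i m I(2) by force
    finally show ?thesis by (simp add: ennreal_leI mult.commute mult_left_mono order_trans)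
  qed simp
  have box: "(\<integral>\<^sup>+y. f y * indicator (cube_box x r) y \<partial>lborel) \<le> ennreal (6 ^ ?d * r powr s)"
    if r: "0 < r" "r \<le> 1" for x r
  proof (cases "r < (1/2) ^ N")
    case True
    have "(\<integral>\<^sup>+y. f y * indicator (cube_box x r) y \<partial>lborel) \<le>
      (\<integral>\<^sup>+y. ennreal (2 ^ (N * ?d) * w N) * indicator (cube_box x r) y \<partial>lborel)"
      by (intro nn_integral_mono mult_right_mono fle) auto
    also have "\<dots> = ennreal (2 ^ (N * ?d) * w N * (2 * r) ^ ?d)"
      using r by (subst nn_integral_cmult_indicator) (auto simp: emeasure_cube_box ennreal_mult' w_def)
    also have "\<dots> \<le> ennreal (6 ^ ?d * r powr s)"
    proof (rule ennreal_leI)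
      have eq: "2 ^ (N * ?d) * w N = (2 ^ N) powr (real ?d - s)"
        by (simp add: w_def powr_diff powr_realpow power_mult powr_divide power_one_over)
      have "(2 ^ N) powr (real ?d - s) \<le> (1 / r) powr (real ?d - s)"
        using True r s(2) by (intro powr_mono2) (auto simp: field_simps power_one_over)
      also have "\<dots> = r powr s / r ^ ?d"
        using r by (simp add: powr_diff powr_realpow powr_divide field_simps)
      finally have "2 ^ (N * ?d) * w N * (2 * r) ^ ?d \<le> r powr s / r ^ ?d * (2 * r) ^ ?d"
        unfolding eq using r by (intro mult_right_mono) auto
      also have "\<dots> = 2 ^ ?d * r powr s" using r by (simp add: power_mult_distrib)
      also have "\<dots> \<le> 6 ^ ?d * r powr s" by (intro mult_right_mono power_mono) auto
      finally show "2 ^ (N * ?d) * w N * (2 * r) ^ ?d \<le> 6 ^ ?d * r powr s" .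
    qed
    finally show ?thesis .
  next
    case False
    obtain n where n: "(1/2) ^ Suc n < r" "r \<le> (1/2) ^ n" using dyadic_scale[OF r] .
    have "n \<le> N"
    proof (rule ccontr)
      assume "\<not> n \<le> N"
      then have "(1/2::real) ^ n \<le> (1/2) ^ Suc N" by (intro power_decreasing) auto
      then have "(1/2::real) ^ n < (1/2) ^ N" by (rule le_less_trans) simp
      then show False using False n(2) by linarith
    qed
    have "(\<integral>\<^sup>+y. f y * indicator (cube_box x r) y \<partial>lborel) =
      (\<Sum>j\<in>I. ennreal (m j * 2 ^ (N * ?d)) * emeasure lborel (dyadic_cube N j \<inter> cube_box x r))" by (rule int) simp
    also have "\<dots> \<le> (\<Sum>j\<in>I. if dyadic_index n j \<in> adjacent_indices n x then ennreal (m j) else 0)"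
    proof (rule sum_mono)
      fix j assume "j \<in> I"
      show "ennreal (m j * 2 ^ (N * ?d)) * emeasure lborel (dyadic_cube N j \<inter> cube_box x r)
        \<le> (if dyadic_index n j \<in> adjacent_indices n x then ennreal (m j) else 0)"
      proof (cases "dyadic_cube N j \<inter> cube_box x r = {}")
        case False
        then obtain y where y: "dyadic_index N y = dyadic_index N j" "y \<in> cube_box x r" by (auto simp: dyadic_cube_def)
        have "dyadic_index n y \<in> adjacent_indices n x"
          using y(2) n(2) unfolding mem_cube_box by (intro dyadic_index_in_adjacent_indices) (meson order_trans)
        then have "dyadic_index n j \<in> adjacent_indices n x" using dyadic_index_refine_le[OF y(1) \<open>n \<le> N\<close>] by simp
        moreover have "ennreal (m j * 2 ^ (N * ?d)) * emeasure lborel (dyadic_cube N j \<inter> cube_box x r) \<le> ennreal (m j)"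
          unfolding cellmass[of j, symmetric] by (intro mult_left_mono emeasure_mono) auto
        ultimately show ?thesis by simp
      qed simp
    qed
    also have "\<dots> = (\<Sum>j\<in>I. ennreal (if dyadic_index n j \<in> adjacent_indices n x then m j else 0))"
      by (intro sum.cong) auto
    also have "\<dots> = ennreal (\<Sum>j\<in>I. if dyadic_index n j \<in> adjacent_indices n x then m j else 0)"
      using m by (intro sum_ennreal) auto
    also have "(\<Sum>j\<in>I. if dyadic_index n j \<in> adjacent_indices n x then m j else 0) = (\<Sum>j\<in>{j\<in>I. dyadic_index n j \<in> adjacent_indices n x}. m j)"
      using I(2) by (simp add: sum.inter_filter)
    also have "\<dots> = (\<Sum>k\<in>adjacent_indices n x. \<Sum>j\<in>{j\<in>{j\<in>I. dyadic_index n j \<in> adjacent_indices n x}. dyadic_index n j = k}. m j)"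
      using I(2) by (intro sum.group[symmetric]) auto
    also have "\<dots> \<le> (\<Sum>k\<in>adjacent_indices n x. w n)"
    proof (rule sum_mono)
      fix k assume "k \<in> adjacent_indices n x"
      then have "{j\<in>{j\<in>I. dyadic_index n j \<in> adjacent_indices n x}. dyadic_index n j = k} = {j\<in>I. dyadic_index n j = k}" by auto
      then show "(\<Sum>j\<in>{j\<in>{j\<in>I. dyadic_index n j \<in> adjacent_indices n x}. dyadic_index n j = k}. m j) \<le> w n"
        using le[OF \<open>n \<le> N\<close>] by simp
    qed
    also have "\<dots> = 3 ^ ?d * w n" by (simp add: card_adjacent_indices)
    also have "\<dots> \<le> 3 ^ ?d * (2 ^ ?d * r powr s)"
    proof (intro mult_left_mono)
      have "w n = 2 powr s * ((1/2) ^ Suc n) powr s"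
        unfolding w_def by (subst powr_mult[symmetric]) auto
      also have "\<dots> \<le> 2 powr s * r powr s"
        using n s by (intro mult_left_mono powr_mono2) auto
      also have "2 powr s \<le> 2 powr (real ?d)" using s by (intro powr_mono) auto
      finally show "w n \<le> 2 ^ ?d * r powr s" by (simp add: powr_realpow mult_right_mono order_trans)
    qed auto
    also have "\<dots> = 6 ^ ?d * r powr s" by (simp add: power_mult_distrib[symmetric] mult.assoc[symmetric])
    finally show ?thesis by (simp add: ennreal_leI)
  qed
  have content: "dyadic_content s C \<le> ennreal (\<Sum>j\<in>I. m j)"
  proof -
    let ?P = "\<lambda>n v. n \<le> N \<and> (\<Sum>j\<in>{j\<in>I. dyadic_index n j = v}. m j) = w n"
    obtain F where F: "\<And>i. i \<in> I \<Longrightarrow> \<exists>n. (n, dyadic_index n i) \<in> F"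
      "\<And>z. z \<in> F \<Longrightarrow> \<exists>i\<in>I. dyadic_index (fst z) i = snd z"
      "\<And>z. z \<in> F \<Longrightarrow> ?P (fst z) (snd z)"
      "\<And>z z' y. z \<in> F \<Longrightarrow> z' \<in> F \<Longrightarrow> dyadic_index (fst z) y = snd z \<Longrightarrow>
        dyadic_index (fst z') y = snd z' \<Longrightarrow> z = z'" "finite I \<Longrightarrow> finite F"
    proof (rule minimal_dyadic_cubes[of I ?P])
      show "\<exists>n. ?P n (dyadic_index n i)" if i: "i \<in> I" for i using sat[OF i] by blast
    qed (rule that)
    have fF: "finite F" using F(5) I(2) by blast
    define blk where "blk z = {j\<in>I. dyadic_index (fst z) j = snd z}" for z :: "nat \<times> ('d \<Rightarrow> int)"
    have "dyadic_content s C \<le> emeasure (weight_measure (dyadic_weight s)) F"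
    proof (rule tree_content_le)
      fix x assume "x \<in> C"
      then obtain i where i: "i \<in> I" "dyadic_index N x = dyadic_index N i" using I(4) by (metis image_iff)
      obtain n where n: "(n, dyadic_index n i) \<in> F" using F(1)[OF i(1)] by blast
      then have "dyadic_index n x = dyadic_index n i"
        using dyadic_index_refine_le[OF i(2), of n] F(3)[OF n] by simp
      then show "\<exists>n. (n, dyadic_index n x) \<in> F" using n by (intro exI[of _ n]) simp
    qed
    also have "\<dots> = (\<Sum>z\<in>F. ennreal (w (fst z)))" by (simp add: emeasure_weight_measure_finite[OF fF] wn)
    also have "\<dots> = ennreal (\<Sum>z\<in>F. w (fst z))" by (rule sum_ennreal) (simp add: w_def)
    also have "(\<Sum>z\<in>F. w (fst z)) = (\<Sum>z\<in>F. \<Sum>j\<in>blk z. m j)"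
      by (intro sum.cong refl) (use F(3) in \<open>simp add: blk_def\<close>)
    also have "\<dots> = (\<Sum>j\<in>(\<Union>z\<in>F. blk z). m j)"
    proof (rule sum.UNION_disjoint[symmetric])
      show "\<forall>z\<in>F. \<forall>z'\<in>F. z \<noteq> z' \<longrightarrow> blk z \<inter> blk z' = {}"
        using F(4) unfolding blk_def by blast
    qed (use fF I(2) in \<open>auto simp: blk_def\<close>)
    also have "\<dots> \<le> (\<Sum>j\<in>I. m j)" using I(2) m by (intro sum_mono2) (auto simp: blk_def)
    finally show ?thesis by (simp add: ennreal_leI)
  qed
  show ?thesis
    by (intro exI[of _ f] conjI allI impI f_meas supp box) (use content total in auto)
qed

section \<open>Mass and energy in a plane\<close>

lemma nn_integral_affine:
  fixes f :: "'a::euclidean_space \<Rightarrow> ennreal"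
  assumes [measurable]: "f \<in> borel_measurable borel" and c: "c \<noteq> 0"
  shows "(\<integral>\<^sup>+x. f x \<partial>lborel) = ennreal (\<bar>c\<bar> ^ DIM('a)) * (\<integral>\<^sup>+x. f (t + c *\<^sub>R x) \<partial>lborel)"
  by (subst lborel_affine[OF c, of t])
     (simp add: nn_integral_density nn_integral_distr nn_integral_cmult)

lemma nn_integral_translate:
  fixes f :: "'a::euclidean_space \<Rightarrow> ennreal"
  assumes "f \<in> borel_measurable borel"
  shows "(\<integral>\<^sup>+x. f (x + t) \<partial>lborel) = (\<integral>\<^sup>+x. f x \<partial>lborel)"
  using nn_integral_affine[OF assms, of 1 t] by (simp add: add.commute)

lemma nn_integral_abs_powr_le:
  assumes a: "a > -1" and r: "\<rho> \<ge> 0"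
  shows "(\<integral>\<^sup>+h. indicator {-\<rho>..\<rho>} h * ennreal (\<bar>h\<bar> powr a) \<partial>lborel) \<le> ennreal (2 * \<rho> powr (a + 1) / (a + 1))"
proof -
  let ?g = "\<lambda>h. indicator {0..\<rho>} h * ennreal (h powr a)"
  let ?I = "\<rho> powr (a + 1) / (a + 1)"
  have half: "(\<integral>\<^sup>+h. ?g h \<partial>lborel) = ennreal ?I"
  proof -
    have "((\<lambda>x. if x \<in> {0..\<rho>} then x powr a else 0) has_integral ?I) UNIV"
      using has_integral_powr_from_0[OF a r] by (simp only: has_integral_restrict_UNIV)
    then have "(\<integral>\<^sup>+x. ennreal (if x \<in> {0..\<rho>} then x powr a else 0) \<partial>lborel) = ennreal ?I"
      by (intro nn_integral_has_integral_lborel) auto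
    moreover have "?g = (\<lambda>x. ennreal (if x \<in> {0..\<rho>} then x powr a else 0))"
      by (auto simp: fun_eq_iff indicator_def)
    ultimately show ?thesis by simp
  qed
  have "(\<integral>\<^sup>+h. indicator {-\<rho>..\<rho>} h * ennreal (\<bar>h\<bar> powr a) \<partial>lborel) \<le>
    (\<integral>\<^sup>+h. ?g h + ?g (0 + (-1) * h) \<partial>lborel)"
    by (intro nn_integral_mono) (auto simp: indicator_def)
  also have "\<dots> = (\<integral>\<^sup>+h. ?g h \<partial>lborel) + (\<integral>\<^sup>+h. ?g (0 + (-1) * h) \<partial>lborel)"
    by (rule nn_integral_add) auto
  also have "(\<integral>\<^sup>+h. ?g (0 + (-1) * h) \<partial>lborel) = (\<integral>\<^sup>+h. ?g h \<partial>lborel)"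
    using nn_integral_real_affine[of ?g "-1" 0] by simp
  finally show ?thesis unfolding half using a by (simp add: ennreal_plus[symmetric] del: ennreal_plus)
qed

lemma borel_measurable_fst_borel [measurable (raw)]:
  fixes f :: "'m \<Rightarrow> 'a::topological_space \<times> 'b::topological_space"
  assumes "f \<in> borel_measurable M" shows "(\<lambda>x. fst (f x)) \<in> borel_measurable M"
  by (rule measurable_compose[OF assms]) (auto intro!: borel_measurable_continuous_onI continuous_intros)

lemma borel_measurable_snd_borel [measurable (raw)]:
  fixes f :: "'m \<Rightarrow> 'a::topological_space \<times> 'b::topological_space"
  assumes "f \<in> borel_measurable M" shows "(\<lambda>x. snd (f x)) \<in> borel_measurable M"
  by (rule measurable_compose[OF assms]) (auto intro!: borel_measurable_continuous_onI continuous_intros)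

abbreviation square_box :: "real \<Rightarrow> (real \<times> real) set" where
  "square_box \<rho> \<equiv> cbox (-\<rho>, -\<rho>) (\<rho>, \<rho>)"

lemma mem_square_box: "p \<in> square_box \<rho> \<longleftrightarrow> \<bar>fst p\<bar> \<le> \<rho> \<and> \<bar>snd p\<bar> \<le> \<rho>"
  by (cases p) (auto simp: cbox_Pair_eq abs_le_iff)

text \<open>For fixed \<open>h \<noteq> 0\<close> the substitution \<open>x = y + h w\<close> maps the cube of all \<open>w\<close> onto the cube of radius
  \<open>\<bar>h\<bar>\<close> around \<open>y\<close>, with Jacobian \<open>\<bar>h\<bar> ^ d\<close>. The integral of \<open>f (y + h w)\<close> over \<open>w\<close> is then at most
  \<open>c * \<bar>h\<bar> powr (s - d)\<close>, uniformly in the position along \<open>e\<close>, and \<open>s > d - 1\<close> makes this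
  integrable at \<open>0\<close>.\<close>

lemma parallelogram_average:
  fixes f :: "real ^ 'd \<Rightarrow> ennreal"
  assumes f[measurable]: "f \<in> borel_measurable borel"
    and box: "\<And>x r. 0 < r \<Longrightarrow> r \<le> 1 \<Longrightarrow>
      (\<integral>\<^sup>+y. f y * indicator (cube_box x r) y \<partial>lborel) \<le> ennreal (c * r powr s)"
    and c: "0 \<le> c" and s: "real CARD('d) - 1 < s" and r: "0 < \<rho>" "\<rho> \<le> 1"
  shows "(\<integral>\<^sup>+w. indicator (cube_box 0 1) w *
      (\<integral>\<^sup>+h. indicator (square_box \<rho>) h * f (z + fst h *\<^sub>R w + snd h *\<^sub>R e) \<partial>lborel) \<partial>lborel)
    \<le> ennreal (4 * c / (s - real CARD('d) + 1) * \<rho> powr (s - real CARD('d) + 2))"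
proof -
  let ?d = "CARD('d)"
  let ?a = "s - real ?d"
  let ?g = "\<lambda>h1 h2 w. indicator (cube_box 0 1) w * (indicator (square_box \<rho>) (h1, h2) * f (z + h1 *\<^sub>R w + h2 *\<^sub>R e))"
  have inner: "(\<integral>\<^sup>+w. indicator (cube_box 0 1) w * f (y + h *\<^sub>R w) \<partial>lborel) \<le> ennreal (c * \<bar>h\<bar> powr ?a)"
    if h: "h \<noteq> 0" "\<bar>h\<bar> \<le> 1" for y h
  proof -
    have eq: "indicator (cube_box y \<bar>h\<bar>) (y + h *\<^sub>R w) = (indicator (cube_box 0 1) w :: ennreal)" for w
    proof -
      have "\<bar>h\<bar> * \<bar>w $ i\<bar> \<le> \<bar>h\<bar> \<longleftrightarrow> \<bar>w $ i\<bar> \<le> 1" for i using h(1) by simp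
      then show ?thesis unfolding indicator_def mem_cube_box by (simp add: abs_mult)
    qed
    have "ennreal (\<bar>h\<bar> ^ ?d) * (\<integral>\<^sup>+w. indicator (cube_box 0 1) w * f (y + h *\<^sub>R w) \<partial>lborel)
       = (\<integral>\<^sup>+x. f x * indicator (cube_box y \<bar>h\<bar>) x \<partial>lborel)"
      by (subst nn_integral_affine[of "\<lambda>x. f x * indicator (cube_box y \<bar>h\<bar>) x" h y])
        (use h in \<open>auto simp: eq mult.commute\<close>)
    also have "\<dots> \<le> ennreal (c * \<bar>h\<bar> powr s)" using box h by simp
    also have "\<dots> = ennreal (\<bar>h\<bar> ^ ?d) * ennreal (c * \<bar>h\<bar> powr ?a)"
      using h c by (simp add: ennreal_mult[symmetric] powr_diff powr_realpow)
    finally show ?thesis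
      using h by (subst (asm) ennreal_mult_le_mult_iff) auto
  qed
  have "(\<integral>\<^sup>+w. indicator (cube_box 0 1) w *
      (\<integral>\<^sup>+h. indicator (square_box \<rho>) h * f (z + fst h *\<^sub>R w + snd h *\<^sub>R e) \<partial>lborel) \<partial>lborel)
    = (\<integral>\<^sup>+w. \<integral>\<^sup>+h. ?g (fst h) (snd h) w \<partial>lborel \<partial>lborel)"
    by (subst nn_integral_cmult) auto
  also have "\<dots> = (\<integral>\<^sup>+h. \<integral>\<^sup>+w. ?g (fst h) (snd h) w \<partial>lborel \<partial>lborel)"
    by (rule lborel_pair.Fubini'[symmetric]) measurable
  also have "\<dots> = (\<integral>\<^sup>+h2. \<integral>\<^sup>+h1. \<integral>\<^sup>+w. ?g h1 h2 w \<partial>lborel \<partial>lborel \<partial>lborel)"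
    by (subst lborel_prod[symmetric], subst lborel_pair.nn_integral_snd[symmetric]) (simp_all add: lborel_prod)
  also have "\<dots> \<le> (\<integral>\<^sup>+h2. indicator {-\<rho>..\<rho>} h2 * ennreal (c * (2 * \<rho> powr (?a + 1) / (?a + 1))) \<partial>lborel)"
  proof (rule nn_integral_mono)
    fix h2 :: real
    have "(\<integral>\<^sup>+h1. \<integral>\<^sup>+w. ?g h1 h2 w \<partial>lborel \<partial>lborel)
      \<le> (\<integral>\<^sup>+h1. indicator {-\<rho>..\<rho>} h2 * (ennreal c * (indicator {-\<rho>..\<rho>} h1 * ennreal (\<bar>h1\<bar> powr ?a))) \<partial>lborel)"
    proof (rule nn_integral_mono_AE)
      show "AE h1 in lborel. (\<integral>\<^sup>+w. ?g h1 h2 w \<partial>lborel)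
        \<le> indicator {-\<rho>..\<rho>} h2 * (ennreal c * (indicator {-\<rho>..\<rho>} h1 * ennreal (\<bar>h1\<bar> powr ?a)))"
        using AE_lborel_singleton[of 0]
      proof (eventually_elim)
        fix h1 :: real assume h1: "h1 \<noteq> 0"
        show "(\<integral>\<^sup>+w. ?g h1 h2 w \<partial>lborel)
        \<le> indicator {-\<rho>..\<rho>} h2 * (ennreal c * (indicator {-\<rho>..\<rho>} h1 * ennreal (\<bar>h1\<bar> powr ?a)))"
        proof (cases "(h1, h2) \<in> square_box \<rho>")
          case True
          then have h: "\<bar>h1\<bar> \<le> 1" "h1 \<in> {-\<rho>..\<rho>}" "h2 \<in> {-\<rho>..\<rho>}"
            using r by (auto simp: mem_square_box abs_le_iff)
          have "z + h1 *\<^sub>R w + h2 *\<^sub>R e = (z + h2 *\<^sub>R e) + h1 *\<^sub>R w" for w by simp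
          note eq = this
          show ?thesis using inner[OF h1 h(1), of "z + h2 *\<^sub>R e"] True h(2,3) c
            unfolding eq by (simp add: ennreal_mult)
        qed simp
      qed
    qed
    also have "\<dots> = indicator {-\<rho>..\<rho>} h2 * (ennreal c * (\<integral>\<^sup>+h1. indicator {-\<rho>..\<rho>} h1 * ennreal (\<bar>h1\<bar> powr ?a) \<partial>lborel))"
      by (simp add: nn_integral_cmult)
    also have "\<dots> \<le> indicator {-\<rho>..\<rho>} h2 * (ennreal c * ennreal (2 * \<rho> powr (?a + 1) / (?a + 1)))"
      using s r by (intro mult_left_mono nn_integral_abs_powr_le) auto
    also have "\<dots> = indicator {-\<rho>..\<rho>} h2 * ennreal (c * (2 * \<rho> powr (?a + 1) / (?a + 1)))"
      by (simp only: ennreal_mult'[OF c])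
    finally show "(\<integral>\<^sup>+h1. \<integral>\<^sup>+w. ?g h1 h2 w \<partial>lborel \<partial>lborel)
      \<le> indicator {-\<rho>..\<rho>} h2 * ennreal (c * (2 * \<rho> powr (?a + 1) / (?a + 1)))" .
  qed
  also have "\<dots> = ennreal (2 * \<rho>) * ennreal (c * (2 * \<rho> powr (?a + 1) / (?a + 1)))"
    using r by (subst nn_integral_multc) auto
  also have "\<dots> = ennreal (2 * \<rho> * (c * (2 * \<rho> powr (?a + 1) / (?a + 1))))"
    using r c s by (intro ennreal_mult[symmetric]) auto
  also have "2 * \<rho> * (c * (2 * \<rho> powr (?a + 1) / (?a + 1))) = 4 * c / (?a + 1) * \<rho> powr (?a + 2)"
  proof -
    have "\<rho> powr (?a + 2) = \<rho> * \<rho> powr (?a + 1)"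
      using r powr_add[of \<rho> "?a + 1" 1] by (simp add: add.assoc)
    then show ?thesis by simp
  qed
  finally show ?thesis .
qed

abbreviation unit_square :: "(real \<times> real) set" where
  "unit_square \<equiv> cbox (0, 0) (1, 1)"

lemma mem_unit_square: "p \<in> unit_square \<longleftrightarrow> fst p \<in> {0..1} \<and> snd p \<in> {0..1}"
  by (cases p) (auto simp: cbox_Pair_eq)

text \<open>The plane through \<open>a\<close> in the directions \<open>w\<close> and \<open>e\<close>. The base point \<open>a\<close> and the vector \<open>w\<close> range over
  full-dimensional sets, so that averages over planes are computed by substitutions in Lebesgue measure.\<close>

definition plane_point :: "'a::real_vector \<Rightarrow> 'a \<Rightarrow> 'a \<Rightarrow> real \<times> real \<Rightarrow> 'a" where
  "plane_point e a w p = a + fst p *\<^sub>R w + snd p *\<^sub>R e"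

definition plane_mass :: "(real \<times> real \<Rightarrow> ennreal) \<Rightarrow> ennreal" where
  "plane_mass g = (\<integral>\<^sup>+p. indicator unit_square p * g p \<partial>lborel)"

definition near_mass :: "(real \<times> real \<Rightarrow> ennreal) \<Rightarrow> nat \<Rightarrow> real \<times> real \<Rightarrow> ennreal" where
  "near_mass g n p = (\<integral>\<^sup>+h. indicator (square_box ((1/2) ^ n)) h * g (p + h) \<partial>lborel)"

text \<open>A dyadic form of the \<open>t\<close>-energy of the density \<open>g\<close>: up to constants, the double integral of
  \<open>g p * g q\<close> against \<open>dist p q powr (- t)\<close>, with \<open>p\<close> in the unit square.\<close>

definition plane_energy :: "real \<Rightarrow> (real \<times> real \<Rightarrow> ennreal) \<Rightarrow> ennreal" where
  "plane_energy t g = (\<Sum>n. ennreal ((2 ^ n) powr t) *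
     (\<integral>\<^sup>+p. indicator unit_square p * g p * near_mass g n p \<partial>lborel))"

lemma near_mass_measurable [measurable]:
  assumes [measurable]: "g \<in> borel_measurable borel"
  shows "near_mass g n \<in> borel_measurable borel"
  unfolding near_mass_def by measurable

lemma emeasure_unit_square: "emeasure lborel unit_square = 1"
proof -
  have "emeasure (lborel \<Otimes>\<^sub>M lborel) ({0..1::real} \<times> {0..1::real}) = 1"
    by (subst lborel.emeasure_pair_measure_Times) auto
  then show ?thesis by (simp add: lborel_prod cbox_Pair_eq)
qed

lemma near_mass_shift:
  assumes [measurable]: "g \<in> borel_measurable borel"
  shows "near_mass g n p = (\<integral>\<^sup>+x. indicator (square_box ((1/2) ^ n)) (x - p) * g x \<partial>lborel)"
  using nn_integral_translate[of "\<lambda>x. indicator (square_box ((1/2) ^ n)) (x - p) * g x" p]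
  unfolding near_mass_def by (simp add: add.commute)

text \<open>The mass distribution principle. The points where the potential exceeds \<open>L\<close> carry mass at most
  \<open>1 / L\<close> times the energy. A ball of radius \<open>r\<close> containing a point of potential at most \<open>L\<close> has mass at
  most \<open>L * (4 * r) powr t\<close>. Here the potential at \<open>p\<close> is the sum in the energy without the integration over \<open>p\<close>.\<close>

lemma plane_mass_le_of_small_cover:
  assumes g[measurable]: "g \<in> borel_measurable borel" and t: "0 < t" and L: "0 < L"
    and k: "\<kappa> \<le> (1/2) powr t"
    and S: "\<And>p. p \<in> unit_square \<Longrightarrow> g p \<noteq> 0 \<Longrightarrow> p \<in> S" and sc: "small_cover t \<kappa> S"
  shows "plane_mass g \<le> ennreal (L * 4 powr t * \<kappa>) + ennreal (1 / L) * plane_energy t g"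
proof -
  define \<phi> where "\<phi> p = (\<Sum>n. ennreal ((2 ^ n) powr t) * near_mass g n p)" for p
  have [measurable]: "\<phi> \<in> borel_measurable borel" unfolding \<phi>_def by measurable
  have energy: "plane_energy t g = (\<integral>\<^sup>+p. indicator unit_square p * g p * \<phi> p \<partial>lborel)"
  proof -
    have "(\<integral>\<^sup>+p. indicator unit_square p * g p * \<phi> p \<partial>lborel) =
      (\<integral>\<^sup>+p. (\<Sum>n. ennreal ((2 ^ n) powr t) * (indicator unit_square p * g p * near_mass g n p)) \<partial>lborel)"
      unfolding \<phi>_def ennreal_suminf_cmult[symmetric] by (simp add: mult.left_commute)
    also have "\<dots> = plane_energy t g"
      unfolding plane_energy_def by (subst nn_integral_suminf) (auto simp: nn_integral_cmult)
    finally show ?thesis ..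
  qed
  define A where "A = {p. \<phi> p \<le> ennreal L}"
  have [measurable]: "A \<in> sets borel" unfolding A_def by measurable
  obtain c r where r: "\<And>i::nat. 0 \<le> r i" and cov: "S \<subseteq> (\<Union>i. ball (c i) (r i))"
    and sum: "(\<Sum>i. ennreal (r i powr t)) < ennreal \<kappa>"
    using sc unfolding small_cover_def by blast
  let ?b = "\<lambda>i p. indicator (ball (c i) (r i) \<inter> A) p * g p"
  have k0: "\<kappa> > 0" using sum by (metis ennreal_neg not_le not_less_zero)
  have r2: "2 * r i \<le> 1" for i
  proof (rule ccontr)
    assume "\<not> 2 * r i \<le> 1"
    then have "(1/2) powr t \<le> r i powr t" using t by (intro powr_mono2) auto
    then have "ennreal \<kappa> \<le> ennreal (r i powr t)" using k by (intro ennreal_leI) auto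
    also have "\<dots> \<le> (\<Sum>i. ennreal (r i powr t))" by (rule term_le_suminf_ennreal)
    finally show False using sum leD by blast
  qed
  have ball_mass: "(\<integral>\<^sup>+p. ?b i p \<partial>lborel) \<le> ennreal (L * 4 powr t) * ennreal (r i powr t)" for i
  proof (cases "ball (c i) (r i) \<inter> A = {}")
    case False
    then obtain p where p: "dist (c i) p < r i" "\<phi> p \<le> ennreal L" by (auto simp: A_def)
    then have ri: "0 < 2 * r i" using zero_le_dist[of "c i" p] by linarith
    obtain n where n: "(1/2) ^ Suc n < 2 * r i" "2 * r i \<le> (1/2) ^ n" using dyadic_scale[OF ri r2] .
    have sub: "x - p \<in> square_box ((1/2) ^ n)" if "x \<in> ball (c i) (r i)" for x
    proof -
      have "dist x p < 2 * r i" using that p(1) dist_triangle3[of x p "c i"] by simp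
      then have "norm (x - p) \<le> (1/2) ^ n" using n(2) by (simp add: dist_norm)
      then have "\<bar>fst (x - p)\<bar> \<le> (1/2) ^ n" "\<bar>snd (x - p)\<bar> \<le> (1/2) ^ n"
        using norm_fst_le[of "fst (x - p)" "snd (x - p)"] norm_snd_le[of "snd (x - p)" "fst (x - p)"]
        unfolding prod.collapse real_norm_def by linarith+
      then show ?thesis by (simp add: mem_square_box)
    qed
    have "(\<integral>\<^sup>+p. ?b i p \<partial>lborel) \<le> near_mass g n p"
      unfolding near_mass_shift[OF g] using sub
      by (intro nn_integral_mono) (auto simp: indicator_def)
    also have "\<dots> \<le> ennreal (L * ((1/2) ^ n) powr t)"
    proof -
      have "ennreal ((2 ^ n) powr t) * near_mass g n p \<le> ennreal L"
        using term_le_suminf_ennreal[of "\<lambda>n. ennreal ((2 ^ n) powr t) * near_mass g n p" n] p(2)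
        unfolding \<phi>_def by (rule order_trans)
      then have "ennreal (((1/2) ^ n) powr t) * (ennreal ((2 ^ n) powr t) * near_mass g n p) \<le> ennreal (((1/2) ^ n) powr t) * ennreal L"
        by (rule mult_left_mono) simp
      moreover have "((1/2) ^ n) powr t * (2 ^ n) powr t = 1"
        using powr_mult[of "(1/2) ^ n" "2 ^ n" t] by (simp add: power_one_over)
      then have "ennreal (((1/2) ^ n) powr t) * (ennreal ((2 ^ n) powr t) * near_mass g n p) = near_mass g n p"
        unfolding mult.assoc[symmetric] by (subst ennreal_mult'[symmetric]) simp_all
      moreover have "ennreal (((1/2) ^ n) powr t) * ennreal L = ennreal (L * ((1/2) ^ n) powr t)"
        using L by (subst ennreal_mult'[symmetric]) (auto simp: mult.commute)
      ultimately show ?thesis by simp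
    qed
    also have "\<dots> \<le> ennreal (L * (4 powr t * r i powr t))"
    proof -
      have "(1/2) ^ n \<le> 4 * r i" using n(1) by simp
      then have "((1/2) ^ n) powr t \<le> (4 * r i) powr t" using t by (intro powr_mono2) auto
      then show ?thesis using L ri by (intro ennreal_leI mult_left_mono) (auto simp: powr_mult)
    qed
    also have "\<dots> = ennreal (L * 4 powr t) * ennreal (r i powr t)"
      using L by (simp add: ennreal_mult[symmetric] mult.assoc)
    finally show ?thesis .
  qed simp
  have "plane_mass g \<le> (\<integral>\<^sup>+p. (\<Sum>i. ?b i p) +
      ennreal (1 / L) * (indicator unit_square p * g p * \<phi> p) \<partial>lborel)"
    unfolding plane_mass_def
  proof (rule nn_integral_mono)
    fix p
    show "indicator unit_square p * g p \<le> (\<Sum>i. ?b i p) +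
      ennreal (1 / L) * (indicator unit_square p * g p * \<phi> p)"
    proof (cases "p \<in> unit_square \<and> g p \<noteq> 0")
      case True
      show ?thesis
      proof (cases "p \<in> A")
        case pA: True
        have "p \<in> S" using S True by blast
        then obtain i where i: "p \<in> ball (c i) (r i)" using cov by blast
        have "indicator unit_square p * g p \<le> ?b i p"
          using i pA True by simp
        also have "\<dots> \<le> (\<Sum>i. ?b i p)" by (rule term_le_suminf_ennreal)
        finally show ?thesis by (rule order_trans) simp
      next
        case False
        then have "ennreal L \<le> \<phi> p" by (simp add: A_def)
        then have "ennreal (1 / L) * ennreal L \<le> ennreal (1 / L) * \<phi> p" by (rule mult_left_mono) simp
        then have "1 \<le> ennreal (1 / L) * \<phi> p" using L by (simp add: ennreal_mult'[symmetric])
        then have "g p * 1 \<le> g p * (ennreal (1 / L) * \<phi> p)" by (rule mult_left_mono) simp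
        then have "indicator unit_square p * g p \<le> ennreal (1 / L) * (indicator unit_square p * g p * \<phi> p)"
          using True by (simp add: ac_simps)
        then show ?thesis by (rule order_trans) simp
      qed
    qed auto
  qed
  also have "\<dots> = (\<Sum>i. \<integral>\<^sup>+p. ?b i p \<partial>lborel) + ennreal (1 / L) * plane_energy t g"
  proof -
    have [measurable]: "ball (c i) (r i) \<inter> A \<in> sets borel" for i
      using \<open>A \<in> sets borel\<close> by (intro sets.Int) auto
    have "(\<lambda>p. ?b i p) \<in> borel_measurable borel" for i
      by (intro borel_measurable_times_ennreal borel_measurable_indicator) auto
    then have m: "(\<lambda>p. ?b i p) \<in> borel_measurable lborel" for i
      by simp
    have "(\<integral>\<^sup>+p. (\<Sum>i. ?b i p) +
      ennreal (1 / L) * (indicator unit_square p * g p * \<phi> p) \<partial>lborel) =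
      (\<integral>\<^sup>+p. (\<Sum>i. ?b i p) \<partial>lborel) +
      (\<integral>\<^sup>+p. ennreal (1 / L) * (indicator unit_square p * g p * \<phi> p) \<partial>lborel)"
    proof (rule nn_integral_add)
      show "(\<lambda>p. \<Sum>i. ?b i p) \<in> borel_measurable lborel"
        using m by (rule borel_measurable_suminf_order)
    qed simp
    also have "(\<integral>\<^sup>+p. (\<Sum>i. ?b i p) \<partial>lborel)
      = (\<Sum>i. \<integral>\<^sup>+p. ?b i p \<partial>lborel)"
      using m by (rule nn_integral_suminf)
    also have "(\<integral>\<^sup>+p. ennreal (1 / L) * (indicator unit_square p * g p * \<phi> p) \<partial>lborel) =
      ennreal (1 / L) * plane_energy t g"
      unfolding energy by (rule nn_integral_cmult) measurable
    finally show ?thesis .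
  qed
  also have "\<dots> \<le> (\<Sum>i. ennreal (L * 4 powr t) * ennreal (r i powr t)) + ennreal (1 / L) * plane_energy t g"
    by (intro add_right_mono suminf_le ball_mass) auto
  also have "(\<Sum>i. ennreal (L * 4 powr t) * ennreal (r i powr t)) = ennreal (L * 4 powr t) * (\<Sum>i. ennreal (r i powr t))"
    by (rule ennreal_suminf_cmult)
  also have "ennreal (L * 4 powr t) * (\<Sum>i. ennreal (r i powr t)) \<le> ennreal (L * 4 powr t) * ennreal \<kappa>"
    using sum by (intro mult_left_mono) auto
  also have "ennreal (L * 4 powr t) * ennreal \<kappa> = ennreal (L * 4 powr t * \<kappa>)"
    using L k0 by (simp add: ennreal_mult[symmetric])
  finally show ?thesis by (simp add: add_right_mono)
qed

text \<open>At level \<open>0\<close> every point of the unit square sees the whole square, so the energy dominates the square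
  of the mass.\<close>

lemma plane_mass_le_energy:
  assumes g[measurable]: "g \<in> borel_measurable borel" and L: "0 < L"
  shows "plane_mass g \<le> ennreal L + ennreal (1 / L) * plane_energy t g"
proof (cases "plane_mass g \<le> ennreal L")
  case True then show ?thesis by (simp add: add_increasing2)
next
  case False
  have "plane_mass g * plane_mass g = (\<integral>\<^sup>+p. indicator unit_square p * g p * plane_mass g \<partial>lborel)"
    by (subst nn_integral_multc) (auto simp: plane_mass_def)
  also have "\<dots> \<le> (\<integral>\<^sup>+p. indicator unit_square p * g p * near_mass g 0 p \<partial>lborel)"
  proof (rule nn_integral_mono)
    fix p
    show "indicator unit_square p * g p * plane_mass g \<le> indicator unit_square p * g p * near_mass g 0 p"
    proof (cases "p \<in> unit_square")
      case True
      then have "x - p \<in> square_box 1" if "x \<in> unit_square" for x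
        using that True by (auto simp: mem_square_box mem_unit_square abs_le_iff)
      then have "plane_mass g \<le> near_mass g 0 p"
        unfolding near_mass_shift[OF g] plane_mass_def by (intro nn_integral_mono) (auto simp: indicator_def)
      then show ?thesis by (rule mult_left_mono) simp
    qed simp
  qed
  also have "\<dots> \<le> plane_energy t g"
    unfolding plane_energy_def
    using term_le_suminf_ennreal[of "\<lambda>n. ennreal ((2 ^ n) powr t) *
     (\<integral>\<^sup>+p. indicator unit_square p * g p * near_mass g n p \<partial>lborel)" 0] by simp
  finally have sq: "plane_mass g * plane_mass g \<le> plane_energy t g" .
  have "1 \<le> ennreal (1 / L) * plane_mass g"
  proof -
    have "ennreal (1 / L) * ennreal L \<le> ennreal (1 / L) * plane_mass g"
      using False by (intro mult_left_mono) auto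
    then show ?thesis using L by (simp add: ennreal_mult'[symmetric])
  qed
  then have "plane_mass g * 1 \<le> plane_mass g * (ennreal (1 / L) * plane_mass g)" by (rule mult_left_mono) simp
  also have "\<dots> = ennreal (1 / L) * (plane_mass g * plane_mass g)" by (simp add: ac_simps)
  also have "\<dots> \<le> ennreal (1 / L) * plane_energy t g" using sq by (rule mult_left_mono) simp
  finally show ?thesis by (simp add: add_increasing)
qed

section \<open>Slices of a compact set\<close>

lemma plane_point_measurable [measurable (raw)]:
  fixes e :: "'a::euclidean_space"
  assumes [measurable]: "a \<in> borel_measurable M" "w \<in> borel_measurable M" "p \<in> borel_measurable M"
  shows "(\<lambda>x. plane_point e (a x) (w x) (p x)) \<in> borel_measurable M"
  unfolding plane_point_def by measurable

lemma plane_mass_average: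
  fixes f :: "'a::euclidean_space \<Rightarrow> ennreal"
  assumes f[measurable]: "f \<in> borel_measurable borel"
  shows "(\<integral>\<^sup>+a. plane_mass (\<lambda>p. f (plane_point e a w p)) \<partial>lborel) = (\<integral>\<^sup>+x. f x \<partial>lborel)"
proof -
  have "(\<integral>\<^sup>+a. plane_mass (\<lambda>p. f (plane_point e a w p)) \<partial>lborel) =
      (\<integral>\<^sup>+p. \<integral>\<^sup>+a. indicator unit_square p * f (plane_point e a w p) \<partial>lborel \<partial>lborel)"
    unfolding plane_mass_def by (rule lborel_pair.Fubini') measurable
  also have "\<dots> = (\<integral>\<^sup>+p. indicator unit_square p * (\<integral>\<^sup>+x. f x \<partial>lborel) \<partial>lborel)"
  proof (rule nn_integral_cong)
    fix p :: "real \<times> real"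
    have "(\<integral>\<^sup>+a. f (plane_point e a w p) \<partial>lborel) = (\<integral>\<^sup>+x. f x \<partial>lborel)"
      using nn_integral_translate[OF f, of "fst p *\<^sub>R w + snd p *\<^sub>R e"] by (simp add: plane_point_def add.assoc)
    then show "(\<integral>\<^sup>+a. indicator unit_square p * f (plane_point e a w p) \<partial>lborel) = indicator unit_square p * (\<integral>\<^sup>+x. f x \<partial>lborel)"
      by (subst nn_integral_cmult) auto
  qed
  also have "\<dots> = (\<integral>\<^sup>+x. f x \<partial>lborel)"
    by (subst nn_integral_multc) (auto simp: emeasure_unit_square)
  finally show ?thesis .
qed

text \<open>Translating in \<open>a\<close> removes the position \<open>p\<close> in the plane, and leaves the integral of \<open>f\<close> against the
  averages over small parallelograms.\<close>

lemma near_energy_average: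
  fixes f :: "real ^ 'd \<Rightarrow> ennreal"
  assumes f[measurable]: "f \<in> borel_measurable borel"
    and box: "\<And>x r. 0 < r \<Longrightarrow> r \<le> 1 \<Longrightarrow>
      (\<integral>\<^sup>+y. f y * indicator (cube_box x r) y \<partial>lborel) \<le> ennreal (c * r powr s)"
    and c: "0 \<le> c" and s: "real CARD('d) - 1 < s"
  shows "(\<integral>\<^sup>+w. indicator (cube_box 0 1) w * (\<integral>\<^sup>+a. (\<integral>\<^sup>+p. indicator unit_square p * f (plane_point e a w p) *
      near_mass (\<lambda>p. f (plane_point e a w p)) n p \<partial>lborel) \<partial>lborel) \<partial>lborel)
    \<le> (\<integral>\<^sup>+x. f x \<partial>lborel) * ennreal (4 * c / (s - real CARD('d) + 1) * ((1/2) ^ n) powr (s - real CARD('d) + 2))"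
    (is "?lhs \<le> _ * ?K")
proof -
  define G where "G w x = (\<integral>\<^sup>+h. indicator (square_box ((1/2) ^ n)) h * f (x + fst h *\<^sub>R w + snd h *\<^sub>R e) \<partial>lborel)" for w x
  have G_meas: "case_prod G \<in> borel_measurable (borel \<Otimes>\<^sub>M borel)"
    unfolding G_def by measurable
  have [measurable]: "(\<lambda>x. G (u x) (v x)) \<in> borel_measurable M"
    if "u \<in> borel_measurable M" "v \<in> borel_measurable M" for u v and M :: "'m measure"
    using measurable_compose[OF measurable_Pair[OF that] G_meas] by simp
  have Gm: "(\<lambda>x. f x * G w x) \<in> borel_measurable borel" for w
    unfolding G_def by measurable
  have near: "near_mass (\<lambda>p. f (plane_point e a w p)) n p = G w (plane_point e a w p)" for a w p
    unfolding near_mass_def G_def plane_point_def by (simp add: algebra_simps)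
  have "?lhs = (\<integral>\<^sup>+w. indicator (cube_box 0 1) w * (\<integral>\<^sup>+x. f x * G w x \<partial>lborel) \<partial>lborel)"
    using plane_mass_average[OF Gm, of e]
    by (simp add: near plane_mass_def mult.assoc)
  also have "\<dots> = (\<integral>\<^sup>+w. \<integral>\<^sup>+x. indicator (cube_box 0 1) w * (f x * G w x) \<partial>lborel \<partial>lborel)"
    using Gm by (subst nn_integral_cmult) auto
  also have "\<dots> = (\<integral>\<^sup>+x. \<integral>\<^sup>+w. indicator (cube_box 0 1) w * (f x * G w x) \<partial>lborel \<partial>lborel)"
    unfolding G_def by (rule lborel_pair.Fubini'[symmetric]) measurable
  also have "\<dots> = (\<integral>\<^sup>+x. f x * (\<integral>\<^sup>+w. indicator (cube_box 0 1) w * G w x \<partial>lborel) \<partial>lborel)"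
    unfolding G_def by (subst nn_integral_cmult[symmetric]) (auto simp: mult.left_commute)
  also have "\<dots> \<le> (\<integral>\<^sup>+x. f x * ?K \<partial>lborel)"
    unfolding G_def
    by (intro nn_integral_mono mult_left_mono parallelogram_average[OF f box c s]) (auto simp: power_le_one)
  also have "\<dots> = (\<integral>\<^sup>+x. f x \<partial>lborel) * ?K" by (rule nn_integral_multc) simp
  finally show ?thesis .
qed

lemma plane_energy_average:
  fixes f :: "real ^ 'd \<Rightarrow> ennreal"
  assumes f[measurable]: "f \<in> borel_measurable borel"
    and box: "\<And>x r. 0 < r \<Longrightarrow> r \<le> 1 \<Longrightarrow>
      (\<integral>\<^sup>+y. f y * indicator (cube_box x r) y \<partial>lborel) \<le> ennreal (c * r powr s)"
    and c: "0 \<le> c" and s: "real CARD('d) - 1 < s" and t: "t < s - real CARD('d) + 2"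
  shows "(\<integral>\<^sup>+w. indicator (cube_box 0 1) w * (\<integral>\<^sup>+a. plane_energy t (\<lambda>p. f (plane_point e a w p)) \<partial>lborel) \<partial>lborel)
    \<le> (\<integral>\<^sup>+x. f x \<partial>lborel) * ennreal (4 * c / (s - real CARD('d) + 1) / (1 - 2 powr (t - (s - real CARD('d) + 2))))"
proof -
  let ?M = "\<integral>\<^sup>+x. f x \<partial>lborel"
  let ?g = "s - real CARD('d) + 2"
  let ?K = "4 * c / (s - real CARD('d) + 1)"
  let ?E = "\<lambda>n a w. \<integral>\<^sup>+p. indicator unit_square p * f (plane_point e a w p) * near_mass (\<lambda>p. f (plane_point e a w p)) n p \<partial>lborel"
  have Em: "(\<lambda>x. ?E n (fst x) (snd x)) \<in> borel_measurable (borel \<Otimes>\<^sub>M borel)" for n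
    unfolding near_mass_def by measurable
  have Em1: "(\<lambda>a. ?E n a w) \<in> borel_measurable borel" for n w
    unfolding near_mass_def by measurable
  have Em2: "(\<lambda>w. \<integral>\<^sup>+a. ?E n a w \<partial>lborel) \<in> borel_measurable borel" for n
    unfolding near_mass_def by measurable
  have K: "?K \<ge> 0" using c s by simp
  have q: "2 powr (t - ?g) < 1" using t by (simp add: powr_less_one)
  have "(\<integral>\<^sup>+w. indicator (cube_box 0 1) w * (\<integral>\<^sup>+a. plane_energy t (\<lambda>p. f (plane_point e a w p)) \<partial>lborel) \<partial>lborel)
    = (\<integral>\<^sup>+w. indicator (cube_box 0 1) w * (\<Sum>n. ennreal ((2 ^ n) powr t) * (\<integral>\<^sup>+a. ?E n a w \<partial>lborel)) \<partial>lborel)"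
    unfolding plane_energy_def using Em1
    by (subst nn_integral_suminf) (auto simp: nn_integral_cmult)
  also have "\<dots> = (\<integral>\<^sup>+w. (\<Sum>n. ennreal ((2 ^ n) powr t) * (indicator (cube_box 0 1) w * (\<integral>\<^sup>+a. ?E n a w \<partial>lborel))) \<partial>lborel)"
    unfolding ennreal_suminf_cmult[symmetric] by (simp only: mult.left_commute)
  also have "\<dots> = (\<Sum>n. ennreal ((2 ^ n) powr t) * (\<integral>\<^sup>+w. indicator (cube_box 0 1) w * (\<integral>\<^sup>+a. ?E n a w \<partial>lborel) \<partial>lborel))"
    using Em2 by (subst nn_integral_suminf) (auto simp: nn_integral_cmult)
  also have "\<dots> \<le> (\<Sum>n. ?M * ennreal (?K * (2 powr (t - ?g)) ^ n))"
  proof (rule suminf_le)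
    fix n
    have "ennreal ((2 ^ n) powr t) * (\<integral>\<^sup>+w. indicator (cube_box 0 1) w * (\<integral>\<^sup>+a. ?E n a w \<partial>lborel) \<partial>lborel)
      \<le> ennreal ((2 ^ n) powr t) * (?M * ennreal (?K * ((1/2) ^ n) powr ?g))"
      by (intro mult_left_mono near_energy_average[OF f box c s]) auto
    also have "\<dots> = ?M * ennreal ((2 ^ n) powr t * (?K * ((1/2) ^ n) powr ?g))"
      by (subst ennreal_mult'[of "(2 ^ n) powr t"]) (simp_all only: mult.left_commute powr_ge_zero)
    also have "(2 ^ n) powr t * (?K * ((1/2) ^ n) powr ?g) = ?K * (2 powr (t - ?g)) ^ n"
    proof -
      have "(2 ^ n) powr t = 2 powr (real n * t)" by (simp add: powr_realpow[symmetric] powr_powr)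
      moreover have "((1/2) ^ n) powr ?g = 2 powr (- real n * ?g)"
        by (simp add: power_one_over powr_realpow[symmetric] powr_powr powr_minus_divide powr_divide)
      moreover have "(2 powr (t - ?g)) ^ n = 2 powr (real n * t) * 2 powr (- real n * ?g)"
        by (simp add: powr_realpow[symmetric] powr_powr powr_add[symmetric] algebra_simps)
      ultimately show ?thesis by simp
    qed
    finally show "ennreal ((2 ^ n) powr t) * (\<integral>\<^sup>+w. indicator (cube_box 0 1) w * (\<integral>\<^sup>+a. ?E n a w \<partial>lborel) \<partial>lborel)
      \<le> ?M * ennreal (?K * (2 powr (t - ?g)) ^ n)" .
  qed auto
  also have "\<dots> = ?M * (\<Sum>n. ennreal (?K * (2 powr (t - ?g)) ^ n))" by (rule ennreal_suminf_cmult)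
  also have "(\<Sum>n. ennreal (?K * (2 powr (t - ?g)) ^ n)) = ennreal (?K * (1 / (1 - 2 powr (t - ?g))))"
    by (intro suminf_ennreal_eq sums_mult geometric_sums mult_nonneg_nonneg K) (use q in auto)
  finally show ?thesis by simp
qed

lemma nn_integral_pair_snd_first:
  fixes F :: "('a::euclidean_space \<times> 'b::euclidean_space) \<Rightarrow> ennreal"
  assumes [measurable]: "F \<in> borel_measurable borel"
  shows "(\<integral>\<^sup>+y. F y \<partial>lborel) = (\<integral>\<^sup>+w. \<integral>\<^sup>+a. F (a, w) \<partial>lborel \<partial>lborel)"
  by (subst lborel_pair.nn_integral_snd) (auto simp: lborel_prod)

lemma plane_mass_measurable [measurable (raw)]:
  assumes [measurable]: "(\<lambda>(x, p). g x p) \<in> borel_measurable (M \<Otimes>\<^sub>M borel)"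
  shows "(\<lambda>x. plane_mass (g x)) \<in> borel_measurable M"
  unfolding plane_mass_def by measurable

lemma plane_energy_measurable [measurable]:
  fixes f :: "'a::euclidean_space \<Rightarrow> ennreal"
  assumes [measurable]: "f \<in> borel_measurable borel"
  shows "(\<lambda>y. plane_energy t (\<lambda>p. f (plane_point e (fst y) (snd y) p))) \<in> borel_measurable borel"
  unfolding plane_energy_def near_mass_def by measurable

abbreviation plane_slice :: "real ^ 'd \<Rightarrow> (real ^ 'd) set \<Rightarrow> (real ^ 'd) \<times> (real ^ 'd) \<Rightarrow> (real \<times> real) set" where
  "plane_slice e C y \<equiv> {p \<in> unit_square. plane_point e (fst y) (snd y) p \<in> C}"

abbreviation costly_planes :: "real \<Rightarrow> real \<Rightarrow> real ^ 'd \<Rightarrow> (real ^ 'd) set \<Rightarrow> ((real ^ 'd) \<times> (real ^ 'd)) set" where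
  "costly_planes t \<kappa> e C \<equiv> {y. snd y \<in> cube_box 0 1 \<and> \<not> small_cover t \<kappa> (plane_slice e C y)}"

lemma emeasure_INT_closed_ge:
  fixes E :: "nat \<Rightarrow> 'a::euclidean_space set"
  assumes E: "\<And>n. closed (E n)" "\<And>n. E (Suc n) \<subseteq> E n" "\<And>n. E n \<subseteq> C" and C: "compact C"
    and m: "\<And>n. m \<le> emeasure lborel (E n)"
  shows "m \<le> emeasure lborel (\<Inter>n. E n)"
proof -
  have "m \<le> (INF n. emeasure lborel (E n))" using m by (rule INF_greatest)
  also have "\<dots> = emeasure lborel (\<Inter>n. E n)"
  proof (rule INF_emeasure_decseq)
    show "range E \<subseteq> sets lborel" using E(1) by auto
    show "decseq E" using E(2) by (rule decseq_SucI)
    show "emeasure lborel (E n) \<noteq> \<infinity>" for n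
      using emeasure_bounded_finite[OF bounded_subset[OF compact_imp_bounded[OF C] E(3)], of n] by auto
  qed
  finally show ?thesis .
qed

lemma closed_plane_point_preimage:
  fixes e :: "'a::euclidean_space"
  assumes "closed C"
  shows "closed {(y, p). p \<in> unit_square \<and> plane_point e (fst y) (snd y) p \<in> C}"
proof -
  have "{(y, p). p \<in> unit_square \<and> plane_point e (fst y) (snd y) p \<in> C} =
    (snd -` unit_square) \<inter> ((\<lambda>(y, p). plane_point e (fst y) (snd y) p) -` C)" by auto
  moreover have "closed (snd -` unit_square :: (('a \<times> 'a) \<times> real \<times> real) set)"
    by (intro closed_vimage) (auto intro!: continuous_intros)
  moreover have "closed ((\<lambda>(y, p). plane_point e (fst y) (snd y) p) -` C :: (('a \<times> 'a) \<times> real \<times> real) set)"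
    using assms by (intro closed_vimage) (auto simp: plane_point_def split_def intro!: continuous_intros)
  ultimately show ?thesis by (simp add: closed_Int)
qed

lemma closed_costly_planes:
  fixes e :: "real ^ 'd"
  assumes "closed C"
  shows "closed (costly_planes t \<kappa> e C)" (is "closed ?G")
proof -
  let ?B = "{y. \<not> small_cover t \<kappa> {p. (y, p) \<in> {(y, p). p \<in> unit_square \<and> plane_point e (fst y) (snd y) p \<in> C}}}"
  have "closed ?B"
    by (rule closed_not_small_cover[OF closed_plane_point_preimage[OF assms] compact_cbox]) auto
  moreover have "closed (snd -` cube_box 0 1 :: ((real ^ 'd) \<times> (real ^ 'd)) set)"
    by (intro closed_vimage) (auto intro!: continuous_intros)
  moreover have "?G = ?B \<inter> snd -` cube_box 0 1" by auto
  ultimately show ?thesis by (simp add: closed_Int)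
qed

text \<open>If the conclusion failed, few planes would carry the total mass. On the planes with a cheap cover the
  mass is controlled by \<open>plane_mass_le_of_small_cover\<close>, on the remaining ones by
  \<open>plane_mass_le_energy\<close>. Integrated over all planes, the energy terms are at most a quarter of the
  total mass by the choice of \<open>L\<close>, and the cheap covers contribute at most \<open>m / 4\<close> by the choice
  of \<open>\<kappa>\<close>. The resulting bound depends on \<open>f\<close> only through \<open>c\<close> and \<open>m\<close>, so it is uniform in the resolution.\<close>

lemma emeasure_costly_planes_ge:
  fixes C :: "(real ^ 'd) set" and f :: "real ^ 'd \<Rightarrow> ennreal"
  assumes C: "closed C" and f[measurable]: "f \<in> borel_measurable borel" and fC: "\<And>x. f x \<noteq> 0 \<Longrightarrow> x \<in> C"
    and box: "\<And>x r. 0 < r \<Longrightarrow> r \<le> 1 \<Longrightarrow>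
      (\<integral>\<^sup>+y. f y * indicator (cube_box x r) y \<partial>lborel) \<le> ennreal (c * r powr s)"
    and c: "0 < c" and s: "real CARD('d) - 1 < s" and t: "0 < t" "t < s - real CARD('d) + 2"
    and M: "ennreal m \<le> (\<integral>\<^sup>+x. f x \<partial>lborel)" "(\<integral>\<^sup>+x. f x \<partial>lborel) < \<infinity>" and m: "0 < m"
    and \<Omega>: "\<And>a w p. w \<in> cube_box 0 1 \<Longrightarrow> p \<in> unit_square \<Longrightarrow> plane_point e a w p \<in> C \<Longrightarrow> a \<in> \<Omega>"
      "\<Omega> \<in> sets borel" "emeasure lborel (\<Omega> \<times> cube_box (0 :: real ^ 'd) 1) \<le> ennreal v" "0 < v"
    and L: "L = 4 * (4 * c / (s - real CARD('d) + 1) / (1 - 2 powr (t - (s - real CARD('d) + 2))))"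
    and k: "0 < \<kappa>" "\<kappa> \<le> (1/2) powr t" "L * 4 powr t * \<kappa> * v \<le> m / 4"
  shows "ennreal (m / (4 * L)) \<le>
    emeasure lborel (costly_planes t \<kappa> e C)"
proof -
  let ?W = "cube_box (0 :: real ^ 'd) 1"
  let ?S = "\<lambda>y. (plane_slice e C y)"
  let ?g = "\<lambda>y p. f (plane_point e (fst y) (snd y) p)"
  define G where "G = costly_planes t \<kappa> e C"
  define M where "M = (\<integral>\<^sup>+x. f x \<partial>lborel)"
  have Lpos: "L > 0" unfolding L using c s t by (simp add: powr_less_one)
  have [measurable]: "G \<in> sets borel"
    unfolding G_def by (rule borel_closed[OF closed_costly_planes[OF C]])
  have OWm [measurable]: "\<Omega> \<times> ?W \<in> sets borel"
    using \<Omega>(2) by (simp add: borel_prod[symmetric])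
  have gm: "?g y \<in> borel_measurable borel" for y by measurable
  have vol: "emeasure lborel ?W \<ge> 1" by (subst emeasure_cube_box) auto
  have pos: "indicator ?W (snd y) * plane_mass (?g y) \<le> ennreal (L * 4 powr t * \<kappa>) * indicator (\<Omega> \<times> ?W) y +
      ennreal L * indicator G y + ennreal (1 / L) * (indicator ?W (snd y) * plane_energy t (?g y))" for y
  proof (cases "snd y \<in> ?W")
    case W: True
    show ?thesis
    proof (cases "y \<in> G")
      case True
      then show ?thesis using plane_mass_le_energy[OF gm Lpos, of y t] W
        by (simp add: add.assoc add_increasing)
    next
      case False
      then have sc: "small_cover t \<kappa> (plane_slice e C y)" using W by (simp add: G_def)
      show ?thesis
      proof (cases "fst y \<in> \<Omega>")
        case True
        have "plane_mass (?g y) \<le> ennreal (L * 4 powr t * \<kappa>) + ennreal (1 / L) * plane_energy t (?g y)"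
          by (rule plane_mass_le_of_small_cover[OF gm t(1) Lpos k(2) _ sc]) (use fC in auto)
        then show ?thesis using W True False by (cases y) simp
      next
        case False
        then have "?g y p = 0" if "p \<in> unit_square" for p using \<Omega>(1)[OF W that] fC by blast
        then have "indicator unit_square p * ?g y p = 0" for p by (cases "p \<in> unit_square") auto
        then have "plane_mass (?g y) = 0" unfolding plane_mass_def by (simp only: nn_integral_0_iff_AE) simp
        then show ?thesis by simp
      qed
    qed
  qed simp
  have "M * emeasure lborel ?W = (\<integral>\<^sup>+w. indicator ?W w * (\<integral>\<^sup>+a. plane_mass (\<lambda>p. f (plane_point e a w p)) \<partial>lborel) \<partial>lborel)"
    unfolding plane_mass_average[OF f] M_def by (subst nn_integral_multc) (auto simp: mult.commute)
  also have "\<dots> = (\<integral>\<^sup>+y. indicator ?W (snd y) * plane_mass (?g y) \<partial>lborel)"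
    by (subst nn_integral_pair_snd_first) (auto simp: nn_integral_cmult)
  also have "\<dots> \<le> (\<integral>\<^sup>+y. ennreal (L * 4 powr t * \<kappa>) * indicator (\<Omega> \<times> ?W) y +
      ennreal L * indicator G y + ennreal (1 / L) * (indicator ?W (snd y) * plane_energy t (?g y)) \<partial>lborel)"
    by (intro nn_integral_mono pos)
  also have "\<dots> = ennreal (L * 4 powr t * \<kappa>) * emeasure lborel (\<Omega> \<times> ?W) + ennreal L * emeasure lborel G
     + ennreal (1 / L) * (\<integral>\<^sup>+y. indicator ?W (snd y) * plane_energy t (?g y) \<partial>lborel)"
  proof -
    define E where "E y = indicator ?W (snd y) * plane_energy t (?g y)" for y
    have Em: "E \<in> borel_measurable lborel" unfolding E_def by measurable
    have "(\<integral>\<^sup>+y. ennreal (L * 4 powr t * \<kappa>) * indicator (\<Omega> \<times> ?W) y +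
        ennreal L * indicator G y + ennreal (1 / L) * E y \<partial>lborel) =
      (\<integral>\<^sup>+y. ennreal (L * 4 powr t * \<kappa>) * indicator (\<Omega> \<times> ?W) y \<partial>lborel) +
      (\<integral>\<^sup>+y. ennreal L * indicator G y \<partial>lborel) + (\<integral>\<^sup>+y. ennreal (1 / L) * E y \<partial>lborel)"
      using Em by (subst nn_integral_add[symmetric]; measurable)+
    also have "(\<integral>\<^sup>+y. ennreal (L * 4 powr t * \<kappa>) * indicator (\<Omega> \<times> ?W) y \<partial>lborel)
      = ennreal (L * 4 powr t * \<kappa>) * emeasure lborel (\<Omega> \<times> ?W)"
      by (rule nn_integral_cmult_indicator) (simp only: sets_lborel OWm)
    also have "(\<integral>\<^sup>+y. ennreal L * indicator G y \<partial>lborel) = ennreal L * emeasure lborel G"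
      by (rule nn_integral_cmult_indicator) simp
    also have "(\<integral>\<^sup>+y. ennreal (1 / L) * E y \<partial>lborel) = ennreal (1 / L) * (\<integral>\<^sup>+y. E y \<partial>lborel)"
      using Em by (rule nn_integral_cmult)
    finally show ?thesis unfolding E_def .
  qed
  also have "(\<integral>\<^sup>+y. indicator ?W (snd y) * plane_energy t (?g y) \<partial>lborel) =
     (\<integral>\<^sup>+w. indicator ?W w * (\<integral>\<^sup>+a. plane_energy t (\<lambda>p. f (plane_point e a w p)) \<partial>lborel) \<partial>lborel)"
  proof (subst nn_integral_pair_snd_first)
    have "(\<lambda>a. plane_energy t (\<lambda>p. f (plane_point e a w p))) \<in> borel_measurable borel" for w
      unfolding plane_energy_def near_mass_def by measurable
    then show "(\<integral>\<^sup>+w. \<integral>\<^sup>+a. indicator ?W (snd (a, w)) * plane_energy t (?g (a, w)) \<partial>lborel \<partial>lborel) =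
      (\<integral>\<^sup>+w. indicator ?W w * (\<integral>\<^sup>+a. plane_energy t (\<lambda>p. f (plane_point e a w p)) \<partial>lborel) \<partial>lborel)"
      by (simp add: nn_integral_cmult)
  qed measurable
  also have "ennreal (1 / L) * \<dots> \<le> ennreal (1 / L) * (M * ennreal (L / 4))"
    unfolding M_def L using plane_energy_average[OF f box _ s t(2), of e] c by (intro mult_left_mono) auto
  also have "\<dots> = M * ennreal (1 / 4)"
    using Lpos by (simp add: mult.left_commute ennreal_mult[symmetric])
  finally have main: "M * emeasure lborel ?W \<le> ennreal (L * 4 powr t * \<kappa>) * emeasure lborel (\<Omega> \<times> ?W) + ennreal L * emeasure lborel G + M * ennreal (1/4)"
    by (simp add: add_left_mono)
  have 1: "ennreal (L * 4 powr t * \<kappa>) * emeasure lborel (\<Omega> \<times> ?W) \<le> ennreal (m / 4)"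
  proof -
    have "ennreal (L * 4 powr t * \<kappa>) * emeasure lborel (\<Omega> \<times> ?W) \<le> ennreal (L * 4 powr t * \<kappa>) * ennreal v"
      using \<Omega>(3) by (rule mult_left_mono) simp
    also have "\<dots> = ennreal (L * 4 powr t * \<kappa> * v)"
      using Lpos k \<Omega>(4) by (simp add: ennreal_mult[symmetric])
    also have "\<dots> \<le> ennreal (m / 4)" using k(3) by (rule ennreal_leI)
    finally show ?thesis .
  qed
  show ?thesis
  proof (cases "emeasure lborel G = \<infinity>")
    case True then show ?thesis unfolding G_def[symmetric] by simp
  next
    case False
    then obtain g where g: "emeasure lborel G = ennreal g" "g \<ge> 0" by (metis ennreal_cases infinity_ennreal_def)
    obtain M' where M': "M = ennreal M'" "M' \<ge> 0" using assms(10) unfolding M_def by (metis ennreal_cases less_irrefl infinity_ennreal_def)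
    have mM: "m \<le> M'" using assms(9) M' m unfolding M_def[symmetric] by (simp add: M')
    have "M * 1 \<le> M * emeasure lborel ?W" using vol by (rule mult_left_mono) simp
    also have "\<dots> \<le> ennreal (m / 4) + ennreal L * emeasure lborel G + M * ennreal (1/4)"
      using main 1 by (meson add_right_mono order_trans)
    also have "\<dots> = ennreal (m / 4 + L * g + M' * (1/4))"
      using m Lpos g M' by (simp add: ennreal_plus[symmetric] ennreal_mult[symmetric] del: ennreal_plus)
    finally have "ennreal M' \<le> ennreal (m / 4 + L * g + M' * (1/4))" by (simp only: M'(1) mult_1_right)
    moreover have "0 \<le> m / 4 + L * g + M' * (1/4)" using M' m Lpos g by simp
    ultimately have "M' \<le> m / 4 + L * g + M' * (1/4)" by (simp only: ennreal_le_iff)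
    then have "m / 4 \<le> L * g" using mM m by linarith
    then have "m / (4 * L) \<le> g" using Lpos by (simp add: field_simps)
    then show ?thesis unfolding G_def[symmetric] g(1) by (rule ennreal_leI)
  qed
qed

text \<open>The slicing theorem. The neighbourhoods \<open>CN N\<close> decrease to \<open>C\<close> and support the Frostman densities of
  resolution \<open>N\<close>. Their expensive slices have measure bounded below uniformly in \<open>N\<close>, and a plane that is expensive
  for every \<open>N\<close> is expensive for \<open>C\<close>.\<close>

lemma slices_not_small_cover:
  fixes C :: "(real ^ 'd) set" and e :: "real ^ 'd"
  assumes C: "compact C" and k: "0 < k" and nsc: "\<not> small_cover s k C"
    and s: "0 < s" "real CARD('d) - 1 < s" "s \<le> real CARD('d)" and t: "0 < t" "t < s - real CARD('d) + 2"
  shows "\<exists>\<kappa>>0. emeasure lborel (costly_planes t \<kappa> e C) > 0"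
proof -
  let ?d = "CARD('d)"
  let ?W = "cube_box (0 :: real ^ 'd) 1"
  have C0: "C \<noteq> {}"
  proof
    assume "C = {}"
    then show False using nsc k by (simp add: small_cover_empty)
  qed
  obtain R where R: "\<And>x. x \<in> C \<Longrightarrow> norm x \<le> R" using compact_imp_bounded[OF C] by (auto simp: bounded_iff)
  define m where "m = k / (2 * real ?d) powr s"
  have dp: "(2 * real ?d) powr s > 0" by (simp add: zero_less_card_finite)
  have m: "m > 0" using k dp by (simp add: m_def)
  have mC: "ennreal m \<le> dyadic_content s C"
  proof (rule ccontr)
    assume "\<not> ?thesis"
    then have "dyadic_content s C < ennreal m" by simp
    from small_cover_of_dyadic_content[OF s(1) this] show False using nsc dp by (simp add: m_def)
  qed
  define \<delta> where "\<delta> N = real ?d * (1/2) ^ N" for N :: nat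
  have dpos: "\<delta> N > 0" for N by (simp add: \<delta>_def zero_less_card_finite)
  have dle: "\<delta> N \<le> \<delta> M" if "M \<le> N" for M N
    unfolding \<delta>_def using that by (intro mult_left_mono power_decreasing) auto
  define CN where "CN N = {x. infdist x C \<le> \<delta> N}" for N
  have CNc: "compact (CN N)" for N unfolding CN_def by (rule compact_infdist_le[OF C0 C dpos])
  \<comment> \<open>planes that meet the support at all; on the unit square, \<open>norm w \<le> d\<close> and \<open>\<delta> N \<le> d\<close>\<close>
  define \<Omega> where "\<Omega> = cball (0 :: real ^ 'd) (R + real ?d + real ?d + norm e)"
  have Om: "a \<in> \<Omega>" if w: "w \<in> ?W" and p: "p \<in> unit_square" and meets: "plane_point e a w p \<in> CN N" for a w p N
  proof -
    obtain y where y: "y \<in> C" "infdist (plane_point e a w p) C = dist (plane_point e a w p) y"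
      using infdist_attains_inf[OF compact_imp_closed[OF C] C0] by blast
    have 1: "norm (plane_point e a w p - y) \<le> real ?d"
    proof -
      have "dist (plane_point e a w p) y \<le> \<delta> N" using meets y(2) by (simp add: CN_def)
      also have "\<dots> \<le> real ?d" using dle[of 0 N] by (simp add: \<delta>_def[of 0])
      finally show ?thesis by (simp add: dist_norm)
    qed
    have "norm w \<le> (\<Sum>i\<in>UNIV. \<bar>w $ i\<bar>)" by (rule norm_le_l1_cart)
    also have "\<dots> \<le> (\<Sum>i\<in>(UNIV::'d set). 1)" using w unfolding mem_cube_box by (intro sum_mono) auto
    finally have 2: "norm w \<le> real ?d" by simp
    have 3: "norm (fst p *\<^sub>R w) \<le> norm w" "norm (snd p *\<^sub>R e) \<le> norm e"
      using p unfolding mem_unit_square by (auto intro!: mult_left_le_one_le)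
    have "a = (plane_point e a w p - y) + y - fst p *\<^sub>R w - snd p *\<^sub>R e" by (simp add: plane_point_def)
    moreover have "norm (x + y - u - v) \<le> norm x + norm y + norm u + norm v" for x y u v :: "real ^ 'd"
      using norm_triangle_ineq[of x y] norm_triangle_ineq4[of "x + y" u] norm_triangle_ineq4[of "x + y - u" v]
      by linarith
    ultimately have "norm a \<le> norm (plane_point e a w p - y) + norm y + norm (fst p *\<^sub>R w) + norm (snd p *\<^sub>R e)"
      by metis
    then show ?thesis using 1 2 3 R[OF y(1)] by (simp add: \<Omega>_def)
  qed
  have OW: "compact (\<Omega> \<times> ?W)" unfolding \<Omega>_def by (intro compact_Times) auto
  obtain v where v: "emeasure lborel (\<Omega> \<times> ?W) \<le> ennreal v" "0 < v"
  proof -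
    have "emeasure lborel (\<Omega> \<times> ?W) < \<infinity>" using OW emeasure_bounded_finite compact_imp_bounded by blast
    then obtain v where "emeasure lborel (\<Omega> \<times> ?W) = ennreal v" "v \<ge> 0" by (metis ennreal_cases less_irrefl infinity_ennreal_def)
    then show ?thesis by (intro that[of "v + 1"]) auto
  qed
  define c where "c = (6::real) ^ ?d"
  define L where "L = 4 * (4 * c / (s - real ?d + 1) / (1 - 2 powr (t - (s - real ?d + 2))))"
  have Lpos: "L > 0" unfolding L_def c_def using s t by (simp add: powr_less_one)
  define \<kappa> where "\<kappa> = min ((1/2) powr t) (m / 4 / (L * 4 powr t * v))"
  have kp: "\<kappa> > 0" "\<kappa> \<le> (1/2) powr t" using m Lpos v by (auto simp: \<kappa>_def)
  have kl: "L * 4 powr t * \<kappa> * v \<le> m / 4"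
  proof -
    have "\<kappa> * (L * 4 powr t * v) \<le> m / 4 / (L * 4 powr t * v) * (L * 4 powr t * v)"
      unfolding \<kappa>_def using Lpos v by (intro mult_right_mono) auto
    then show ?thesis using Lpos v by (simp add: ac_simps)
  qed
  define GN where "GN N = costly_planes t \<kappa> e (CN N)" for N
  have GN: "ennreal (m / (4 * L)) \<le> emeasure lborel (GN N)" for N
  proof -
    obtain f :: "real ^ 'd \<Rightarrow> ennreal" where f: "f \<in> borel_measurable borel"
      "\<And>x. f x \<noteq> 0 \<Longrightarrow> \<exists>y\<in>C. dyadic_index N x = dyadic_index N y"
      "\<And>x r. 0 < r \<Longrightarrow> r \<le> 1 \<Longrightarrow>
      (\<integral>\<^sup>+y. f y * indicator (cube_box x r) y \<partial>lborel) \<le> ennreal (6 ^ CARD('d) * r powr s)"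
      "dyadic_content s C \<le> (\<integral>\<^sup>+y. f y \<partial>lborel)" "(\<integral>\<^sup>+y. f y \<partial>lborel) < \<infinity>"
      using discrete_frostman[OF compact_imp_bounded[OF C] s(1,3), of N] by blast
    have fC: "x \<in> CN N" if fx: "f x \<noteq> 0" for x
    proof -
      obtain y where y: "y \<in> C" "dyadic_index N x = dyadic_index N y" using f(2)[OF fx] by blast
      have "infdist x C \<le> dist x y" by (rule infdist_le[OF y(1)])
      also have "\<dots> \<le> \<delta> N" unfolding dist_norm \<delta>_def by (rule dyadic_index_eq_imp_norm[OF y(2)])
      finally show ?thesis by (simp add: CN_def)
    qed
    show ?thesis unfolding GN_def
    proof (rule emeasure_costly_planes_ge[OF compact_imp_closed[OF CNc] f(1) fC f(3)[folded c_def] _ s(2) t _ f(5) m _ _ v(1,2) L_def kp kl])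
      show "ennreal m \<le> (\<integral>\<^sup>+y. f y \<partial>lborel)" using mC f(4) by (rule order_trans)
      show "0 < c" by (simp add: c_def)
      show "\<Omega> \<in> sets borel" by (simp add: \<Omega>_def)
    qed (use Om in blast)+
  qed
  have Sc: "compact (plane_slice e (CN N) y)" for y N
  proof -
    have "(plane_slice e (CN N) y) = unit_square \<inter> (\<lambda>p. plane_point e (fst y) (snd y) p) -` CN N" by auto
    moreover have "closed ((\<lambda>p. plane_point e (fst y) (snd y) p) -` CN N)"
      using compact_imp_closed[OF CNc] by (intro closed_vimage) (auto simp: plane_point_def intro!: continuous_intros)
    ultimately show ?thesis by (simp add: compact_Int_closed)
  qed
  have GNclosed: "closed (GN N)" for N
    unfolding GN_def by (rule closed_costly_planes[OF compact_imp_closed[OF CNc]])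
  have CNmono: "CN N \<subseteq> CN M" if "M \<le> N" for M N using dle[OF that] by (auto simp: CN_def)
  have GNsub: "GN N \<subseteq> \<Omega> \<times> ?W" for N
  proof
    fix y assume y: "y \<in> GN N"
    then have W: "snd y \<in> ?W" by (simp add: GN_def)
    have "(plane_slice e (CN N) y) \<noteq> {}"
    proof
      assume E: "(plane_slice e (CN N) y) = {}"
      show False using y E kp(1) by (simp add: GN_def small_cover_empty)
    qed
    then show "y \<in> \<Omega> \<times> ?W" using Om[OF W] W by (auto simp: mem_Times_iff)
  qed
  have "GN (Suc N) \<subseteq> GN N" for N
  proof
    fix y assume y: "y \<in> GN (Suc N)"
    have "plane_slice e (CN (Suc N)) y \<subseteq> plane_slice e (CN N) y"
      using CNmono[of N "Suc N"] by auto
    then show "y \<in> GN N" using y small_cover_subset unfolding GN_def by blast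
  qed
  from emeasure_INT_closed_ge[where E=GN, OF GNclosed this GNsub OW GN]
  have "ennreal (m / (4 * L)) \<le> emeasure lborel (\<Inter>N. GN N)" .
  also have "\<dots> \<le> emeasure lborel (costly_planes t \<kappa> e C)"
  proof (rule emeasure_mono)
    show "(\<Inter>N. GN N) \<subseteq> costly_planes t \<kappa> e C"
    proof
      fix y assume y: "y \<in> (\<Inter>N. GN N)"
      have "\<not> small_cover t \<kappa> (\<Inter>N. (plane_slice e (CN N) y))"
        by (rule not_small_cover_INT[OF Sc]) (use CNmono y in \<open>auto simp: GN_def\<close>)
      moreover have "(\<Inter>N. (plane_slice e (CN N) y)) \<subseteq> (plane_slice e C y)"
      proof
        fix p assume p: "p \<in> (\<Inter>N. (plane_slice e (CN N) y))"
        let ?x = "plane_point e (fst y) (snd y) p"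
        have le: "infdist ?x C \<le> \<delta> N" for N using p by (auto simp: CN_def)
        have "\<delta> \<longlonglongrightarrow> real ?d * 0" unfolding \<delta>_def by (intro tendsto_mult tendsto_const LIMSEQ_power_zero) auto
        then have "infdist ?x C \<le> 0" using le by (intro LIMSEQ_le_const[of \<delta>]) auto
        then have "infdist ?x C = 0" using infdist_nonneg[of ?x C] by linarith
        then have "?x \<in> C" using C0 compact_imp_closed[OF C] by (simp add: in_closed_iff_infdist_zero)
        then show "p \<in> (plane_slice e C y)" using p by auto
      qed
      ultimately have "\<not> small_cover t \<kappa> (plane_slice e C y)"
        using small_cover_subset by blast
      then show "y \<in> costly_planes t \<kappa> e C"
        using y by (auto simp: GN_def)
    qed
    show "costly_planes t \<kappa> e C \<in> sets lborel"
      unfolding sets_lborel by (rule borel_closed[OF closed_costly_planes[OF compact_imp_closed[OF C]]])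
  qed
  finally have le: "ennreal (m / (4 * L)) \<le> emeasure lborel (costly_planes t \<kappa> e C)" .
  have "ennreal (m / (4 * L)) > 0" using m Lpos by simp
  from less_le_trans[OF this le] show ?thesis using kp(1) by blast
qed

section \<open>Compact sections of a G-delta set\<close>

lemma open_increasing_union_closed:
  fixes G :: "'a::metric_space set"
  assumes "open G"
  obtains F where "\<And>j::nat. closed (F j)" "incseq F" "(\<Union>j. F j) = G"
proof -
  have "fsigma_in euclidean G"
    using assms by (intro open_imp_fsigma_in metrizable_space_euclidean) simp
  then obtain F where "\<And>j. closedin euclidean (F j)" "\<And>j. F j \<subseteq> F (Suc j)" "\<Union>(range F) = G"
    unfolding fsigma_in_ascending by blast
  then show ?thesis by (intro that[of F]) (auto intro: incseq_SucI)
qed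

lemma compact_section:
  fixes Z :: "('a::metric_space \<times> 'b::metric_space) set"
  assumes "compact Z"
  shows "compact {x. (e, x) \<in> Z}"
proof -
  have "{x. (e, x) \<in> Z} = snd ` (Z \<inter> ({e} \<times> UNIV))" by force
  moreover have "compact (Z \<inter> ({e} \<times> UNIV))" using assms by (intro compact_Int_closed closed_Times) auto
  ultimately show ?thesis by (simp add: compact_continuous_image continuous_on_snd)
qed

text \<open>Choquet's argument. Write each \<open>G n\<close> as an increasing union of closed sets. Because outer measure
  and dyadic content are continuous along increasing sequences, one closed piece of each \<open>G n\<close> can be
  selected so that the outer measure of the directions with large section always stays above \<open>m\<close>. The
  intersection of the selected pieces is compact, and semicontinuity of the ball content on compact
  sets carries the bound over to it.\<close>

lemma compact_section_not_small_cover: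
  fixes K0 :: "((real ^ 'd) \<times> (real ^ 'd)) set"
  assumes K0: "compact K0" and G: "\<And>n::nat. open (G n)" and s: "0 < s" and k: "0 < k"
    and pos: "outer_measure_of lborel {e. ennreal k < dyadic_content s {x. (e, x) \<in> K0 \<inter> (\<Inter>n. G n)}} > 0"
  shows "\<exists>Z. compact Z \<and> Z \<subseteq> K0 \<inter> (\<Inter>n. G n) \<and>
    (\<exists>k'>0. emeasure lborel {e. \<not> small_cover s k' {x. (e, x) \<in> Z}} > 0)"
proof -
  define Z where "Z = K0 \<inter> (\<Inter>n. G n)"
  define \<Phi> where "\<Phi> P = outer_measure_of (lborel :: (real ^ 'd) measure) {e. ennreal k < dyadic_content s {x. (e, x) \<in> P}}"
    for P :: "((real ^ 'd) \<times> (real ^ 'd)) set"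
  obtain m where m: "0 < m" "m < \<Phi> Z" using pos dense unfolding \<Phi>_def Z_def by blast
  have cont: "\<exists>j. m < \<Phi> (P j)" if P: "incseq P" "m < \<Phi> (\<Union>j. P j)" for P
  proof -
    let ?A = "\<lambda>j. {e. ennreal k < dyadic_content s {x. (e, x) \<in> P j}}"
    have "incseq ?A"
    proof (rule incseq_SucI, rule subsetI)
      fix j e assume e: "e \<in> ?A j"
      have "{x. (e, x) \<in> P j} \<subseteq> {x. (e, x) \<in> P (Suc j)}" using P(1) by (auto simp: incseq_Suc_iff)
      from tree_content_subset[OF this, of dyadic_index "dyadic_weight s"] show "e \<in> ?A (Suc j)"
        using e by (auto intro: less_le_trans)
    qed
    then have "(SUP j. \<Phi> (P j)) = outer_measure_of lborel (\<Union>j. ?A j)"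
      unfolding \<Phi>_def by (intro SUP_outer_measure_of_incseq) auto
    also have "\<dots> \<ge> \<Phi> (\<Union>j. P j)"
      unfolding \<Phi>_def
    proof (rule outer_measure_of_mono, rule subsetI)
      fix e assume e: "e \<in> {e. ennreal k < dyadic_content s {x. (e, x) \<in> (\<Union>j. P j)}}"
      show "e \<in> (\<Union>j. ?A j)"
      proof (rule ccontr)
        assume "e \<notin> (\<Union>j. ?A j)"
        then have le: "dyadic_content s {x. (e, x) \<in> P j} \<le> ennreal k" for j by (auto simp: not_less)
        have "incseq (\<lambda>j. {x. (e, x) \<in> P j})" using P(1) by (auto simp: incseq_def)
        from tree_content_Union_incseq[OF dyadic_index_refine this le]
        have "dyadic_content s (\<Union>j. {x. (e, x) \<in> P j}) \<le> ennreal k" .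
        moreover have "(\<Union>j. {x. (e, x) \<in> P j}) = {x. (e, x) \<in> (\<Union>j. P j)}" by auto
        ultimately show False using e by simp
      qed
    qed
    finally have "m < (SUP j. \<Phi> (P j))" using P(2) by simp
    then show ?thesis by (simp add: less_SUP_iff)
  qed
  have "\<exists>Q. \<forall>n. (closed (Q n) \<and> m < \<Phi> (Z \<inter> Q n)) \<and> (Q (Suc n) \<subseteq> Q n \<and> Q (Suc n) \<subseteq> G n)"
  proof (rule dependent_nat_choice)
    show "\<exists>Q. closed Q \<and> m < \<Phi> (Z \<inter> Q)" using m by (intro exI[of _ UNIV]) auto
  next
    fix Q n assume Q: "closed Q \<and> m < \<Phi> (Z \<inter> Q)"
    obtain F where F: "\<And>j::nat. closed (F j)" "incseq F" "(\<Union>j. F j) = G n"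
      using open_increasing_union_closed[OF G] by blast
    have "(\<Union>j. Z \<inter> Q \<inter> F j) = Z \<inter> Q" using F(3) by (auto simp: Z_def)
    moreover have "incseq (\<lambda>j. Z \<inter> Q \<inter> F j)" using F(2) by (fastforce simp: incseq_def)
    ultimately obtain j where "m < \<Phi> (Z \<inter> Q \<inter> F j)" using cont[of "\<lambda>j. Z \<inter> Q \<inter> F j"] Q by auto
    then show "\<exists>Q'. (closed Q' \<and> m < \<Phi> (Z \<inter> Q')) \<and> (Q' \<subseteq> Q \<and> Q' \<subseteq> G n)"
      using Q F by (intro exI[of _ "Q \<inter> F j"]) (auto simp: Int_assoc)
  qed
  then obtain Q where Q: "\<And>n. closed (Q n)" "\<And>n. m < \<Phi> (Z \<inter> Q n)" "\<And>n. Q (Suc n) \<subseteq> Q n" "\<And>n. Q (Suc n) \<subseteq> G n"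
    by blast
  have Qdec: "Q n \<subseteq> Q l" if "l \<le> n" for l n using that Q(3) by (rule lift_Suc_antimono_le[rotated])
  define Z' where "Z' = K0 \<inter> (\<Inter>n. Q n)"
  have Z'c: "compact Z'" unfolding Z'_def using K0 Q(1) by (intro compact_Int_closed closed_INT) auto
  have Z'sub: "Z' \<subseteq> Z" unfolding Z'_def Z_def using Q(4) by blast
  define c where "c = 3 ^ CARD('d) * 2 powr s"
  have cpos: "c > 0" by (simp add: c_def)
  define k' where "k' = min 1 (k / c)"
  have k': "k' > 0" "k' \<le> 1" using k cpos by (auto simp: k'_def)
  have ck: "c * k' \<le> k"
  proof -
    have "c * k' \<le> c * (k / c)" using cpos unfolding k'_def by (intro mult_left_mono) auto
    then show ?thesis using cpos by simp
  qed
  define E where "E n = {e. \<not> small_cover s k' {x. (e, x) \<in> K0 \<inter> Q n}}" for n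
  have closedE: "closed {e. \<not> small_cover s k' {x. (e, x) \<in> K0 \<inter> R}}" if "closed R" for R :: "((real ^ 'd) \<times> (real ^ 'd)) set"
  proof (rule closed_not_small_cover)
    show "closed (K0 \<inter> R)" using K0 that by (simp add: closed_Int compact_imp_closed)
    show "compact (snd ` K0)" using K0 by (intro compact_continuous_image continuous_intros)
    show "x \<in> snd ` K0" if "(e, x) \<in> K0 \<inter> R" for e x using that by force
  qed
  have Em: "m \<le> emeasure lborel (E n)" for n
  proof -
    have "{e. ennreal k < dyadic_content s {x. (e, x) \<in> Z \<inter> Q n}} \<subseteq> E n"
    proof (rule subsetI, rule ccontr)
      fix e assume e: "e \<in> {e. ennreal k < dyadic_content s {x. (e, x) \<in> Z \<inter> Q n}}" and "e \<notin> E n"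
      then have "small_cover s k' {x. (e, x) \<in> K0 \<inter> Q n}" by (simp add: E_def)
      from dyadic_content_le_of_small_cover[OF s this k'(2)]
      have 1: "dyadic_content s {x. (e, x) \<in> K0 \<inter> Q n} \<le> ennreal (c * k')" by (simp add: c_def)
      have "dyadic_content s {x. (e, x) \<in> Z \<inter> Q n} \<le> dyadic_content s {x. (e, x) \<in> K0 \<inter> Q n}"
        by (rule tree_content_subset) (auto simp: Z_def)
      also note 1
      also have "ennreal (c * k') \<le> ennreal k" using ck by (rule ennreal_leI)
      finally show False using e by simp
    qed
    then have "\<Phi> (Z \<inter> Q n) \<le> outer_measure_of lborel (E n)" unfolding \<Phi>_def by (rule outer_measure_of_mono)
    also have "\<dots> = emeasure lborel (E n)" using closedE[OF Q(1)] by (intro outer_measure_of_eq) (simp add: E_def)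
    finally show ?thesis using Q(2)[of n] by simp
  qed
  have Esub: "E n \<subseteq> fst ` K0" for n
  proof
    fix e assume "e \<in> E n"
    then have "{x. (e, x) \<in> K0 \<inter> Q n} \<noteq> {}"
      unfolding E_def mem_Collect_eq by (metis small_cover_empty k'(1))
    then show "e \<in> fst ` K0" by force
  qed
  have cf: "compact (fst ` K0)" using K0 by (intro compact_continuous_image continuous_intros)
  have "E (Suc n) \<subseteq> E n" for n
    unfolding E_def using Q(3)[of n] by (auto elim!: contrapos_nn small_cover_subset)
  from emeasure_INT_closed_ge[where E=E, OF closedE[OF Q(1), folded E_def] this Esub cf Em]
  have "m \<le> emeasure lborel (\<Inter>n. E n)" .
  also have "\<dots> \<le> emeasure lborel {e. \<not> small_cover s k' {x. (e, x) \<in> Z'}}"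
  proof (rule emeasure_mono)
    show "{e. \<not> small_cover s k' {x. (e, x) \<in> Z'}} \<in> sets lborel"
      unfolding Z'_def using closedE[of "\<Inter>n. Q n"] Q(1) by (simp add: closed_INT)
    show "(\<Inter>n. E n) \<subseteq> {e. \<not> small_cover s k' {x. (e, x) \<in> Z'}}"
    proof
      fix e assume e: "e \<in> (\<Inter>n. E n)"
      have "\<not> small_cover s k' (\<Inter>n. {x. (e, x) \<in> K0 \<inter> Q n})"
      proof (rule not_small_cover_INT)
        fix n
        show "compact {x. (e, x) \<in> K0 \<inter> Q n}"
          by (rule compact_section) (use K0 Q(1) in \<open>rule compact_Int_closed\<close>)
        show "\<not> small_cover s k' {x. (e, x) \<in> K0 \<inter> Q n}" using e by (auto simp: E_def)
      next
        fix l n :: nat assume "l \<le> n"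
        then show "{x. (e, x) \<in> K0 \<inter> Q n} \<subseteq> {x. (e, x) \<in> K0 \<inter> Q l}" using Qdec by blast
      qed
      moreover have "(\<Inter>n. {x. (e, x) \<in> K0 \<inter> Q n}) = {x. (e, x) \<in> Z'}" by (auto simp: Z'_def)
      ultimately show "e \<in> {e. \<not> small_cover s k' {x. (e, x) \<in> Z'}}" by simp
    qed
  qed
  finally have "0 < emeasure lborel {e. \<not> small_cover s k' {x. (e, x) \<in> Z'}}" using m(1) by simp
  then show ?thesis using Z'c Z'sub k'(1) unfolding Z_def by blast
qed

section \<open>Null sets of directions\<close>

text \<open>The cubes are the maximal ones contained in \<open>U\<close> among the dyadic cubes of side at most \<open>1\<close>.\<close>

lemma dyadic_cover_of_open:
  fixes U :: "(real ^ 'd) set"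
  assumes U: "open U"
  obtains F :: "(nat \<times> ('d \<Rightarrow> int)) set" where
    "\<And>x. x \<in> U \<Longrightarrow> \<exists>n. (n, dyadic_index n x) \<in> F" "\<And>z. z \<in> F \<Longrightarrow> \<exists>x. dyadic_index (fst z) x = snd z"
    "emeasure (weight_measure (dyadic_weight (real CARD('d)))) F \<le> emeasure lborel U"
proof -
  let ?d = "CARD('d)"
  have ex: "\<exists>n. dyadic_cube n x \<subseteq> U" if x: "x \<in> U" for x
  proof -
    obtain r where r: "r > 0" "ball x r \<subseteq> U" using U x open_contains_ball by blast
    have "(\<lambda>n. real ?d * (1/2) ^ n) \<longlonglongrightarrow> real ?d * 0" by (intro tendsto_mult tendsto_const LIMSEQ_power_zero) auto
    then have "eventually (\<lambda>n. real ?d * (1/2) ^ n < r) sequentially"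
      by (rule order_tendstoD) (use r in simp)
    then obtain n where n: "real ?d * (1/2) ^ n < r" by (auto simp: eventually_sequentially)
    have "dyadic_cube n x \<subseteq> ball x r"
    proof
      fix y assume "y \<in> dyadic_cube n x"
      then have "norm (x - y) \<le> real ?d * (1/2) ^ n" by (intro dyadic_index_eq_imp_norm) (simp add: dyadic_cube_def)
      then show "y \<in> ball x r" using n by (simp add: dist_norm)
    qed
    then show ?thesis using r by blast
  qed
  obtain F where F: "\<And>x. x \<in> U \<Longrightarrow> \<exists>n. (n, dyadic_index n x) \<in> F"
    "\<And>z. z \<in> F \<Longrightarrow> \<exists>x\<in>U. dyadic_index (fst z) x = snd z"
    "\<And>z. z \<in> F \<Longrightarrow> {y. dyadic_index (fst z) y = snd z} \<subseteq> U"
    "\<And>z z' y. z \<in> F \<Longrightarrow> z' \<in> F \<Longrightarrow> dyadic_index (fst z) y = snd z \<Longrightarrow>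
      dyadic_index (fst z') y = snd z' \<Longrightarrow> z = z'" "finite U \<Longrightarrow> finite F"
  proof (rule minimal_dyadic_cubes[of U "\<lambda>n v. {y. dyadic_index n y = v} \<subseteq> U"])
    show "\<exists>n. {y. dyadic_index n y = dyadic_index n x} \<subseteq> U" if x: "x \<in> U" for x
      using ex[OF x] by (simp add: dyadic_cube_def)
  qed (rule that)
  have ne: "\<exists>x. dyadic_index (fst z) x = snd z" if z: "z \<in> F" for z using F(2)[OF z] by blast
  have "emeasure (weight_measure (dyadic_weight (real ?d))) F = emeasure lborel (\<Union>z\<in>F. {y. dyadic_index (fst z) y = snd z})"
    using ne F(4) by (rule weight_disjoint_dyadic_cubes)
  also have "\<dots> \<le> emeasure lborel U"
    by (rule emeasure_mono) (use F(3) U in auto)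
  finally show ?thesis using that F(1) ne by blast
qed

text \<open>Cover the cone over \<open>E\<close> by cubes with small total volume. A cube of side \<open>l\<close> meets the sphere of
  radius \<open>\<rho>\<close> only for \<open>\<rho>\<close> in an interval of length comparable to \<open>l\<close>. Averaging over \<open>\<rho>\<close> therefore
  gives a radius for which the cubes meeting the sphere have small total weight in dimension \<open>d - 1\<close>;
  these cover the copy of \<open>E\<close> on that sphere.\<close>

lemma hausdorff_null_of_null_cone:
  fixes E :: "(real ^ 'd) set"
  assumes d: "CARD('d) \<ge> 2" and E: "E \<subseteq> sphere 0 1"
    and null: "outer_measure_of lborel {x. 1 \<le> norm x \<and> norm x \<le> 2 \<and> (1 / norm x) *\<^sub>R x \<in> E} = 0"
  shows "hausdorff_measure (real CARD('d) - 1) E = 0"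
proof (rule hausdorff_null_if_small_cover)
  let ?d = "CARD('d)"
  let ?t = "real ?d - 1"
  show tpos: "?t > 0" using d by simp
  fix k :: real assume k: "k > 0"
  define D where "D = (2 * real ?d) powr ?t"
  have Dp: "D > 0" using d by (simp add: D_def)
  define \<epsilon> where "\<epsilon> = k / (3 * real ?d * D)"
  have e: "\<epsilon> > 0" using k Dp d by (simp add: \<epsilon>_def)
  define N where "N = {x. 1 \<le> norm x \<and> norm x \<le> 2 \<and> (1 / norm x) *\<^sub>R x \<in> E}"
  obtain B where B: "B \<in> sets lborel" "N \<subseteq> B" "emeasure lborel B = 0"
    using outer_measure_of_attain[of N lborel] null by (auto simp: N_def)
  obtain U where U: "open U" "B \<subseteq> U" "emeasure lborel (U - B) < ennreal \<epsilon>"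
    using outer_regular_lborel[of B \<epsilon>] B(1) e by auto
  have "emeasure lborel U \<le> emeasure lborel B + emeasure lborel (U - B)"
  proof -
    have "emeasure lborel U \<le> emeasure lborel (B \<union> (U - B))"
      using U(1) B(1) by (intro emeasure_mono) auto
    also have "\<dots> \<le> emeasure lborel B + emeasure lborel (U - B)"
      using U(1) B(1) by (intro emeasure_subadditive) auto
    finally show ?thesis .
  qed
  then have Ue: "emeasure lborel U \<le> ennreal \<epsilon>" using U(3) B(3) by simp
  obtain F :: "(nat \<times> ('d \<Rightarrow> int)) set" where
    F: "\<And>x. x \<in> U \<Longrightarrow> \<exists>n. (n, dyadic_index n x) \<in> F" "\<And>z. z \<in> F \<Longrightarrow> \<exists>x. dyadic_index (fst z) x = snd z"
    "emeasure (weight_measure (dyadic_weight (real ?d))) F \<le> emeasure lborel U"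
    using dyadic_cover_of_open[OF U(1)] by blast
  define pnt where "pnt z = (SOME x :: real ^ 'd. dyadic_index (fst z) x = snd z)" for z :: "nat \<times> ('d \<Rightarrow> int)"
  have pnt: "dyadic_index (fst z) (pnt z) = snd z" if "z \<in> F" for z
    unfolding pnt_def using F(2)[OF that] by (rule someI_ex)
  define \<delta> where "\<delta> z = real ?d * (1/2) ^ fst z" for z :: "nat \<times> ('d \<Rightarrow> int)"
  define I where "I z = {norm (pnt z) - \<delta> z .. norm (pnt z) + \<delta> z}" for z
  define F\<rho> where "F\<rho> \<rho> = {z \<in> F. \<rho> \<in> I z}" for \<rho>
  define g where "g \<rho> = emeasure (weight_measure (dyadic_weight ?t)) (F\<rho> \<rho>)" for \<rho>
  have g: "g \<rho> = (\<integral>\<^sup>+z. dyadic_weight ?t (fst z) * indicator (I z) \<rho> \<partial>count_space F)" for \<rho>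
    unfolding g_def emeasure_weight_measure
    by (subst nn_integral_count_space_indicator[of F]) (auto intro!: nn_integral_cong simp: F\<rho>_def indicator_def)
  have gint: "(\<integral>\<^sup>+\<rho>. g \<rho> \<partial>lborel) \<le> ennreal (2 * real ?d * \<epsilon>)"
  proof -
    have "(\<integral>\<^sup>+\<rho>. g \<rho> \<partial>lborel) = (\<integral>\<^sup>+z. \<integral>\<^sup>+\<rho>. dyadic_weight ?t (fst z) * indicator (I z) \<rho> \<partial>lborel \<partial>count_space F)"
      unfolding g by (rule nn_integral_count_space_nn_integral) (auto simp: I_def)
    also have "\<dots> = (\<integral>\<^sup>+z. ennreal (2 * real ?d) * dyadic_weight (real ?d) (fst z) \<partial>count_space F)"
    proof (rule nn_integral_cong)
      fix z
      have dz: "\<delta> z \<ge> 0" by (simp add: \<delta>_def)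
      have "(\<integral>\<^sup>+\<rho>. dyadic_weight ?t (fst z) * indicator (I z) \<rho> \<partial>lborel) = dyadic_weight ?t (fst z) * emeasure lborel (I z)"
        by (rule nn_integral_cmult_indicator) (simp add: I_def)
      also have "emeasure lborel (I z) = ennreal (2 * \<delta> z)" using dz by (simp add: I_def)
      also have "dyadic_weight ?t (fst z) * ennreal (2 * \<delta> z) = ennreal (((1/2) ^ fst z) powr ?t * (2 * \<delta> z))"
        unfolding dyadic_weight_eq using dz by (simp add: ennreal_mult)
      also have "((1/2) ^ fst z) powr ?t * (2 * \<delta> z) = 2 * real ?d * ((1/2) ^ fst z) powr (real ?d)"
      proof -
        have "((1/2::real) ^ fst z) powr (real ?d) = ((1/2) ^ fst z) powr (?t + 1)" by simp
        also have "\<dots> = ((1/2) ^ fst z) powr ?t * (1/2) ^ fst z" unfolding powr_add by simp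
        finally show ?thesis by (simp add: \<delta>_def)
      qed
      also have "ennreal \<dots> = ennreal (2 * real ?d) * dyadic_weight (real ?d) (fst z)"
        unfolding dyadic_weight_eq by (rule ennreal_mult) auto
      finally show "(\<integral>\<^sup>+\<rho>. dyadic_weight ?t (fst z) * indicator (I z) \<rho> \<partial>lborel) = ennreal (2 * real ?d) * dyadic_weight (real ?d) (fst z)" .
    qed
    also have "\<dots> = ennreal (2 * real ?d) * emeasure (weight_measure (dyadic_weight (real ?d))) F"
      unfolding emeasure_weight_measure by (simp add: nn_integral_cmult nn_integral_count_space_indicator)
    also have "\<dots> \<le> ennreal (2 * real ?d) * ennreal \<epsilon>"
      using F(3) Ue by (intro mult_left_mono) (auto intro: order_trans)
    also have "\<dots> = ennreal (2 * real ?d * \<epsilon>)" using e by (intro ennreal_mult[symmetric]) auto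
    finally show ?thesis .
  qed
  have "\<exists>\<rho>\<in>{1..2}. g \<rho> < ennreal (3 * real ?d * \<epsilon>)"
  proof (rule ccontr)
    assume "\<not> ?thesis"
    then have ge: "ennreal (3 * real ?d * \<epsilon>) \<le> g \<rho>" if "\<rho> \<in> {1..2}" for \<rho> using that by (auto simp: not_less)
    have "ennreal (3 * real ?d * \<epsilon>) = (\<integral>\<^sup>+\<rho>. ennreal (3 * real ?d * \<epsilon>) * indicator {1..2::real} \<rho> \<partial>lborel)"
      by (subst nn_integral_cmult_indicator) auto
    also have "\<dots> \<le> (\<integral>\<^sup>+\<rho>. g \<rho> \<partial>lborel)"
      using ge by (intro nn_integral_mono) (auto simp: indicator_def)
    also note gint
    finally have "ennreal (3 * real ?d * \<epsilon>) \<le> ennreal (2 * real ?d * \<epsilon>)" .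
    moreover have "2 * real ?d * \<epsilon> < 3 * real ?d * \<epsilon>" using e d by simp
    then have "ennreal (2 * real ?d * \<epsilon>) < ennreal (3 * real ?d * \<epsilon>)" using e by (intro ennreal_lessI) auto
    ultimately show False by simp
  qed
  then obtain \<rho> where \<rho>: "1 \<le> \<rho>" "\<rho> \<le> 2" "g \<rho> < ennreal (3 * real ?d * \<epsilon>)" by auto
  have "dyadic_content ?t ((\<lambda>x. \<rho> *\<^sub>R x) ` E) \<le> g \<rho>"
    unfolding g_def
  proof (rule tree_content_le)
    fix y assume "y \<in> (\<lambda>x. \<rho> *\<^sub>R x) ` E"
    then obtain x where x: "x \<in> E" "y = \<rho> *\<^sub>R x" by blast
    have nx: "norm x = 1" using E x(1) by auto
    have ny: "norm y = \<rho>" using x nx \<rho> by simp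
    have "y \<in> N" using x ny \<rho> by (simp add: N_def)
    then have "y \<in> U" using B(2) U(2) by blast
    then obtain n where n: "(n, dyadic_index n y) \<in> F" using F(1) by blast
    have "dyadic_index n (pnt (n, dyadic_index n y)) = dyadic_index n y" using pnt[OF n] by simp
    then have "norm (pnt (n, dyadic_index n y) - y) \<le> \<delta> (n, dyadic_index n y)" unfolding \<delta>_def fst_conv by (rule dyadic_index_eq_imp_norm)
    then have "\<bar>norm (pnt (n, dyadic_index n y)) - norm y\<bar> \<le> \<delta> (n, dyadic_index n y)"
      using norm_triangle_ineq3 order_trans by blast
    then have "\<rho> \<in> I (n, dyadic_index n y)" using ny by (auto simp: I_def abs_le_iff)
    then show "\<exists>n. (n, dyadic_index n y) \<in> F\<rho> \<rho>" using n by (auto simp: F\<rho>_def)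
  qed
  also note \<rho>(3)
  finally have "small_cover ?t (D * (3 * real ?d * \<epsilon>)) ((\<lambda>x. \<rho> *\<^sub>R x) ` E)"
    unfolding D_def by (rule small_cover_of_dyadic_content[OF tpos])
  then have sc: "small_cover ?t k ((\<lambda>x. \<rho> *\<^sub>R x) ` E)" using Dp d by (simp add: \<epsilon>_def)
  have "small_cover ?t (1 powr ?t * k) ((\<lambda>y. (1 / \<rho>) *\<^sub>R y) ` ((\<lambda>x. \<rho> *\<^sub>R x) ` E))"
  proof (rule small_cover_lipschitz_image[OF sc])
    fix x y :: "real ^ 'd"
    have "dist ((1 / \<rho>) *\<^sub>R x) ((1 / \<rho>) *\<^sub>R y) = (1 / \<rho>) * dist x y"
      using \<rho> by (simp add: dist_norm scaleR_diff_right[symmetric])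
    also have "\<dots> \<le> 1 * dist x y" using \<rho> by (intro mult_right_mono) auto
    finally show "dist ((1 / \<rho>) *\<^sub>R x) ((1 / \<rho>) *\<^sub>R y) \<le> 1 * dist x y" .
  qed simp
  moreover have "(\<lambda>y. (1 / \<rho>) *\<^sub>R y) ` ((\<lambda>x. \<rho> *\<^sub>R x) ` E) = E" using \<rho> by (simp add: image_image)
  ultimately show "small_cover ?t k E" by simp
qed

definition slope_direction :: "real \<Rightarrow> real ^ 2" where
  "slope_direction \<tau> = (1 / sqrt (1 + \<tau>\<^sup>2)) *\<^sub>R vector [\<tau>, 1]"

lemma slope_direction_components: "slope_direction \<tau> $ 1 = \<tau> / sqrt (1 + \<tau>\<^sup>2)" "slope_direction \<tau> $ 2 = 1 / sqrt (1 + \<tau>\<^sup>2)"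
  by (simp_all add: slope_direction_def)

lemma norm_slope_direction: "norm (slope_direction \<tau>) = 1"
proof -
  have "norm (vector [\<tau>, 1] :: real ^ 2) = sqrt (1 + \<tau>\<^sup>2)"
    by (simp add: norm_vec_def L2_set_def UNIV_2 add.commute)
  moreover have "1 + \<tau>\<^sup>2 > 0" by (smt (verit) zero_le_power2)
  ultimately show ?thesis by (simp add: slope_direction_def)
qed

lemma slope_direction_dist:
  assumes "\<tau> \<in> {0..1}" "\<sigma> \<in> {0..1}"
  shows "\<bar>\<tau> - \<sigma>\<bar> \<le> 4 * dist (slope_direction \<tau>) (slope_direction \<sigma>)"
proof -
  define a b where "a = sqrt (1 + \<tau>\<^sup>2)" and "b = sqrt (1 + \<sigma>\<^sup>2)"
  have ab: "1 \<le> a" "a \<le> 2" "1 \<le> b" "b \<le> 2"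
  proof -
    have "\<tau>\<^sup>2 \<le> 1" "\<sigma>\<^sup>2 \<le> 1" using assms by (auto simp: power_le_one)
    then show "1 \<le> a" "a \<le> 2" "1 \<le> b" "b \<le> 2" unfolding a_def b_def by (auto intro!: real_le_lsqrt)
  qed
  let ?D = "dist (slope_direction \<tau>) (slope_direction \<sigma>)"
  have 1: "\<bar>\<tau> / a - \<sigma> / b\<bar> \<le> ?D" "\<bar>1 / a - 1 / b\<bar> \<le> ?D"
    using component_le_norm_cart[of "slope_direction \<tau> - slope_direction \<sigma>" 1] component_le_norm_cart[of "slope_direction \<tau> - slope_direction \<sigma>" 2]
    by (simp_all add: dist_norm slope_direction_components a_def b_def)
  have "\<tau> - \<sigma> = a * (\<tau> / a - \<sigma> / b) - a * \<sigma> * (1 / a - 1 / b)"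
    using ab by (simp add: field_simps)
  then have "\<bar>\<tau> - \<sigma>\<bar> \<le> \<bar>a * (\<tau> / a - \<sigma> / b)\<bar> + \<bar>a * \<sigma> * (1 / a - 1 / b)\<bar>"
    by (simp only: abs_triangle_ineq4)
  also have "\<dots> = a * \<bar>\<tau> / a - \<sigma> / b\<bar> + (a * \<sigma>) * \<bar>1 / a - 1 / b\<bar>"
    using ab assms by (simp add: abs_mult)
  also have "\<dots> \<le> 2 * ?D + (2 * 1) * ?D"
    using ab assms 1 by (intro add_mono mult_mono) auto
  finally show ?thesis by simp
qed

text \<open>The slope is a Lipschitz function of the direction.\<close>

lemma null_of_hausdorff_null_directions:
  assumes N: "hausdorff_measure 1 N = 0" and D: "D \<in> sets borel" "D \<subseteq> {0..1}"
    and DN: "\<And>\<tau>. \<tau> \<in> D \<Longrightarrow> slope_direction \<tau> \<in> N"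
  shows "emeasure lborel D = 0"
proof -
  have "emeasure lborel D \<le> ennreal \<epsilon>" if e: "\<epsilon> > 0" for \<epsilon>
  proof -
    have "small_cover 1 (\<epsilon> / 16) N" using small_cover_if_hausdorff_null[OF _ N, of "\<epsilon> / 16"] e by simp
    then obtain c r where r: "\<And>i::nat. 0 \<le> r i" and cov: "N \<subseteq> (\<Union>i. ball (c i) (r i))"
      and sum: "(\<Sum>i. ennreal (r i powr 1)) < ennreal (\<epsilon> / 16)"
      unfolding small_cover_def by blast
    define T where "T i = (SOME \<tau>. \<tau> \<in> {0..1} \<and> slope_direction \<tau> \<in> ball (c i) (r i))" for i
    define J where "J i = {T i - 8 * r i .. T i + 8 * r i}" for i
    have "D \<subseteq> (\<Union>i. J i)"
    proof
      fix \<tau> assume t: "\<tau> \<in> D"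
      then obtain i where i: "slope_direction \<tau> \<in> ball (c i) (r i)" using DN cov by blast
      have t01: "\<tau> \<in> {0..1}" using D(2) t by blast
      have Ti: "T i \<in> {0..1} \<and> slope_direction (T i) \<in> ball (c i) (r i)"
        unfolding T_def by (rule someI[of _ \<tau>]) (use i t01 in blast)
      have "dist (slope_direction \<tau>) (slope_direction (T i)) \<le> 2 * r i"
        using i Ti dist_triangle3[of "slope_direction \<tau>" "slope_direction (T i)" "c i"] by auto
      then have "\<bar>\<tau> - T i\<bar> \<le> 8 * r i" using slope_direction_dist[OF t01, of "T i"] Ti by linarith
      then have "\<tau> \<in> J i" by (auto simp: J_def abs_le_iff)
      then show "\<tau> \<in> (\<Union>i. J i)" by blast
    qed
    then have "emeasure lborel D \<le> emeasure lborel (\<Union>i. J i)"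
      by (rule emeasure_mono) (auto simp: J_def)
    also have "\<dots> \<le> (\<Sum>i. emeasure lborel (J i))"
      by (rule emeasure_subadditive_countably) (auto simp: J_def)
    also have "\<dots> = (\<Sum>i. ennreal 16 * ennreal (r i powr 1))"
    proof (intro arg_cong[where f=suminf] ext)
      fix i
      have "emeasure lborel (J i) = ennreal (16 * r i powr 1)" using r[of i] by (simp add: J_def)
      then show "emeasure lborel (J i) = ennreal 16 * ennreal (r i powr 1)" by (simp only: ennreal_mult')
    qed
    also have "\<dots> = ennreal 16 * (\<Sum>i. ennreal (r i powr 1))" by (rule ennreal_suminf_cmult)
    also have "\<dots> \<le> ennreal 16 * ennreal (\<epsilon> / 16)" using sum by (intro mult_left_mono less_imp_le) auto
    also have "\<dots> = ennreal (16 * (\<epsilon> / 16))" using e by (intro ennreal_mult[symmetric]) auto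
    finally show ?thesis by simp
  qed
  then have "emeasure lborel D \<le> 0 + ennreal \<epsilon>" if "\<epsilon> > 0" for \<epsilon> using that by simp
  then have "emeasure lborel D \<le> 0" by (rule ennreal_le_epsilon)
  then show ?thesis by simp
qed

section \<open>Visible parts and the theorem\<close>

lemma visible_part_scale:
  assumes "c > 0"
  shows "visible_part (c *\<^sub>R e) K = visible_part e K"
proof -
  have "{x + t *\<^sub>R (c *\<^sub>R e) | t. 0 \<le> t} = {x + t *\<^sub>R e | t. 0 \<le> t}" for x
  proof (intro equalityI subsetI)
    fix y assume "y \<in> {x + t *\<^sub>R (c *\<^sub>R e) | t. 0 \<le> t}"
    then obtain t where "y = x + t *\<^sub>R (c *\<^sub>R e)" "0 \<le> t" by blast
    then show "y \<in> {x + t *\<^sub>R e | t. 0 \<le> t}" using assms by (auto intro!: exI[of _ "t * c"])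
  next
    fix y assume "y \<in> {x + t *\<^sub>R e | t. 0 \<le> t}"
    then obtain t where "y = x + t *\<^sub>R e" "0 \<le> t" by blast
    then show "y \<in> {x + t *\<^sub>R (c *\<^sub>R e) | t. 0 \<le> t}" using assms by (auto intro!: exI[of _ "t / c"])
  qed
  then show ?thesis by (simp only: visible_part_def)
qed

lemma mem_visible_part_iff:
  assumes "e \<noteq> 0"
  shows "x \<in> visible_part e K \<longleftrightarrow> x \<in> K \<and> (\<forall>t>0. x + t *\<^sub>R e \<notin> K)"
proof -
  have "{x + t *\<^sub>R e | t. 0 \<le> t} \<inter> K = {x} \<longleftrightarrow> (\<forall>t>0. x + t *\<^sub>R e \<notin> K)" if x: "x \<in> K"
  proof
    assume eq: "{x + t *\<^sub>R e | t. 0 \<le> t} \<inter> K = {x}"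
    show "\<forall>t>0. x + t *\<^sub>R e \<notin> K"
    proof (intro allI impI notI)
      fix t :: real assume t: "t > 0" "x + t *\<^sub>R e \<in> K"
      then have "x + t *\<^sub>R e \<in> {x + t *\<^sub>R e | t. 0 \<le> t} \<inter> K" by (auto intro!: exI[of _ t])
      then show False using eq assms t(1) by simp
    qed
  next
    assume n: "\<forall>t>0. x + t *\<^sub>R e \<notin> K"
    have "y = x" if y: "y \<in> {x + t *\<^sub>R e | t. 0 \<le> t} \<inter> K" for y
    proof -
      obtain t where t: "y = x + t *\<^sub>R e" "0 \<le> t" "y \<in> K" using y by blast
      then have "\<not> 0 < t" using n by blast
      then show ?thesis using t by simp
    qed
    moreover have "x \<in> {x + t *\<^sub>R e | t. 0 \<le> t}" by (auto intro!: exI[of _ 0])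
    ultimately show "{x + t *\<^sub>R e | t. 0 \<le> t} \<inter> K = {x}" using x by blast
  qed
  then show ?thesis unfolding visible_part_def by blast
qed

lemma open_not_blocked:
  fixes K :: "'a::real_normed_vector set"
  assumes "closed K"
  shows "open {(e, x). \<forall>t\<in>{a..b}. x + t *\<^sub>R e \<notin> K}"
proof -
  have "closed {(e, x). \<exists>t\<in>{a..b}. x + t *\<^sub>R e \<in> K}"
    unfolding closed_sequential_limits
  proof (intro allI impI, elim conjE)
    fix z l assume z: "\<forall>n::nat. z n \<in> {(e, x). \<exists>t\<in>{a..b}. x + t *\<^sub>R e \<in> K}" and lim: "z \<longlonglongrightarrow> l"
    have "\<forall>n. \<exists>t. t \<in> {a..b} \<and> snd (z n) + t *\<^sub>R fst (z n) \<in> K"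
      using z by (simp only: mem_Collect_eq split_def Bex_def simp_thms)
    then obtain t where t: "\<And>n. t n \<in> {a..b}" "\<And>n. snd (z n) + t n *\<^sub>R fst (z n) \<in> K" by metis
    obtain s r where s: "s \<in> {a..b}" "strict_mono (r::nat\<Rightarrow>nat)" "(t \<circ> r) \<longlonglongrightarrow> s"
      using compact_Icc[of a b] t(1) unfolding compact_def by metis
    have zr: "(z \<circ> r) \<longlonglongrightarrow> l" by (rule LIMSEQ_subseq_LIMSEQ[OF lim s(2)])
    have seq: "(\<lambda>n. snd ((z \<circ> r) n) + (t \<circ> r) n *\<^sub>R fst ((z \<circ> r) n)) \<longlonglongrightarrow> snd l + s *\<^sub>R fst l"
      by (intro tendsto_intros zr s(3))
    have inK: "snd ((z \<circ> r) n) + (t \<circ> r) n *\<^sub>R fst ((z \<circ> r) n) \<in> K" for n using t(2)[of "r n"] by simp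
    have "snd l + s *\<^sub>R fst l \<in> K" by (rule closed_sequentially[OF assms inK seq])
    then show "l \<in> {(e, x). \<exists>t\<in>{a..b}. x + t *\<^sub>R e \<in> K}" using s(1) by (auto simp: split_def)
  qed
  moreover have "{(e, x). \<forall>t\<in>{a..b}. x + t *\<^sub>R e \<notin> K} = - {(e, x). \<exists>t\<in>{a..b}. x + t *\<^sub>R e \<in> K}" by auto
  ultimately show ?thesis by (simp add: open_Compl)
qed

text \<open>The times \<open>t > 0\<close> are exhausted by compact intervals bounded away from \<open>0\<close>, and each of these contributes
  an open condition on \<open>(e, x)\<close> by \<open>open_not_blocked\<close>.\<close>

lemma visible_pairs_G_delta:
  fixes K :: "(real ^ 'd) set"
  assumes e: "1 \<le> norm e"
  shows "x \<in> visible_part e K \<longleftrightarrow>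
    x \<in> K \<and> (e, x) \<in> (\<Inter>n::nat. {(e, x). \<forall>t\<in>{1 / real (Suc n)..real (Suc n)}. x + t *\<^sub>R e \<notin> K})"
proof -
  have "e \<noteq> 0" using e by auto
  have "(\<forall>t>0. x + t *\<^sub>R e \<notin> K) \<longleftrightarrow> (\<forall>n. \<forall>t\<in>{1 / real (Suc n)..real (Suc n)}. x + t *\<^sub>R e \<notin> K)"
  proof
    assume L: "\<forall>t>0. x + t *\<^sub>R e \<notin> K"
    show "\<forall>n. \<forall>t\<in>{1 / real (Suc n)..real (Suc n)}. x + t *\<^sub>R e \<notin> K"
    proof (intro allI ballI)
      fix n t assume "t \<in> {1 / real (Suc n)..real (Suc n)}"
      then have "1 / real (Suc n) \<le> t" by simp
      moreover have "0 < 1 / real (Suc n)" by simp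
      ultimately show "x + t *\<^sub>R e \<notin> K" using L by (meson less_le_trans)
    qed
  next
    assume R: "\<forall>n. \<forall>t\<in>{1 / real (Suc n)..real (Suc n)}. x + t *\<^sub>R e \<notin> K"
    show "\<forall>t>0. x + t *\<^sub>R e \<notin> K"
    proof (intro allI impI)
      fix t :: real assume t: "t > 0"
      obtain n :: nat where n: "max t (1 / t) \<le> real n" using real_arch_simple by blast
      have "1 / t \<le> real (Suc n)" using n by simp
      then have "1 / real (Suc n) \<le> t" using t by (simp add: field_simps)
      then have "t \<in> {1 / real (Suc n)..real (Suc n)}" using n by simp
      then show "x + t *\<^sub>R e \<notin> K" using R by blast
    qed
  qed
  then show ?thesis using mem_visible_part_iff[OF \<open>e \<noteq> 0\<close>] by blast
qed

text \<open>Lebesgue measure is invariant under \<open>u \<mapsto> u + \<tau> w\<close> for every \<open>\<tau>\<close>, so averaging over \<open>\<tau>\<close> does not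
  change the measure of \<open>T\<close>. All directions \<open>u + \<tau> w\<close> lie in the plane spanned by \<open>u\<close> and \<open>w\<close>.\<close>

lemma exists_shifted_line:
  fixes T :: "('a::euclidean_space \<times> ('a \<times> 'a)) set"
  assumes T: "T \<in> sets borel" and pos: "emeasure lborel T > 0"
  shows "\<exists>u a w. emeasure lborel {\<tau> \<in> {0..1}. (u + \<tau> *\<^sub>R w, (a, w)) \<in> T} > 0"
proof (rule ccontr)
  assume "\<not> ?thesis"
  then have zero: "emeasure lborel {\<tau> \<in> {0..1}. (u + \<tau> *\<^sub>R w, (a, w)) \<in> T} = 0" for u a w
    by (simp add: zero_less_iff_neq_zero)
  have Tm [measurable]: "(\<lambda>z. (f z, g z)) \<in> measurable M borel \<Longrightarrow> (\<lambda>z. indicator T (f z, g z) :: ennreal) \<in> borel_measurable M"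
    for f g and M :: "'m measure"
    by (erule measurable_compose[OF _ borel_measurable_indicator[OF T]])
  define h where "h u y \<tau> = (indicator T (u + \<tau> *\<^sub>R snd y, y) :: ennreal)" for u y \<tau>
  have hm: "(\<lambda>z. h (u z) (y z) (\<tau> z)) \<in> borel_measurable M"
    if [measurable]: "u \<in> borel_measurable M" "y \<in> borel_measurable M" "\<tau> \<in> borel_measurable M"
    for u y \<tau> and M :: "'m measure"
    unfolding h_def by (intro Tm borel_measurable_Pair) measurable
  have "emeasure lborel T = (\<integral>\<^sup>+z. indicator T z \<partial>lborel)" using T by simp
  also have "\<dots> = (\<integral>\<^sup>+y. \<integral>\<^sup>+u. indicator T (u, y) \<partial>lborel \<partial>lborel)"
    by (rule nn_integral_pair_snd_first) (use T in auto)
  also have "\<dots> = (\<integral>\<^sup>+y. \<integral>\<^sup>+\<tau>. indicator {0..1} \<tau> * (\<integral>\<^sup>+u. h u y \<tau> \<partial>lborel) \<partial>lborel \<partial>lborel)"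
  proof (rule nn_integral_cong)
    fix y :: "'a \<times> 'a"
    have "(\<integral>\<^sup>+u. h u y \<tau> \<partial>lborel) = (\<integral>\<^sup>+u. indicator T (u, y) \<partial>lborel)" for \<tau>
      unfolding h_def by (rule nn_integral_translate[of "\<lambda>u. indicator T (u, y)"])
        (intro Tm borel_measurable_Pair, auto)
    then show "(\<integral>\<^sup>+u. indicator T (u, y) \<partial>lborel) = (\<integral>\<^sup>+\<tau>. indicator {0..1::real} \<tau> * (\<integral>\<^sup>+u. h u y \<tau> \<partial>lborel) \<partial>lborel)"
      by (simp add: nn_integral_multc)
  qed
  also have "\<dots> = (\<integral>\<^sup>+y. \<integral>\<^sup>+\<tau>. \<integral>\<^sup>+u. indicator {0..1} \<tau> * h u y \<tau> \<partial>lborel \<partial>lborel \<partial>lborel)"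
    by (intro nn_integral_cong nn_integral_cmult[symmetric]) (auto intro!: hm)
  also have "\<dots> = (\<integral>\<^sup>+y. \<integral>\<^sup>+u. \<integral>\<^sup>+\<tau>. indicator {0..1} \<tau> * h u y \<tau> \<partial>lborel \<partial>lborel \<partial>lborel)"
    by (intro nn_integral_cong lborel_pair.Fubini')
      (simp add: split_def, intro borel_measurable_times_ennreal hm; measurable)
  also have "\<dots> = 0"
  proof -
    have "(\<integral>\<^sup>+\<tau>. indicator {0..1} \<tau> * h u y \<tau> \<partial>lborel) = 0" for u y
    proof -
      have "{\<tau> \<in> {0..1}. (u + \<tau> *\<^sub>R snd y, y) \<in> T} \<in> sets borel"
      proof -
        have "(\<lambda>\<tau>::real. (u + \<tau> *\<^sub>R snd y, y)) \<in> borel_measurable borel"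
          by (intro borel_measurable_continuous_onI continuous_intros)
        from measurable_sets[OF this T] show ?thesis
          by (simp add: vimage_def Collect_conj_eq sets.Int)
      qed
      then have "(\<integral>\<^sup>+\<tau>. indicator {\<tau> \<in> {0..1}. (u + \<tau> *\<^sub>R snd y, y) \<in> T} \<tau> \<partial>lborel) = 0"
        using zero[of u "snd y" "fst y"] by simp
      moreover have "(\<lambda>\<tau>. indicator {0..1} \<tau> * h u y \<tau>) = (indicator {\<tau> \<in> {0..1}. (u + \<tau> *\<^sub>R snd y, y) \<in> T} :: real \<Rightarrow> ennreal)"
        by (auto simp: h_def indicator_def fun_eq_iff)
      ultimately show ?thesis by simp
    qed
    then show ?thesis by simp
  qed
  finally show False using pos by simp
qed

text \<open>By the slicing theorem the section of the union of the closed sets \<open>T i\<close> over a direction with a large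
  section of \<open>Z\<close> has positive measure, hence some \<open>T i\<close> has positive measure.\<close>

lemma exists_plane_with_bad_directions:
  fixes Z :: "((real ^ 'd) \<times> (real ^ 'd)) set"
  assumes Z: "compact Z" and k: "0 < k" and s: "0 < s" "real CARD('d) - 1 < s" "s \<le> real CARD('d)"
    and t: "0 < t" "t < s - real CARD('d) + 2"
    and pos: "emeasure lborel {e. \<not> small_cover s k {x. (e, x) \<in> Z}} > 0"
  shows "\<exists>u a w \<kappa> D. 0 < \<kappa> \<and> D \<in> sets borel \<and> D \<subseteq> {0..1} \<and> emeasure lborel D > 0 \<and>
    (\<forall>\<tau>\<in>D. \<not> small_cover t \<kappa> {p \<in> unit_square. (u + \<tau> *\<^sub>R w, plane_point (u + \<tau> *\<^sub>R w) a w p) \<in> Z})"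
proof -
  let ?W = "cube_box (0 :: real ^ 'd) 1"
  let ?S = "\<lambda>e y. {p \<in> unit_square. (e, plane_point e (fst y) (snd y) p) \<in> Z}"
  let ?B = "\<lambda>e \<kappa>. costly_planes t \<kappa> e {x. (e, x) \<in> Z}"
  have sec: "compact {x. (e, x) \<in> Z}" for e by (rule compact_section[OF Z])
  define E1 where "E1 = {e. \<not> small_cover s k {x. (e, x) \<in> Z}}"
  define T where "T i = {z. snd (snd z) \<in> ?W \<and> \<not> small_cover t (1 / real (Suc i)) (?S (fst z) (snd z))}" for i
  have Tclosed: "closed (T i)" for i
  proof -
    let ?G = "{(z, p). p \<in> unit_square \<and> (fst z, plane_point (fst z) (fst (snd z)) (snd (snd z)) p) \<in> Z}
      :: (((real ^ 'd) \<times> ((real ^ 'd) \<times> (real ^ 'd))) \<times> (real \<times> real)) set"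
    have "?G = snd -` unit_square \<inter> (\<lambda>(z, p). (fst z, plane_point (fst z) (fst (snd z)) (snd (snd z)) p)) -` Z" by auto
    moreover have "closed (snd -` unit_square :: (((real ^ 'd) \<times> ((real ^ 'd) \<times> (real ^ 'd))) \<times> (real \<times> real)) set)"
      by (intro closed_vimage) (auto intro!: continuous_intros)
    moreover have "closed ((\<lambda>(z, p). (fst z, plane_point (fst z) (fst (snd z)) (snd (snd z)) p)) -` Z
       :: (((real ^ 'd) \<times> ((real ^ 'd) \<times> (real ^ 'd))) \<times> (real \<times> real)) set)"
      using compact_imp_closed[OF Z] by (intro closed_vimage) (auto simp: plane_point_def split_def intro!: continuous_intros)
    ultimately have "closed ?G" by (simp add: closed_Int)
    then have "closed {z. \<not> small_cover t (1 / real (Suc i)) {p. (z, p) \<in> ?G}}"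
      by (rule closed_not_small_cover[OF _ compact_cbox]) auto
    moreover have "closed ((\<lambda>z. snd (snd z)) -` ?W :: ((real ^ 'd) \<times> ((real ^ 'd) \<times> (real ^ 'd))) set)"
      by (intro closed_vimage) (auto intro!: continuous_intros)
    moreover have "T i = {z. \<not> small_cover t (1 / real (Suc i)) {p. (z, p) \<in> ?G}} \<inter> (\<lambda>z. snd (snd z)) -` ?W"
      by (auto simp: T_def)
    ultimately show ?thesis by (simp add: closed_Int)
  qed
  then have Tb: "T i \<in> sets borel" for i by simp
  have "\<exists>i. emeasure lborel (T i) > 0"
  proof (rule ccontr)
    assume "\<not> ?thesis"
    then have "emeasure lborel (T i) = 0" for i by (simp add: zero_less_iff_neq_zero)
    then have "(\<Union>i. T i) \<in> null_sets lborel" using Tb by (intro null_sets_UN) (auto simp: null_sets_def)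
    then have "(\<Union>i. T i) \<in> null_sets (lborel \<Otimes>\<^sub>M lborel)" by (simp add: lborel_prod)
    then have "AE z in lborel \<Otimes>\<^sub>M lborel. z \<notin> (\<Union>i. T i)" by (rule AE_not_in)
    then have "AE e in lborel. AE y in lborel. (e, y) \<notin> (\<Union>i. T i)" by (rule lborel_pair.AE_pair)
    then obtain N where N: "N \<in> null_sets lborel" "{e. \<not> (AE y in lborel. (e, y) \<notin> (\<Union>i. T i))} \<subseteq> N"
      unfolding eventually_ae_filter by auto
    have "E1 \<subseteq> N"
    proof
      fix e assume e: "e \<in> E1"
      obtain \<kappa> where \<kappa>: "\<kappa> > 0" "emeasure lborel (?B e \<kappa>) > 0"
        using slices_not_small_cover[OF sec k _ s t, of e] e unfolding E1_def by blast
      obtain i where i: "inverse (real (Suc i)) < \<kappa>" using reals_Archimedean[OF \<kappa>(1)] by blast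
      have "?B e \<kappa> \<subseteq> Pair e -` (T i)"
      proof
        fix y assume y: "y \<in> ?B e \<kappa>"
        have "\<not> small_cover t (1 / real (Suc i)) (?S e y)"
        proof
          assume "small_cover t (1 / real (Suc i)) (?S e y)"
          then have "small_cover t \<kappa> (?S e y)"
            by (rule small_cover_mono) (use i in \<open>simp add: inverse_eq_divide\<close>)
          then show False using y by simp
        qed
        then show "y \<in> Pair e -` (T i)" using y by (simp add: T_def)
      qed
      then have sub: "?B e \<kappa> \<subseteq> Pair e -` (\<Union>i. T i)"
        by blast
      show "e \<in> N"
      proof (rule ccontr)
        assume "e \<notin> N"
        then have "AE y in lborel. (e, y) \<notin> (\<Union>i. T i)" using N(2) by blast
        then have "AE y in lborel. y \<notin> ?B e \<kappa>"
          by (rule eventually_mono) (use sub in blast)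
        then have "emeasure lborel {y \<in> space lborel. y \<in> ?B e \<kappa>} = 0" by (intro emeasure_eq_0_AE) simp
        then show False using \<kappa>(2) by simp
      qed
    qed
    then have "emeasure lborel E1 \<le> emeasure lborel N" using N(1) by (intro emeasure_mono) auto
    then show False using N(1) pos unfolding E1_def by (simp add: null_sets_def)
  qed
  then obtain i where i: "emeasure lborel (T i) > 0" by blast
  obtain u a w where uaw: "emeasure lborel {\<tau> \<in> {0..1}. (u + \<tau> *\<^sub>R w, (a, w)) \<in> T i} > 0"
    using exists_shifted_line[OF Tb i] by blast
  define D where "D = {\<tau> \<in> {0..1}. (u + \<tau> *\<^sub>R w, (a, w)) \<in> T i}"
  have "D = {0..1} \<inter> (\<lambda>\<tau>. (u + \<tau> *\<^sub>R w, (a, w))) -` (T i)" by (auto simp: D_def)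
  moreover have "closed ((\<lambda>\<tau>::real. (u + \<tau> *\<^sub>R w, (a, w))) -` (T i))"
    by (intro closed_vimage Tclosed continuous_intros)
  ultimately have Db: "D \<in> sets borel" by simp
  have "\<not> small_cover t (1 / real (Suc i)) {p \<in> unit_square. (u + \<tau> *\<^sub>R w, plane_point (u + \<tau> *\<^sub>R w) a w p) \<in> Z}" if "\<tau> \<in> D" for \<tau>
    using that by (simp add: D_def T_def del: of_nat_Suc)
  moreover have "0 < 1 / real (Suc i)" by simp
  moreover have "D \<subseteq> {0..1}" by (auto simp: D_def)
  moreover have "emeasure lborel D > 0" using uaw by (simp add: D_def)
  ultimately show ?thesis using Db by blast
qed

text \<open>In the coordinates given by \<open>w\<close> and \<open>u\<close>, the direction \<open>u + \<tau> w\<close> is \<open>(\<tau>, 1)\<close>. The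
  coordinates with respect to \<open>w\<close> and \<open>u + \<tau> w\<close>, in which the sets \<open>S \<tau>\<close> are given, differ from these
  by the shear \<open>\<psi>\<close>. Cutting the plane section down to a bounded square can only make more points
  visible.\<close>

lemma planar_slice_contradiction:
  fixes K :: "(real ^ 'd) set" and u a w :: "real ^ 'd"
  assumes K: "compact K" and b: "1 \<le> b" "b < t" and \<kappa>: "0 < \<kappa>"
    and planar: "\<And>A :: (real ^ 2) set. compact A \<Longrightarrow>
      hausdorff_ae 1 (sphere 0 1) (\<lambda>v. hausdorff_dim (visible_part v A) \<le> ereal b)"
    and D: "D \<in> sets borel" "D \<subseteq> {0..1}" "emeasure lborel D > 0"
    and vis: "\<And>\<tau> p. \<tau> \<in> D \<Longrightarrow> p \<in> S \<tau> \<Longrightarrow> p \<in> unit_square \<and> u + \<tau> *\<^sub>R w \<noteq> 0 \<and>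
       plane_point (u + \<tau> *\<^sub>R w) a w p \<in> visible_part (u + \<tau> *\<^sub>R w) K"
    and nsc: "\<And>\<tau>. \<tau> \<in> D \<Longrightarrow> \<not> small_cover t \<kappa> (S \<tau>)"
  shows False
proof -
  define A where "A = {q :: real ^ 2. (\<forall>i. \<bar>q $ i\<bar> \<le> 2) \<and> a + q $ 1 *\<^sub>R w + q $ 2 *\<^sub>R u \<in> K}"
  have "A = cube_box 0 2 \<inter> (\<lambda>q. a + q $ 1 *\<^sub>R w + q $ 2 *\<^sub>R u) -` K"
    by (rule set_eqI) (simp only: A_def mem_Collect_eq Int_iff vimage_eq mem_cube_box zero_index diff_zero)
  moreover have "closed ((\<lambda>q :: real ^ 2. a + q $ 1 *\<^sub>R w + q $ 2 *\<^sub>R u) -` K)"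
    using compact_imp_closed[OF K] by (intro closed_vimage) (auto intro!: continuous_intros)
  ultimately have A: "compact A" by (simp only: compact_Int_closed compact_cbox)
  define N where "N = {v \<in> sphere 0 1. \<not> hausdorff_dim (visible_part v A) \<le> ereal b}"
  have N: "hausdorff_measure 1 N = 0" using planar[OF A] by (simp add: hausdorff_ae_def N_def)
  have "slope_direction \<tau> \<in> N" if \<tau>: "\<tau> \<in> D" for \<tau>
  proof (rule ccontr)
    assume "slope_direction \<tau> \<notin> N"
    then have "hausdorff_dim (visible_part (slope_direction \<tau>) A) \<le> ereal b" by (simp add: N_def norm_slope_direction)
    also have "ereal b < ereal t" using b by simp
    finally have H: "hausdorff_measure t (visible_part (slope_direction \<tau>) A) = 0" by (rule hausdorff_measure_0_above_dim)
    have "1 + \<tau>\<^sup>2 > 0" by (smt (verit) zero_le_power2)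
    then have "visible_part (slope_direction \<tau>) A = visible_part (vector [\<tau>, 1]) A"
      unfolding slope_direction_def by (intro visible_part_scale) simp
    then have H': "small_cover t (\<kappa> / 3 powr t) (visible_part (vector [\<tau>, 1]) A)"
      using H small_cover_if_hausdorff_null[of t "visible_part (vector [\<tau>, 1]) A" "\<kappa> / 3 powr t"] b \<kappa> by simp
    have t01: "0 \<le> \<tau>" "\<tau> \<le> 1" using D(2) \<tau> by auto
    define \<psi> where "\<psi> q = (q $ 1 - \<tau> * q $ 2, q $ 2)" for q :: "real ^ 2"
    have "small_cover t (3 powr t * (\<kappa> / 3 powr t)) (\<psi> ` visible_part (vector [\<tau>, 1]) A)"
    proof (rule small_cover_lipschitz_image[OF H'])
      fix p q :: "real ^ 2"
      have c: "\<bar>p $ i - q $ i\<bar> \<le> dist p q" for i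
        using component_le_norm_cart[of "p - q" i] by (simp add: dist_norm)
      have "\<bar>\<tau> * (p $ 2 - q $ 2)\<bar> \<le> 1 * \<bar>p $ 2 - q $ 2\<bar>"
        unfolding abs_mult using t01 by (intro mult_right_mono) auto
      then have shear: "\<bar>\<tau> * (p $ 2 - q $ 2)\<bar> \<le> dist p q" using c[of 2] by simp
      have "dist (\<psi> p) (\<psi> q) \<le> dist (fst (\<psi> p)) (fst (\<psi> q)) + dist (snd (\<psi> p)) (snd (\<psi> q))"
        unfolding dist_prod_def by (rule sqrt_sum_squares_le_sum) auto
      also have "dist (fst (\<psi> p)) (fst (\<psi> q)) = \<bar>(p $ 1 - q $ 1) - \<tau> * (p $ 2 - q $ 2)\<bar>"
        by (simp add: \<psi>_def dist_real_def algebra_simps)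
      also have "dist (snd (\<psi> p)) (snd (\<psi> q)) = \<bar>p $ 2 - q $ 2\<bar>" by (simp add: \<psi>_def dist_real_def)
      also have "\<bar>(p $ 1 - q $ 1) - \<tau> * (p $ 2 - q $ 2)\<bar> + \<bar>p $ 2 - q $ 2\<bar> \<le> 3 * dist p q"
      proof -
        have "\<bar>x - y\<bar> + \<bar>z\<bar> \<le> 3 * m" if "\<bar>x\<bar> \<le> m" "\<bar>y\<bar> \<le> m" "\<bar>z\<bar> \<le> m" for x y z m :: real
          using that by linarith
        from this[OF c[of 1] shear c[of 2]] show ?thesis .
      qed
      finally show "dist (\<psi> p) (\<psi> q) \<le> 3 * dist p q" .
    qed simp
    then have "small_cover t \<kappa> (\<psi> ` visible_part (vector [\<tau>, 1]) A)" by simp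
    moreover have "S \<tau> \<subseteq> \<psi> ` visible_part (vector [\<tau>, 1]) A"
    proof
      fix p assume p: "p \<in> S \<tau>"
      let ?e = "u + \<tau> *\<^sub>R w"
      have pJ: "p \<in> unit_square" and e0: "?e \<noteq> 0" and pv: "plane_point ?e a w p \<in> visible_part ?e K"
        using vis[OF \<tau> p] by auto
      define q :: "real ^ 2" where "q = vector [fst p + \<tau> * snd p, snd p]"
      have q: "q $ 1 = fst p + \<tau> * snd p" "q $ 2 = snd p" by (simp_all add: q_def)
      have line: "a + (q + r *\<^sub>R vector [\<tau>, 1]) $ 1 *\<^sub>R w + (q + r *\<^sub>R vector [\<tau>, 1]) $ 2 *\<^sub>R u = plane_point ?e a w p + r *\<^sub>R ?e" for r
        by (simp add: q plane_point_def algebra_simps)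
      have pv': "plane_point ?e a w p \<in> K" "\<And>r. r > 0 \<Longrightarrow> plane_point ?e a w p + r *\<^sub>R ?e \<notin> K"
        using pv mem_visible_part_iff[OF e0] by auto
      have bd: "\<bar>q $ 1\<bar> \<le> 2" "\<bar>q $ 2\<bar> \<le> 2"
      proof -
        have p01: "0 \<le> fst p" "fst p \<le> 1" "0 \<le> snd p" "snd p \<le> 1" using pJ by (auto simp: mem_unit_square)
        have "0 \<le> \<tau> * snd p" "\<tau> * snd p \<le> 1" using t01 p01 by (auto intro!: mult_le_one)
        then show "\<bar>q $ 1\<bar> \<le> 2" "\<bar>q $ 2\<bar> \<le> 2" using p01 by (auto simp: q)
      qed
      have qA: "q \<in> A" using bd pv'(1) line[of 0] by (simp add: A_def forall_2)
      have "vector [\<tau>, 1] \<noteq> (0 :: real ^ 2)" by (metis vector_2(2) zero_index zero_neq_one)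
      moreover have "q + r *\<^sub>R vector [\<tau>, 1] \<notin> A" if "r > 0" for r
        using pv'(2)[OF that] unfolding A_def mem_Collect_eq line by blast
      ultimately have "q \<in> visible_part (vector [\<tau>, 1]) A" using qA mem_visible_part_iff by blast
      moreover have "\<psi> q = p" by (simp add: \<psi>_def q)
      ultimately show "p \<in> \<psi> ` visible_part (vector [\<tau>, 1]) A" by blast
    qed
    ultimately have "small_cover t \<kappa> (S \<tau>)" by (rule small_cover_subset)
    then show False using nsc[OF \<tau>] by simp
  qed
  then have "emeasure lborel D = 0" by (rule null_of_hausdorff_null_directions[OF N D(1,2)])
  then show False using D(3) by simp
qed

text \<open>The G-delta set of visible pairs is replaced by a compact subset, slicing this subset produces one plane
  in which many directions are bad, and there the planar hypothesis is violated.\<close>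

lemma visible_content_null:
  fixes b :: real and K :: "(real ^ 'd) set"
  assumes b: "1 \<le> b"
    and planar: "\<And>A :: (real ^ 2) set. compact A \<Longrightarrow>
      hausdorff_ae 1 (sphere 0 1) (\<lambda>v. hausdorff_dim (visible_part v A) \<le> ereal b)"
    and d: "CARD('d) \<ge> 2" and K: "compact K"
    and s: "real CARD('d) - 2 + b < s" "s \<le> real CARD('d)" and k: "0 < k"
  shows "outer_measure_of lborel {e. 1 \<le> norm e \<and> norm e \<le> 2 \<and> ennreal k < dyadic_content s (visible_part e K)} = 0"
proof (rule ccontr)
  let ?d = "real CARD('d)"
  define R where "R = {e :: real ^ 'd. 1 \<le> norm e \<and> norm e \<le> 2}"
  define G where "G n = {(e :: real ^ 'd, x). \<forall>t\<in>{1 / real (Suc n)..real (Suc n)}. x + t *\<^sub>R e \<notin> K}" for n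
  let ?A = "{e. 1 \<le> norm e \<and> norm e \<le> 2 \<and> ennreal k < dyadic_content s (visible_part e K)}"
  let ?B = "{e. ennreal k < dyadic_content s {x. (e, x) \<in> (R \<times> K) \<inter> (\<Inter>n. G n)}}"
  assume ne: "\<not> ?thesis"
  have Rc: "compact R"
  proof -
    have "R = cball 0 2 \<inter> {e. 1 \<le> norm e}" by (auto simp: R_def)
    moreover have "closed {e :: real ^ 'd. 1 \<le> norm e}" by (intro closed_Collect_le continuous_intros)
    ultimately show ?thesis by (simp add: compact_Int_closed)
  qed
  have sec: "{x. (e, x) \<in> (R \<times> K) \<inter> (\<Inter>n. G n)} = visible_part e K" if "e \<in> R" for e
  proof -
    have "1 \<le> norm e" using that by (simp add: R_def)
    from visible_pairs_G_delta[OF this, of _ K] show ?thesis using that unfolding G_def by blast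
  qed
  have "?A
    \<subseteq> ?B"
  proof
    fix e assume e: "e \<in> ?A"
    then have "e \<in> R" by (simp add: R_def)
    from sec[OF this] show "e \<in> ?B"
      using e by simp
  qed
  then have le: "outer_measure_of lborel ?A
    \<le> outer_measure_of lborel ?B"
    by (rule outer_measure_of_mono)
  have pos: "outer_measure_of lborel ?B > 0"
    by (rule less_le_trans[OF _ le]) (use ne in \<open>simp only: zero_less_iff_neq_zero simp_thms\<close>)
  have s0: "0 < s" "?d - 1 < s" using s b d by auto
  have RK: "compact (R \<times> K)" using Rc K by (rule compact_Times)
  have Go: "open (G n)" for n unfolding G_def by (rule open_not_blocked[OF compact_imp_closed[OF K]])
  from compact_section_not_small_cover[OF RK Go s0(1) k pos]
  obtain Z k' where Z: "compact Z" "Z \<subseteq> (R \<times> K) \<inter> (\<Inter>n. G n)" "k' > 0"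
    "emeasure lborel {e. \<not> small_cover s k' {x. (e, x) \<in> Z}} > 0" by blast
  define t where "t = (b + (s - ?d + 2)) / 2"
  have t: "b < t" "t < s - ?d + 2" "0 < t" using s b by (auto simp: t_def)
  obtain u a w \<kappa> D where D: "0 < \<kappa>" "D \<in> sets borel" "D \<subseteq> {0..1}" "emeasure lborel D > 0"
    "\<And>\<tau>. \<tau> \<in> D \<Longrightarrow> \<not> small_cover t \<kappa> {p \<in> unit_square. (u + \<tau> *\<^sub>R w, plane_point (u + \<tau> *\<^sub>R w) a w p) \<in> Z}"
    using exists_plane_with_bad_directions[OF Z(1,3) s0 s(2) t(3,2) Z(4)] by blast
  show False
  proof (rule planar_slice_contradiction[OF K b t(1) D(1) planar D(2-4) _ D(5)])
    fix \<tau> p assume "p \<in> {p \<in> unit_square. (u + \<tau> *\<^sub>R w, plane_point (u + \<tau> *\<^sub>R w) a w p) \<in> Z}"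
    then have p: "p \<in> unit_square" "(u + \<tau> *\<^sub>R w, plane_point (u + \<tau> *\<^sub>R w) a w p) \<in> (R \<times> K) \<inter> (\<Inter>n. G n)"
      using Z(2) by auto
    then have R: "u + \<tau> *\<^sub>R w \<in> R" by blast
    then have "u + \<tau> *\<^sub>R w \<noteq> 0" by (auto simp: R_def)
    moreover have "plane_point (u + \<tau> *\<^sub>R w) a w p \<in> visible_part (u + \<tau> *\<^sub>R w) K" using sec[OF R] p(2) by blast
    ultimately show "p \<in> unit_square \<and> u + \<tau> *\<^sub>R w \<noteq> 0 \<and> plane_point (u + \<tau> *\<^sub>R w) a w p \<in> visible_part (u + \<tau> *\<^sub>R w) K"
      using p(1) by blast
  qed
qed

lemma outer_measure_of_0_UN:
  assumes "\<And>i::nat. outer_measure_of lborel (A i) = 0"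
  shows "outer_measure_of lborel (\<Union>i. A i) = 0"
proof -
  have "\<exists>B. B \<in> null_sets lborel \<and> A i \<subseteq> B" for i
    using outer_measure_of_attain[of "A i" lborel] assms[of i] by (auto simp: null_sets_def)
  then obtain B where B: "\<And>i. B i \<in> null_sets lborel" "\<And>i. A i \<subseteq> B i" by metis
  have "outer_measure_of lborel (\<Union>i. A i) \<le> outer_measure_of lborel (\<Union>i. B i)"
    by (rule outer_measure_of_mono) (use B(2) in blast)
  also have "\<dots> = 0" using null_sets_UN[of B lborel] B(1) by (simp add: null_sets_def)
  finally show ?thesis by simp
qed

theorem theorem1p2:
  fixes b :: real and K :: "(real ^ 'd) set"
  assumes "1 \<le> b" and "b \<le> 2"
    and planar: "\<And>A :: (real ^ 2) set. compact A \<Longrightarrow>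
      hausdorff_ae 1 (sphere 0 1) (\<lambda>v. hausdorff_dim (visible_part v A) \<le> ereal b)"
    and "CARD('d) \<ge> 3"
    and "compact K"
  shows "hausdorff_ae (real CARD('d) - 1) (sphere 0 1)
    (\<lambda>e. hausdorff_dim (visible_part e K)
       \<le> min (hausdorff_dim K) (ereal (real CARD('d) - 2 + b)))"
proof -
  let ?v = "real CARD('d) - 2 + b"
  let ?E = "{e \<in> sphere 0 1. \<not> hausdorff_dim (visible_part e K) \<le> min (hausdorff_dim K) (ereal ?v)}"
  let ?cone = "{x. 1 \<le> norm x \<and> norm x \<le> 2 \<and> (1 / norm x) *\<^sub>R x \<in> ?E}"
  have v0: "0 \<le> ?v" using assms(1,4) by simp
  have KV: "visible_part e K \<subseteq> K" for e by (auto simp: visible_part_def)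
  define A where "A n j = {e :: real ^ 'd. 1 \<le> norm e \<and> norm e \<le> 2 \<and>
     ennreal (1 / real (Suc j)) < dyadic_content (?v + 1 / real (Suc n)) (visible_part e K)}" for n j
  \<comment> \<open>for \<open>b < 2\<close> the exponents close to \<open>d - 2 + b\<close> are at most \<open>d\<close>; for \<open>b = 2\<close> no exponent above \<open>d\<close> matters\<close>
  obtain m :: nat where m: "\<And>n. n \<ge> m \<Longrightarrow> b < 2 \<Longrightarrow> ?v + 1 / real (Suc n) \<le> real CARD('d)"
  proof (cases "b < 2")
    case True
    then obtain m where m: "inverse (real (Suc m)) < 2 - b" using reals_Archimedean[of "2 - b"] by auto
    have "?v + 1 / real (Suc n) \<le> real CARD('d)" if "n \<ge> m" for n
    proof -
      have "1 / real (Suc n) \<le> 1 / real (Suc m)" using that by (intro divide_left_mono) auto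
      then show ?thesis using m by (simp add: inverse_eq_divide del: of_nat_Suc)
    qed
    then show ?thesis using that by blast
  qed (use that in blast)
  have null: "outer_measure_of lborel ?cone = 0"
  proof (cases "b < 2")
    case True
    have A0: "outer_measure_of lborel (A (n + m) j) = 0" for n j
      unfolding A_def
      by (rule visible_content_null[OF assms(1) planar _ assms(5)])
        (use assms(4) m[of "n + m"] True in auto)
    have "?cone \<subseteq> (\<Union>n. \<Union>j. A (n + m) j)"
    proof
      fix x :: "real ^ 'd"
      assume x: "x \<in> ?cone"
      then have "1 / norm x > 0" by (auto intro: less_le_trans[of 0 1])
      then have eq: "visible_part ((1 / norm x) *\<^sub>R x) K = visible_part x K" by (rule visible_part_scale)
      have "\<not> hausdorff_dim (visible_part x K) \<le> ereal ?v"
        using x hausdorff_dim_subset[OF KV[of x]] by (auto simp: eq)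
      then obtain n where n: "n \<ge> m" "hausdorff_measure (?v + 1 / real (Suc n)) (visible_part x K) \<noteq> 0"
        using hausdorff_dim_le_if_null_above[OF v0, of m] by blast
      have "0 < ?v + 1 / real (Suc n)" using v0 by (intro add_nonneg_pos) auto
      then have "dyadic_content (?v + 1 / real (Suc n)) (visible_part x K) \<noteq> 0"
        using hausdorff_null_if_dyadic_content_0 n(2) by blast
      then have "0 < dyadic_content (?v + 1 / real (Suc n)) (visible_part x K)"
        by (simp add: zero_less_iff_neq_zero)
      then obtain y where y: "0 < y" "y < dyadic_content (?v + 1 / real (Suc n)) (visible_part x K)"
        using dense by blast
      have "y < top" by (rule less_le_trans[OF y(2) top_greatest])
      then obtain \<epsilon> where "y = ennreal \<epsilon>" by (cases y) auto
      then have \<epsilon>: "0 < ennreal \<epsilon>" "ennreal \<epsilon> < dyadic_content (?v + 1 / real (Suc n)) (visible_part x K)"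
        using y by simp_all
      then have "\<epsilon> > 0" by simp
      then obtain j where "inverse (real (Suc j)) < \<epsilon>" using reals_Archimedean by blast
      then have "ennreal (1 / real (Suc j)) \<le> ennreal \<epsilon>" by (intro ennreal_leI) (simp add: inverse_eq_divide)
      also note \<epsilon>(2)
      finally have "x \<in> A n j" using x by (simp add: A_def del: of_nat_Suc)
      moreover have "n = (n - m) + m" using n(1) by simp
      ultimately show "x \<in> (\<Union>n. \<Union>j. A (n + m) j)" by (metis UN_I UNIV_I)
    qed
    then have "outer_measure_of lborel ?cone
      \<le> outer_measure_of lborel (\<Union>n. \<Union>j. A (n + m) j)" by (rule outer_measure_of_mono)
    also have "\<dots> = 0" by (intro outer_measure_of_0_UN A0)
    finally show ?thesis by (simp only: le_zero_eq)
  next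
    case False
    then have b: "b = 2" using assms(2) by simp
    have "hausdorff_dim (visible_part e K) \<le> ereal ?v" for e
    proof (rule hausdorff_dim_le_if_null_above[OF v0, of 0])
      fix n :: nat
      have "bounded (visible_part e K)" by (rule bounded_subset[OF compact_imp_bounded[OF assms(5)] KV])
      then show "hausdorff_measure (?v + 1 / real (Suc n)) (visible_part e K) = 0"
        by (rule hausdorff_null_above_space_dimension) (simp add: b)
    qed
    then have "e \<notin> ?E" for e using hausdorff_dim_subset[OF KV] by simp
    then have "?cone = {}" by blast
    then show ?thesis by (simp only: outer_measure_of_eq[OF sets.empty_sets] emeasure_empty)
  qed
  have "hausdorff_measure (real CARD('d) - 1) ?E = 0"
    by (rule hausdorff_null_of_null_cone[OF _ _ null]) (use assms(4) in auto)
  then show ?thesis by (simp only: hausdorff_ae_def)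
qed

end
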